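(* Let $k$ be a commutative ring, and let $A_1$ and $A_2$ be $k$-algebras such that (i) the structure map $k\to A_1$ admits a $k$-module-theoretic left inverse $\pi: A_1\to k$, whose kernel we denote $M_1$; and (ii) $A_2$ admits a surjective $k$-algebra homomorphism $\psi: A_2\to k[x]/(x^3)$. Write $x$ also for the image of $x$ in $k[x]/(x^3)$, and also for a fixed element of $A_2$ mapped by $\psi$ to that image. Then in the coproduct ("free product") $B$ of $A_1$ and $A_2$ as $k$-algebras, the $k$-submodule $x\,M_1\,x$ is isomorphic to $M_1$, and it generates a nonunital $k$-subalgebra $A\subseteq B$ isomorphic to the nonunital tensor algebra on the $k$-module $M_1$ (namely $\bigoplus_{n\ge 1} M_1^{\otimes_k n}$); and this subalgebra $A$ has the ideal extension property in $B$. Hence, any $k$-algebra $A_0$ which admits a $k$-algebra homomorphism $A_0\to k$, and which can be generated as a $k$-algebra by a $k$-module homomorphic image of $M_1$ (i.e. by the image of some $k$-module homomorphism $M_1\to A_0$), can be embedded in a $k$-algebra $R$ generated by an image of $A_1$ and an image of $A_2$ (under $k$-algebra homomorphisms $A_1\to R$ and $A_2\to R$). Moreover, these images can be taken to be isomorphic copies of $A_1$ and $A_2$ (i.e. $R$ can be chosen so that these two homomorphisms are injective).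
   Context: Rings and algebras are associative and, unless called nonunital, unital, with homomorphisms and embeddings respecting $1$. "Nonunital" means "not necessarily unital". The ring $k$ is unital. A nonunital subalgebra $A$ of an algebra $B$ is said to have the ideal extension property in $B$ if every (two-sided) ideal $I$ of $A$ (as a nonunital $k$-algebra, so that $I$ is in particular a $k$-submodule) is the intersection of $A$ with a two-sided ideal $J$ of $B$; equivalently, $I=A\cap J$ where $J$ is the ideal of $B$ generated by $I$. *)

theory Defs
  imports "HOL-Algebra.UnivPoly" "HOL-Algebra.QuotRing"
begin

section \<open>Associative algebras over a commutative ring\<close>

text \<open>
  The locale \<^locale>\<open>algebra\<close> of the library requires a commutative multiplication.
  The base ring may be the zero ring.
\<close>

locale assoc_algebra = module + M?: ring M +
  assumes smult_mult_left:
      "\<lbrakk>a \<in> carrier R; x \<in> carrier M; y \<in> carrier M\<rbrakk>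
        \<Longrightarrow> (a \<odot>\<^bsub>M\<^esub> x) \<otimes>\<^bsub>M\<^esub> y = a \<odot>\<^bsub>M\<^esub> (x \<otimes>\<^bsub>M\<^esub> y)"
    and smult_mult_right:
      "\<lbrakk>a \<in> carrier R; x \<in> carrier M; y \<in> carrier M\<rbrakk>
        \<Longrightarrow> x \<otimes>\<^bsub>M\<^esub> (a \<odot>\<^bsub>M\<^esub> y) = a \<odot>\<^bsub>M\<^esub> (x \<otimes>\<^bsub>M\<^esub> y)"

definition base_algebra :: "('k, 'm) ring_scheme \<Rightarrow> ('k, 'k) module"
  where "base_algebra K =
    \<lparr>carrier = carrier K, mult = mult K, one = one K, zero = zero K, add = add K,
     smult = mult K\<rparr>"

definition mod_hom ::
    "('k, 'm) ring_scheme \<Rightarrow> ('k, 'a, 'n) module_scheme \<Rightarrow> ('k, 'b, 'p) module_scheme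
      \<Rightarrow> ('a \<Rightarrow> 'b) set"
  where "mod_hom K M N =
    {h \<in> carrier M \<rightarrow> carrier N.
      (\<forall>x\<in>carrier M. \<forall>y\<in>carrier M. h (x \<oplus>\<^bsub>M\<^esub> y) = h x \<oplus>\<^bsub>N\<^esub> h y) \<and>
      (\<forall>c\<in>carrier K. \<forall>x\<in>carrier M. h (c \<odot>\<^bsub>M\<^esub> x) = c \<odot>\<^bsub>N\<^esub> h x)}"

definition alg_hom ::
    "('k, 'm) ring_scheme \<Rightarrow> ('k, 'a, 'n) module_scheme \<Rightarrow> ('k, 'b, 'p) module_scheme
      \<Rightarrow> ('a \<Rightarrow> 'b) set"
  where "alg_hom K A B = ring_hom A B \<inter> mod_hom K A B"

text \<open>
  Modules and nonunital algebras are represented by the same records as unital algebras;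
  the components \<^const>\<open>one\<close> and, for modules, \<^const>\<open>mult\<close> are then ignored.
\<close>

definition mod_isomorphic ::
    "('k, 'm) ring_scheme \<Rightarrow> ('k, 'a, 'n) module_scheme \<Rightarrow> ('k, 'b, 'p) module_scheme \<Rightarrow> bool"
  where "mod_isomorphic K M N \<longleftrightarrow> (\<exists>h\<in>mod_hom K M N. bij_betw h (carrier M) (carrier N))"

definition nonunital_alg_isomorphic ::
    "('k, 'm) ring_scheme \<Rightarrow> ('k, 'a, 'n) module_scheme \<Rightarrow> ('k, 'b, 'p) module_scheme \<Rightarrow> bool"
  where "nonunital_alg_isomorphic K A B \<longleftrightarrow>
    (\<exists>h\<in>mod_hom K A B. bij_betw h (carrier A) (carrier B) \<and>
      (\<forall>x\<in>carrier A. \<forall>y\<in>carrier A. h (x \<otimes>\<^bsub>A\<^esub> y) = h x \<otimes>\<^bsub>B\<^esub> h y))"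

definition nonunital_subalgebra ::
    "'a set \<Rightarrow> ('k, 'm) ring_scheme \<Rightarrow> ('k, 'a, 'n) module_scheme \<Rightarrow> bool"
  where "nonunital_subalgebra H K B \<longleftrightarrow>
    submodule H K B \<and> (\<forall>x\<in>H. \<forall>y\<in>H. x \<otimes>\<^bsub>B\<^esub> y \<in> H)"

definition unital_subalgebra ::
    "'a set \<Rightarrow> ('k, 'm) ring_scheme \<Rightarrow> ('k, 'a, 'n) module_scheme \<Rightarrow> bool"
  where "unital_subalgebra H K B \<longleftrightarrow> nonunital_subalgebra H K B \<and> \<one>\<^bsub>B\<^esub> \<in> H"

definition nonunital_subalgebra_generated ::
    "('k, 'm) ring_scheme \<Rightarrow> ('k, 'a, 'n) module_scheme \<Rightarrow> 'a set \<Rightarrow> 'a set"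
  where "nonunital_subalgebra_generated K B S =
    \<Inter>{H. nonunital_subalgebra H K B \<and> S \<subseteq> H}"

definition unital_subalgebra_generated ::
    "('k, 'm) ring_scheme \<Rightarrow> ('k, 'a, 'n) module_scheme \<Rightarrow> 'a set \<Rightarrow> 'a set"
  where "unital_subalgebra_generated K B S =
    \<Inter>{H. unital_subalgebra H K B \<and> S \<subseteq> H}"

definition nonunital_ideal ::
    "'a set \<Rightarrow> ('k, 'm) ring_scheme \<Rightarrow> ('k, 'a, 'n) module_scheme \<Rightarrow> bool"
  where "nonunital_ideal I K A \<longleftrightarrow>
    submodule I K A \<and> (\<forall>a\<in>carrier A. \<forall>x\<in>I. a \<otimes>\<^bsub>A\<^esub> x \<in> I \<and> x \<otimes>\<^bsub>A\<^esub> a \<in> I)"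

text \<open>
  Ideals of the unital algebra \<open>B\<close> are automatically submodules, so the library notion
  \<^const>\<open>ideal\<close> applies to \<open>B\<close>; for ideals of the subalgebra \<open>A\<close> the condition is needed.
\<close>

definition ideal_extension_property ::
    "'a set \<Rightarrow> ('k, 'm) ring_scheme \<Rightarrow> ('k, 'a, 'n) module_scheme \<Rightarrow> bool"
  where "ideal_extension_property A K B \<longleftrightarrow>
    (\<forall>I. nonunital_ideal I K (B\<lparr>carrier := A\<rparr>) \<longrightarrow> (\<exists>J. ideal J B \<and> I = A \<inter> J))"


section \<open>Quotients\<close>

text \<open>
  The quotient ring of the library, with scalar multiplication added.  For a submodule \<open>H\<close>
  that is not an ideal, only the module structure of the result is meaningful.
\<close>

definition quot_module :: "('k, 'a, 'n) module_scheme \<Rightarrow> 'a set \<Rightarrow> ('k, 'a set) module"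
  where "quot_module M H =
    ring.extend (M Quot H)
      (module.fields (\<lambda>c X. \<Union>x\<in>X. H +>\<^bsub>M\<^esub> (c \<odot>\<^bsub>M\<^esub> x)))"

definition submodule_generated ::
    "('k, 'm) ring_scheme \<Rightarrow> ('k, 'a, 'n) module_scheme \<Rightarrow> 'a set \<Rightarrow> 'a set"
  where "submodule_generated K M S = \<Inter>{H. submodule H K M \<and> S \<subseteq> H}"

definition poly_x :: "('k, 'm) ring_scheme \<Rightarrow> nat \<Rightarrow> 'k"
  where "poly_x K = monom (UP K) \<one>\<^bsub>K\<^esub> 1"

definition poly_x_cubed_ideal :: "('k, 'm) ring_scheme \<Rightarrow> (nat \<Rightarrow> 'k) set"
  where "poly_x_cubed_ideal K = PIdl\<^bsub>UP K\<^esub> (poly_x K [^]\<^bsub>UP K\<^esub> (3::nat))"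

definition truncated_poly :: "('k, 'm) ring_scheme \<Rightarrow> ('k, (nat \<Rightarrow> 'k) set) module"
  where "truncated_poly K = quot_module (UP K) (poly_x_cubed_ideal K)"

definition truncated_x :: "('k, 'm) ring_scheme \<Rightarrow> (nat \<Rightarrow> 'k) set"
  where "truncated_x K = poly_x_cubed_ideal K +>\<^bsub>UP K\<^esub> poly_x K"


section \<open>Free algebras and coproducts\<close>

text \<open>
  Elements of the free algebra on \<open>S\<close> are finitely supported functions on the words over \<open>S\<close>;
  multiplication extends concatenation of words.
\<close>

definition word_elem :: "('k, 'm) ring_scheme \<Rightarrow> 's list \<Rightarrow> 's list \<Rightarrow> 'k"
  where "word_elem K w = (\<lambda>v. if v = w then \<one>\<^bsub>K\<^esub> else \<zero>\<^bsub>K\<^esub>)"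

definition free_algebra :: "('k, 'm) ring_scheme \<Rightarrow> 's set \<Rightarrow> ('k, 's list \<Rightarrow> 'k) module"
  where "free_algebra K S =
    \<lparr>carrier = {f. range f \<subseteq> carrier K \<and> finite {w. f w \<noteq> \<zero>\<^bsub>K\<^esub>} \<and> {w. f w \<noteq> \<zero>\<^bsub>K\<^esub>} \<subseteq> lists S},
     mult = (\<lambda>f g w. \<Oplus>\<^bsub>K\<^esub>i\<in>{..length w}. f (take i w) \<otimes>\<^bsub>K\<^esub> g (drop i w)),
     one = word_elem K [],
     zero = (\<lambda>w. \<zero>\<^bsub>K\<^esub>),
     add = (\<lambda>f g w. f w \<oplus>\<^bsub>K\<^esub> g w),
     smult = (\<lambda>c f w. c \<otimes>\<^bsub>K\<^esub> f w)\<rparr>"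

text \<open>
  The relations which force \<open>a \<mapsto> word_elem K [i a]\<close> to become an algebra homomorphism
  from \<open>A\<close> to a quotient of the algebra \<open>F\<close>.
\<close>

definition hom_relations ::
    "('k, 'm) ring_scheme \<Rightarrow> ('k, 's list \<Rightarrow> 'k, 'p) module_scheme
      \<Rightarrow> ('k, 'a, 'n) module_scheme \<Rightarrow> ('a \<Rightarrow> 's) \<Rightarrow> ('s list \<Rightarrow> 'k) set"
  where "hom_relations K F A i =
    (let e = (\<lambda>a. word_elem K [i a]) in
      {e (a \<oplus>\<^bsub>A\<^esub> b) \<ominus>\<^bsub>F\<^esub> (e a \<oplus>\<^bsub>F\<^esub> e b) | a b. a \<in> carrier A \<and> b \<in> carrier A} \<union>
      {e (a \<otimes>\<^bsub>A\<^esub> b) \<ominus>\<^bsub>F\<^esub> (e a \<otimes>\<^bsub>F\<^esub> e b) | a b. a \<in> carrier A \<and> b \<in> carrier A} \<union>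
      {e (c \<odot>\<^bsub>A\<^esub> a) \<ominus>\<^bsub>F\<^esub> (c \<odot>\<^bsub>F\<^esub> e a) | c a. c \<in> carrier K \<and> a \<in> carrier A} \<union>
      {e \<one>\<^bsub>A\<^esub> \<ominus>\<^bsub>F\<^esub> \<one>\<^bsub>F\<^esub>})"

definition coprod_ideal ::
    "('k, 'm) ring_scheme \<Rightarrow> ('k, 'a, 'n) module_scheme \<Rightarrow> ('k, 'b, 'p) module_scheme
      \<Rightarrow> (('a + 'b) list \<Rightarrow> 'k) set"
  where "coprod_ideal K A1 A2 =
    (let F = free_algebra K (carrier A1 <+> carrier A2)
     in Idl\<^bsub>F\<^esub> (hom_relations K F A1 Inl \<union> hom_relations K F A2 Inr))"

definition coprod_algebra ::
    "('k, 'm) ring_scheme \<Rightarrow> ('k, 'a, 'n) module_scheme \<Rightarrow> ('k, 'b, 'p) module_scheme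
      \<Rightarrow> ('k, (('a + 'b) list \<Rightarrow> 'k) set) module"
  where "coprod_algebra K A1 A2 =
    quot_module (free_algebra K (carrier A1 <+> carrier A2)) (coprod_ideal K A1 A2)"

definition coprod_inl ::
    "('k, 'm) ring_scheme \<Rightarrow> ('k, 'a, 'n) module_scheme \<Rightarrow> ('k, 'b, 'p) module_scheme
      \<Rightarrow> 'a \<Rightarrow> (('a + 'b) list \<Rightarrow> 'k) set"
  where "coprod_inl K A1 A2 a =
    coprod_ideal K A1 A2 +>\<^bsub>free_algebra K (carrier A1 <+> carrier A2)\<^esub> word_elem K [Inl a]"

definition coprod_inr ::
    "('k, 'm) ring_scheme \<Rightarrow> ('k, 'a, 'n) module_scheme \<Rightarrow> ('k, 'b, 'p) module_scheme
      \<Rightarrow> 'b \<Rightarrow> (('a + 'b) list \<Rightarrow> 'k) set"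
  where "coprod_inr K A1 A2 b =
    coprod_ideal K A1 A2 +>\<^bsub>free_algebra K (carrier A1 <+> carrier A2)\<^esub> word_elem K [Inr b]"


section \<open>Tensor powers and the nonunital tensor algebra\<close>

text \<open>
  The \<open>n\<close>-th tensor power of \<open>M\<close> is the free module on \<open>n\<close>-tuples of elements of \<open>M\<close>, realized as
  the homogeneous component of degree \<open>n\<close> of the free algebra on the set \<open>carrier M\<close>, modulo
  the multilinearity relations.
\<close>

definition tuple_module ::
    "('k, 'm) ring_scheme \<Rightarrow> ('k, 'a, 'n) module_scheme \<Rightarrow> nat \<Rightarrow> ('k, 'a list \<Rightarrow> 'k) module"
  where "tuple_module K M n =
    (free_algebra K (carrier M))\<lparr>carrier :=
      {f \<in> carrier (free_algebra K (carrier M)). \<forall>w. f w \<noteq> \<zero>\<^bsub>K\<^esub> \<longrightarrow> length w = n}\<rparr>"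

definition multilinear_relations ::
    "('k, 'm) ring_scheme \<Rightarrow> ('k, 'a, 'n) module_scheme \<Rightarrow> nat \<Rightarrow> ('a list \<Rightarrow> 'k) set"
  where "multilinear_relations K M n =
    (let e = word_elem K; F = tuple_module K M n in
      {e (u @ [x \<oplus>\<^bsub>M\<^esub> y] @ v) \<ominus>\<^bsub>F\<^esub> (e (u @ [x] @ v) \<oplus>\<^bsub>F\<^esub> e (u @ [y] @ v)) | u v x y.
        u \<in> lists (carrier M) \<and> v \<in> lists (carrier M) \<and> x \<in> carrier M \<and> y \<in> carrier M \<and>
        length u + 1 + length v = n} \<union>
      {e (u @ [c \<odot>\<^bsub>M\<^esub> x] @ v) \<ominus>\<^bsub>F\<^esub> (c \<odot>\<^bsub>F\<^esub> e (u @ [x] @ v)) | u v c x.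
        u \<in> lists (carrier M) \<and> v \<in> lists (carrier M) \<and> c \<in> carrier K \<and> x \<in> carrier M \<and>
        length u + 1 + length v = n})"

definition multilinear_submodule ::
    "('k, 'm) ring_scheme \<Rightarrow> ('k, 'a, 'n) module_scheme \<Rightarrow> nat \<Rightarrow> ('a list \<Rightarrow> 'k) set"
  where "multilinear_submodule K M n =
    submodule_generated K (tuple_module K M n) (multilinear_relations K M n)"

definition tensor_power ::
    "('k, 'm) ring_scheme \<Rightarrow> ('k, 'a, 'n) module_scheme \<Rightarrow> nat
      \<Rightarrow> ('k, ('a list \<Rightarrow> 'k) set) module"
  where "tensor_power K M n = quot_module (tuple_module K M n) (multilinear_submodule K M n)"

text \<open>
  The canonical map from the \<open>i\<close>-th and \<open>j\<close>-th tensor powers to the \<open>(i+j)\<close>-th one, induced by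
  concatenation of tuples.
\<close>

definition tensor_mult ::
    "('k, 'm) ring_scheme \<Rightarrow> ('k, 'a, 'n) module_scheme \<Rightarrow> nat \<Rightarrow> nat
      \<Rightarrow> ('a list \<Rightarrow> 'k) set \<Rightarrow> ('a list \<Rightarrow> 'k) set \<Rightarrow> ('a list \<Rightarrow> 'k) set"
  where "tensor_mult K M i j X Y =
    rcoset_mult (free_algebra K (carrier M)) (multilinear_submodule K M (i + j)) X Y"

text \<open>
  The direct sum of the tensor powers of positive degree: families with finite support, which are
  \<^const>\<open>undefined\<close> in degree \<open>0\<close>.
\<close>

definition nonunital_tensor_algebra ::
    "('k, 'm) ring_scheme \<Rightarrow> ('k, 'a, 'n) module_scheme
      \<Rightarrow> ('k, nat \<Rightarrow> ('a list \<Rightarrow> 'k) set) module"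
  where "nonunital_tensor_algebra K M =
    \<lparr>carrier = {t \<in> \<Pi>\<^sub>E n\<in>{1..}. carrier (tensor_power K M n).
        finite {n \<in> {1..}. t n \<noteq> \<zero>\<^bsub>tensor_power K M n\<^esub>}},
     mult = (\<lambda>s t. \<lambda>n\<in>{1..}.
        \<Oplus>\<^bsub>tensor_power K M n\<^esub>i\<in>{1..<n}. tensor_mult K M i (n - i) (s i) (t (n - i))),
     one = undefined,
     zero = (\<lambda>n\<in>{1..}. \<zero>\<^bsub>tensor_power K M n\<^esub>),
     add = (\<lambda>s t. \<lambda>n\<in>{1..}. s n \<oplus>\<^bsub>tensor_power K M n\<^esub> t n),
     smult = (\<lambda>c t. \<lambda>n\<in>{1..}. c \<odot>\<^bsub>tensor_power K M n\<^esub> t n)\<rparr>"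

end

theory Submission
  imports Defs
begin

text \<open>
  Let \<open>T\<close> be the tensor algebra on \<open>M1\<close>, as a quotient of the free algebra on the set \<open>M1\<close>, let
  \<open>I\<close> be an ideal of \<open>T\<close> inside its augmentation ideal, and put \<open>Q = T/I\<close>.  No normal form for the
  coproduct is needed: it suffices to let \<open>B\<close> act on a module such that each product \<open>x m x\<close>
  acts, up to a splitting, as left multiplication by \<open>m\<close> on \<open>Q\<close>.  Then an element of \<open>A\<close> acts as
  zero exactly if it comes from \<open>I\<close>, so the annihilator of the module is an ideal of \<open>B\<close> that meets
  \<open>A\<close> in the image of \<open>I\<close>.  The case \<open>I = 0\<close> shows that \<open>A\<close> is the tensor algebra, the general case
  is the ideal extension property, and \<open>Q = A0\<close> gives the embedding.

  The module is \<open>Hom(A1, P)\<close> for \<open>P = Q \<times> Q\<close>, where \<open>A1\<close> acts by \<open>(a h)(b) = h(b a)\<close> and \<open>A2\<close> acts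
  through \<open>\<psi>\<close>, with \<open>(x h)(b) = (m p2, \<pi>(b) p1)\<close> for \<open>h(1) = (p1, p2)\<close> and \<open>m = b - \<pi>(b)\<close>; one
  checks that \<open>x\<^sup>3\<close> acts as zero.  Two more representations, in which every \<open>x m x\<close> acts as zero,
  are faithful on \<open>A1\<close> and on \<open>A2\<close>; intersecting the kernels keeps both algebras embedded in
  the quotient.
\<close>

section \<open>Modules and algebras\<close>

text \<open>\<open>Q\<close> carries no action of \<open>A1\<close>, and as \<pi> is only
  \<open>K\<close>-linear, \<open>M1\<close> need not be closed under multiplication. Coinduction
  supplies an \<open>A1\<close>-module nevertheless: since \<open>(a h)(1) = h(a)\<close>, an
  operator that reads \<open>h(1)\<close> and writes its values on \<open>K 1\<close> and on
  \<open>M1\<close> through the linear splitting alone can be probed by acting with \<open>m\<close>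
  afterwards. The exponent 3 comes from \<open>(x m x)(x m' x) = x m x^2 m' x\<close>: an action
  with \<open>x^2 = 0\<close> would kill every product of two generators. This is why
  \<open>P\<close> has two slots. In the direction of 1, \<open>x\<close> shifts slot 1 into slot 2;
  in the direction of \<open>m\<close>, it multiplies slot 2 by \<open>m\<close> and writes the
  result into slot 1. So \<open>x m x\<close> leads from slot 2 back to slot 2 with factor
  \<open>m\<close>, while \<open>x^3\<close> contains the shift twice in a row, which is zero.
  Constant terms need separate care: 1 acts as the identity, whereas nonempty products of the
  \<open>x m x\<close> see only slot 2 of \<open>h(1)\<close>. The comparison with \<open>Q\<close>
  is therefore made on elements without constant term, and the representation that is faithful on
  \<open>A1\<close> also detects the constant term.\<close>

lemma mod_homI:
  assumes "\<And>x. x \<in> carrier M \<Longrightarrow> h x \<in> carrier N"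
    and "\<And>x y. x \<in> carrier M \<Longrightarrow> y \<in> carrier M \<Longrightarrow> h (x \<oplus>\<^bsub>M\<^esub> y) = h x \<oplus>\<^bsub>N\<^esub> h y"
    and "\<And>c x. c \<in> carrier K \<Longrightarrow> x \<in> carrier M \<Longrightarrow> h (c \<odot>\<^bsub>M\<^esub> x) = c \<odot>\<^bsub>N\<^esub> h x"
  shows "h \<in> mod_hom K M N"
  using assms by (auto simp: mod_hom_def)

lemma mod_homD:
  assumes "h \<in> mod_hom K M N"
  shows "x \<in> carrier M \<Longrightarrow> h x \<in> carrier N"
    and "x \<in> carrier M \<Longrightarrow> y \<in> carrier M \<Longrightarrow> h (x \<oplus>\<^bsub>M\<^esub> y) = h x \<oplus>\<^bsub>N\<^esub> h y"
    and "c \<in> carrier K \<Longrightarrow> x \<in> carrier M \<Longrightarrow> h (c \<odot>\<^bsub>M\<^esub> x) = c \<odot>\<^bsub>N\<^esub> h x"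
  using assms by (auto simp: mod_hom_def)

lemma mod_hom_zero:
  assumes "module K M" "module K N" "h \<in> mod_hom K M N"
  shows "h \<zero>\<^bsub>M\<^esub> = \<zero>\<^bsub>N\<^esub>"
proof -
  interpret M: module K M by fact
  interpret N: module K N by fact
  have "h (\<zero>\<^bsub>K\<^esub> \<odot>\<^bsub>M\<^esub> \<zero>\<^bsub>M\<^esub>) = \<zero>\<^bsub>K\<^esub> \<odot>\<^bsub>N\<^esub> h \<zero>\<^bsub>M\<^esub>"
    by (rule mod_homD(3)[OF assms(3)]) auto
  then show ?thesis
    using mod_homD(1)[OF assms(3), of "\<zero>\<^bsub>M\<^esub>"] by simp
qed

lemma mod_hom_a_inv:
  assumes "module K M" "module K N" "h \<in> mod_hom K M N" "x \<in> carrier M"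
  shows "h (\<ominus>\<^bsub>M\<^esub> x) = \<ominus>\<^bsub>N\<^esub> h x"
proof -
  interpret M: module K M by fact
  interpret N: module K N by fact
  have "h (\<ominus>\<^bsub>M\<^esub> x) \<oplus>\<^bsub>N\<^esub> h x = \<zero>\<^bsub>N\<^esub>"
    using mod_homD(2)[OF assms(3), of "\<ominus>\<^bsub>M\<^esub> x" x] assms(4) mod_hom_zero[OF assms(1-3)]
    by (simp add: M.M.l_neg)
  then show ?thesis
    using mod_homD(1)[OF assms(3)] assms(4) N.M.minus_equality by (metis M.M.add.inv_closed)
qed

lemma mod_hom_minus:
  assumes "module K M" "module K N" "h \<in> mod_hom K M N" "x \<in> carrier M" "y \<in> carrier M"
  shows "h (x \<ominus>\<^bsub>M\<^esub> y) = h x \<ominus>\<^bsub>N\<^esub> h y"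
proof -
  interpret M: module K M by fact
  interpret N: module K N by fact
  show ?thesis
    using assms by (simp add: a_minus_def mod_homD(2)[OF assms(3)] mod_hom_a_inv[OF assms(1-3)])
qed

lemma alg_homI:
  assumes "h \<in> mod_hom K A B"
    and "\<And>x y. x \<in> carrier A \<Longrightarrow> y \<in> carrier A \<Longrightarrow> h (x \<otimes>\<^bsub>A\<^esub> y) = h x \<otimes>\<^bsub>B\<^esub> h y"
    and "h \<one>\<^bsub>A\<^esub> = \<one>\<^bsub>B\<^esub>"
  shows "h \<in> alg_hom K A B"
  using assms by (auto simp: alg_hom_def mod_hom_def ring_hom_def)

lemma alg_homD:
  assumes "h \<in> alg_hom K A B"
  shows "h \<in> mod_hom K A B"
    and "x \<in> carrier A \<Longrightarrow> h x \<in> carrier B"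
    and "x \<in> carrier A \<Longrightarrow> y \<in> carrier A \<Longrightarrow> h (x \<oplus>\<^bsub>A\<^esub> y) = h x \<oplus>\<^bsub>B\<^esub> h y"
    and "c \<in> carrier K \<Longrightarrow> x \<in> carrier A \<Longrightarrow> h (c \<odot>\<^bsub>A\<^esub> x) = c \<odot>\<^bsub>B\<^esub> h x"
    and "x \<in> carrier A \<Longrightarrow> y \<in> carrier A \<Longrightarrow> h (x \<otimes>\<^bsub>A\<^esub> y) = h x \<otimes>\<^bsub>B\<^esub> h y"
    and "h \<one>\<^bsub>A\<^esub> = \<one>\<^bsub>B\<^esub>"
  using assms by (auto simp: alg_hom_def mod_hom_def ring_hom_def)

lemma alg_hom_comp:
  assumes "f \<in> alg_hom K A B" "g \<in> alg_hom K B C"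
  shows "g \<circ> f \<in> alg_hom K A C"
  using assms by (auto simp: alg_hom_def mod_hom_def ring_hom_def Pi_def)

lemma assoc_algebra_module: "assoc_algebra K A \<Longrightarrow> module K A"
  by (simp add: assoc_algebra_def)

lemma assoc_algebra_ring: "assoc_algebra K A \<Longrightarrow> ring A"
  by (simp add: assoc_algebra_def)

lemma assoc_algebraI:
  assumes "module K A" "ring A"
    and "\<And>a x y. a \<in> carrier K \<Longrightarrow> x \<in> carrier A \<Longrightarrow> y \<in> carrier A \<Longrightarrow>
      (a \<odot>\<^bsub>A\<^esub> x) \<otimes>\<^bsub>A\<^esub> y = a \<odot>\<^bsub>A\<^esub> (x \<otimes>\<^bsub>A\<^esub> y)"
    and "\<And>a x y. a \<in> carrier K \<Longrightarrow> x \<in> carrier A \<Longrightarrow> y \<in> carrier A \<Longrightarrow>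
      x \<otimes>\<^bsub>A\<^esub> (a \<odot>\<^bsub>A\<^esub> y) = a \<odot>\<^bsub>A\<^esub> (x \<otimes>\<^bsub>A\<^esub> y)"
  shows "assoc_algebra K A"
  using assms by (simp add: assoc_algebra_def assoc_algebra_axioms_def)

lemma assoc_algebra_base:
  assumes "cring K"
  shows "assoc_algebra K (base_algebra K)"
proof -
  interpret K: cring K by fact
  have "abelian_group (base_algebra K)"
  proof (rule abelian_groupI)
    show "\<exists>y\<in>carrier (base_algebra K). y \<oplus>\<^bsub>base_algebra K\<^esub> x = \<zero>\<^bsub>base_algebra K\<^esub>"
      if "x \<in> carrier (base_algebra K)" for x
      using that by (intro bexI[of _ "\<ominus>\<^bsub>K\<^esub> x"]) (auto simp: base_algebra_def K.l_neg)
  qed (auto simp: base_algebra_def K.a_ac)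
  note ab = this
  have "Group.monoid (base_algebra K)"
    by (rule monoidI) (simp_all add: base_algebra_def K.m_assoc)
  with ab have R: "ring (base_algebra K)"
    by (rule ringI) (simp_all add: base_algebra_def K.l_distr K.r_distr)
  have "module K (base_algebra K)"
    by (rule moduleI[OF assms ab]) (simp_all add: base_algebra_def K.l_distr K.r_distr K.m_assoc)
  then show ?thesis
    using R by (rule assoc_algebraI) (auto simp: base_algebra_def K.m_ac)
qed

lemma kernel_ideal:
  assumes "assoc_algebra K A" "assoc_algebra K B" "h \<in> alg_hom K A B"
  shows "ideal {a \<in> carrier A. h a = \<zero>\<^bsub>B\<^esub>} A"
proof -
  interpret ring_hom_ring A B h
    using assms by (intro ring_hom_ringI2) (simp_all add: assoc_algebra_ring alg_hom_def)
  show ?thesis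
    using kernel_is_ideal unfolding a_kernel_def' .
qed

text \<open>A scalar acts as multiplication by the algebra element \<open>c 1\<close>, so absorption
  already gives closure under scalars.\<close>

lemma ideal_imp_submodule:
  assumes "assoc_algebra K A" "ideal J A"
  shows "submodule J K A"
proof -
  interpret A: assoc_algebra K A by fact
  interpret J: ideal J A by fact
  show ?thesis
  proof (rule A.submoduleI)
    show "c \<odot>\<^bsub>A\<^esub> a \<in> J" if "c \<in> carrier K" "a \<in> J" for c a
    proof -
      have "c \<odot>\<^bsub>A\<^esub> a = (c \<odot>\<^bsub>A\<^esub> \<one>\<^bsub>A\<^esub>) \<otimes>\<^bsub>A\<^esub> a"
        using that by (simp add: A.smult_mult_left)
      then show ?thesis
        using that J.I_l_closed by simp
    qed
  qed (auto intro: J.a_Hcarr)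
qed

section \<open>Submodules: restriction, preimages, generation\<close>

lemma submodule_minus:
  assumes "module K M" "submodule H K M" "x \<in> H" "y \<in> H"
  shows "x \<ominus>\<^bsub>M\<^esub> y \<in> H"
  using module.submoduleE[OF assms(1,2)] assms(3,4) by (simp add: a_minus_def)

text \<open>The definition of the additive inverse refers to the carrier, so restricting the carrier
  changes the term; uniqueness of inverses in the submodule identifies the two.\<close>

lemma submodule_a_inv:
  assumes "module K M" "submodule H K M" "x \<in> H"
  shows "\<ominus>\<^bsub>M\<lparr>carrier := H\<rparr>\<^esub> x = \<ominus>\<^bsub>M\<^esub> x"
proof -
  interpret M: module K M by fact
  interpret H: module K "M\<lparr>carrier := H\<rparr>"
    by (rule submodule.submodule_is_module) fact+
  have "H \<subseteq> carrier M" "\<ominus>\<^bsub>M\<^esub> x \<in> H"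
    using M.submoduleE[OF assms(2)] assms(3) by auto
  then show ?thesis
    using H.M.minus_equality[of "\<ominus>\<^bsub>M\<^esub> x" x] assms(3) by (simp add: M.M.l_neg subset_iff)
qed

lemma submodule_trans:
  assumes "module K M" "submodule H K M" "submodule N K (M\<lparr>carrier := H\<rparr>)"
  shows "submodule N K M"
proof -
  interpret M: module K M by fact
  interpret H: module K "M\<lparr>carrier := H\<rparr>"
    by (rule submodule.submodule_is_module) fact+
  note N = H.submoduleE[OF assms(3)]
  have "H \<subseteq> carrier M"
    using M.submoduleE[OF assms(2)] by auto
  moreover have "\<ominus>\<^bsub>M\<^esub> a \<in> N" if "a \<in> N" for a
  proof -
    have "a \<in> H"
      using N(1) that by auto
    then show ?thesis
      using N(3)[OF that] submodule_a_inv[OF assms(1,2)] by simp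
  qed
  moreover have "\<zero>\<^bsub>M\<^esub> \<in> N"
    using subgroup.one_closed[OF submodule.axioms(1)[OF assms(3)]] by simp
  ultimately show ?thesis
    using N by (intro M.submoduleI) auto
qed

lemma submodule_zero: "submodule H K M \<Longrightarrow> \<zero>\<^bsub>M\<^esub> \<in> H"
  using subgroup.one_closed[OF submodule.axioms(1)] by fastforce

lemma zero_submodule:
  assumes "module K M"
  shows "submodule {\<zero>\<^bsub>M\<^esub>} K M"
proof -
  interpret M: module K M by fact
  show ?thesis
    by (rule M.submoduleI) auto
qed

lemma submodule_vimage:
  assumes "module K M" "module K N" "h \<in> mod_hom K M N" "submodule H K M" "submodule S K N"
  shows "submodule {a \<in> H. h a \<in> S} K M"
proof -
  interpret M: module K M by fact
  interpret N: module K N by fact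
  note H = M.submoduleE[OF assms(4)] and S = N.submoduleE[OF assms(5)]
  note hom = mod_homD[OF assms(3)] mod_hom_zero[OF assms(1-3)] mod_hom_a_inv[OF assms(1-3)]
  show ?thesis
    by (rule M.submoduleI)
      (use H S hom submodule_zero[OF assms(4)] submodule_zero[OF assms(5)] in \<open>auto simp: subset_iff\<close>)
qed

lemma submodule_generated_submodule:
  assumes "module K M" "S \<subseteq> carrier M"
  shows "submodule (submodule_generated K M S) K M" "S \<subseteq> submodule_generated K M S"
proof -
  interpret M: module K M by fact
  \<comment> \<open>The family is nonempty; an empty intersection would be the whole type.\<close>
  have car: "carrier M \<in> {H. submodule H K M \<and> S \<subseteq> H}"
    using M.carrier_is_submodule assms by auto
  show "submodule (submodule_generated K M S) K M"
    unfolding submodule_generated_def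
    by (rule M.submoduleI) (use car submodule_zero in \<open>auto intro: M.submoduleE(3-6)\<close>)
  show "S \<subseteq> submodule_generated K M S"
    by (auto simp: submodule_generated_def)
qed

lemma submodule_generated_minimal:
  assumes "submodule H K M" "S \<subseteq> H"
  shows "submodule_generated K M S \<subseteq> H"
  using assms by (auto simp: submodule_generated_def)

section \<open>The free algebra\<close>

lemma free_carrier:
  "f \<in> carrier (free_algebra K S) \<longleftrightarrow>
    (\<forall>w. f w \<in> carrier K) \<and> finite {w. f w \<noteq> \<zero>\<^bsub>K\<^esub>} \<and> {w. f w \<noteq> \<zero>\<^bsub>K\<^esub>} \<subseteq> lists S"
  by (auto simp: free_algebra_def)

lemma free_simps:
  "zero (free_algebra K S) = (\<lambda>w. \<zero>\<^bsub>K\<^esub>)"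
  "one (free_algebra K S) = word_elem K []"
  "f \<oplus>\<^bsub>free_algebra K S\<^esub> g = (\<lambda>w. f w \<oplus>\<^bsub>K\<^esub> g w)"
  "c \<odot>\<^bsub>free_algebra K S\<^esub> f = (\<lambda>w. c \<otimes>\<^bsub>K\<^esub> f w)"
  "f \<otimes>\<^bsub>free_algebra K S\<^esub> g =
    (\<lambda>w. \<Oplus>\<^bsub>K\<^esub>i\<in>{..length w}. f (take i w) \<otimes>\<^bsub>K\<^esub> g (drop i w))"
  by (simp_all add: free_algebra_def)

definition word_prod :: "('k, 'a, 'n) module_scheme \<Rightarrow> ('s \<Rightarrow> 'a) \<Rightarrow> 's list \<Rightarrow> 'a"
  where "word_prod E \<phi> w = foldr (\<lambda>s a. \<phi> s \<otimes>\<^bsub>E\<^esub> a) w \<one>\<^bsub>E\<^esub>"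

text \<open>The extension of \<phi> to an algebra homomorphism on the free algebra. The sum runs
  over the support because a finite index set is needed.\<close>

definition free_eval ::
    "('k, 'm) ring_scheme \<Rightarrow> ('k, 'a, 'n) module_scheme \<Rightarrow> ('s \<Rightarrow> 'a) \<Rightarrow> ('s list \<Rightarrow> 'k) \<Rightarrow> 'a"
  where "free_eval K E \<phi> f = (\<Oplus>\<^bsub>E\<^esub>w\<in>{w. f w \<noteq> \<zero>\<^bsub>K\<^esub>}. f w \<odot>\<^bsub>E\<^esub> word_prod E \<phi> w)"

lemma word_prod_simps [simp]:
  "word_prod E \<phi> [] = \<one>\<^bsub>E\<^esub>"
  "word_prod E \<phi> (s # w) = \<phi> s \<otimes>\<^bsub>E\<^esub> word_prod E \<phi> w"
  by (simp_all add: word_prod_def)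

context
  fixes K :: "('k, 'm) ring_scheme" (structure) and S :: "'s set"
  assumes K: "cring K"
begin

interpretation K: cring K by (rule K)

abbreviation (input) F where "F \<equiv> free_algebra K S"

lemma free_add_closed:
  assumes "f \<in> carrier F" "g \<in> carrier F"
  shows "f \<oplus>\<^bsub>F\<^esub> g \<in> carrier F"
proof -
  have "{w. f w \<oplus> g w \<noteq> \<zero>} \<subseteq> {w. f w \<noteq> \<zero>} \<union> {w. g w \<noteq> \<zero>}"
    by (auto intro: ccontr)
  moreover have "finite ({w. f w \<noteq> \<zero>} \<union> {w. g w \<noteq> \<zero>})"
    using assms by (simp add: free_carrier)
  moreover have "{w. f w \<noteq> \<zero>} \<union> {w. g w \<noteq> \<zero>} \<subseteq> lists S"
    using assms by (simp add: free_carrier)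
  ultimately show ?thesis
    using assms finite_subset unfolding free_carrier free_simps
    by (metis (no_types, lifting) K.add.m_closed subset_trans)
qed

lemma free_smult_closed:
  assumes "c \<in> carrier K" "f \<in> carrier F"
  shows "c \<odot>\<^bsub>F\<^esub> f \<in> carrier F"
proof -
  have "{w. c \<otimes> f w \<noteq> \<zero>} \<subseteq> {w. f w \<noteq> \<zero>}"
    using assms(1) by auto
  then show ?thesis
    using assms finite_subset unfolding free_carrier free_simps
    by (metis (no_types, lifting) K.m_closed subset_trans)
qed

lemma free_word_closed:
  "w \<in> lists S \<Longrightarrow> word_elem K w \<in> carrier F"
  by (auto simp: free_carrier word_elem_def)

lemma free_module: "module K F"
proof (rule moduleI[OF K])
  show "abelian_group F"
  proof (rule abelian_groupI)
    fix f assume f: "f \<in> carrier F"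
    have "(\<ominus> \<one>) \<odot>\<^bsub>F\<^esub> f \<oplus>\<^bsub>F\<^esub> f = \<zero>\<^bsub>F\<^esub>"
      using f by (auto simp: free_simps free_carrier K.l_minus K.l_neg)
    then show "\<exists>g\<in>carrier F. g \<oplus>\<^bsub>F\<^esub> f = \<zero>\<^bsub>F\<^esub>"
      using free_smult_closed[OF _ f] by blast
  next
    fix f assume "f \<in> carrier F"
    then show "\<zero>\<^bsub>F\<^esub> \<oplus>\<^bsub>F\<^esub> f = f"
      by (auto simp: free_simps free_carrier)
  next
    show "\<zero>\<^bsub>F\<^esub> \<in> carrier F"
      by (auto simp: free_simps free_carrier)
  next
    fix f g h
    assume "f \<in> carrier F" "g \<in> carrier F"
      "h \<in> carrier F"
    then show "f \<oplus>\<^bsub>F\<^esub> g \<oplus>\<^bsub>F\<^esub> h =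
        f \<oplus>\<^bsub>F\<^esub> (g \<oplus>\<^bsub>F\<^esub> h)"
      by (simp add: free_simps free_carrier K.a_assoc)
  next
    fix f g
    assume "f \<in> carrier F" "g \<in> carrier F"
    then show "f \<oplus>\<^bsub>F\<^esub> g = g \<oplus>\<^bsub>F\<^esub> f"
      by (simp add: free_simps free_carrier K.a_comm)
  qed (rule free_add_closed)
qed (simp_all add: free_smult_closed,
    simp_all add: free_simps free_carrier K.l_distr K.r_distr K.m_assoc)

text \<open>The support is removed one word at a time. \<open>X\<close> restricts only the words for
  which the base case must be checked; the closure cases are not relative to \<open>X\<close>. It is
  applied with all words, with the nonempty words, and with the words of one length.\<close>

lemma free_induct [consumes 2, case_names word add smult]:
  assumes f: "f \<in> carrier F" and supp: "\<And>w. f w \<noteq> \<zero> \<Longrightarrow> w \<in> X"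
    and word: "\<And>w. w \<in> lists S \<Longrightarrow> w \<in> X \<Longrightarrow> P (word_elem K w)"
    and add: "\<And>f g. f \<in> carrier F \<Longrightarrow> g \<in> carrier F \<Longrightarrow>
      P f \<Longrightarrow> P g \<Longrightarrow> P (f \<oplus>\<^bsub>F\<^esub> g)"
    and smult: "\<And>c f. c \<in> carrier K \<Longrightarrow> f \<in> carrier F \<Longrightarrow> P f \<Longrightarrow>
      P (c \<odot>\<^bsub>F\<^esub> f)"
    and zero: "P \<zero>\<^bsub>F\<^esub>"
  shows "P f"
proof -
  have "P f" if "finite W" "{w. f w \<noteq> \<zero>} = W" "W \<subseteq> X" "f \<in> carrier F" for W f
    using that
  proof (induction W arbitrary: f rule: finite_induct)
    case empty
    then have "f = \<zero>\<^bsub>F\<^esub>"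
      by (auto simp: free_simps)
    then show ?case
      using zero by simp
  next
    case (insert w W)
    define g where "g = (\<lambda>v. if v = w then \<zero> else f v)"
    have fK: "f v \<in> carrier K" for v
      using insert.prems by (simp add: free_carrier)
    have w: "w \<in> lists S" "w \<in> X"
      using insert.prems by (auto simp: free_carrier)
    have supp: "{v. g v \<noteq> \<zero>} = W"
      using insert by (auto simp: g_def)
    then have g: "g \<in> carrier F"
      using insert fK by (auto simp: free_carrier g_def)
    have "P g"
      using insert supp g by auto
    then have "P (f w \<odot>\<^bsub>F\<^esub> word_elem K w \<oplus>\<^bsub>F\<^esub> g)"
      by (intro add smult word free_smult_closed free_word_closed g w fK)
    also have "f w \<odot>\<^bsub>F\<^esub> word_elem K w \<oplus>\<^bsub>F\<^esub> g = f"
      using fK by (auto simp: free_simps word_elem_def g_def)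
    finally show ?case .
  qed
  then show ?thesis
    using f supp by (auto simp: free_carrier subset_iff)
qed

text \<open>In the convolution sum only the cut at position \<open>length u\<close> can be
  nonzero.\<close>

lemma free_mult_word:
  "word_elem K u \<otimes>\<^bsub>F\<^esub> word_elem K v = word_elem K (u @ v)"
proof
  fix w
  have "(word_elem K u \<otimes>\<^bsub>F\<^esub> word_elem K v) w =
      (\<Oplus>i\<in>{..length w}. if length u = i then word_elem K (u @ v) w else \<zero>)"
    unfolding free_simps
  proof (rule K.finsum_cong')
    fix i assume "i \<in> {..length w}"
    then show "word_elem K u (take i w) \<otimes> word_elem K v (drop i w) =
        (if length u = i then word_elem K (u @ v) w else \<zero>)"
      by (auto simp: word_elem_def)
  qed (auto simp: word_elem_def)
  also have "\<dots> = word_elem K (u @ v) w"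
  proof (cases "length u \<le> length w")
    case True
    then show ?thesis
      by (intro K.finsum_singleton) (auto simp: word_elem_def)
  next
    case False
    then have "(\<Oplus>i\<in>{..length w}. if length u = i then word_elem K (u @ v) w else \<zero>) = \<zero>"
      by (intro K.add.finprod_one_eqI) auto
    then show ?thesis
      using False by (auto simp: word_elem_def)
  qed
  finally show "(word_elem K u \<otimes>\<^bsub>F\<^esub> word_elem K v) w = word_elem K (u @ v) w" .
qed

lemma free_distr:
  assumes "f \<in> carrier F" "g \<in> carrier F"
    "h \<in> carrier F"
  shows "(f \<oplus>\<^bsub>F\<^esub> g) \<otimes>\<^bsub>F\<^esub> h =
      f \<otimes>\<^bsub>F\<^esub> h \<oplus>\<^bsub>F\<^esub> g \<otimes>\<^bsub>F\<^esub> h"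
    and "h \<otimes>\<^bsub>F\<^esub> (f \<oplus>\<^bsub>F\<^esub> g) =
      h \<otimes>\<^bsub>F\<^esub> f \<oplus>\<^bsub>F\<^esub> h \<otimes>\<^bsub>F\<^esub> g"
  using assms
  by (auto simp: free_simps free_carrier K.l_distr K.r_distr Pi_def
      simp flip: K.finsum_addf)

lemma free_smult_mult:
  assumes "c \<in> carrier K" "f \<in> carrier F" "g \<in> carrier F"
  shows "(c \<odot>\<^bsub>F\<^esub> f) \<otimes>\<^bsub>F\<^esub> g =
      c \<odot>\<^bsub>F\<^esub> (f \<otimes>\<^bsub>F\<^esub> g)"
    and "f \<otimes>\<^bsub>F\<^esub> (c \<odot>\<^bsub>F\<^esub> g) =
      c \<odot>\<^bsub>F\<^esub> (f \<otimes>\<^bsub>F\<^esub> g)"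
  using assms
  by (auto simp: free_simps free_carrier K.finsum_rdistr Pi_def K.m_ac
      intro!: K.finsum_cong')

lemma free_mult_zero:
  assumes "f \<in> carrier F"
  shows "\<zero>\<^bsub>F\<^esub> \<otimes>\<^bsub>F\<^esub> f = \<zero>\<^bsub>F\<^esub>"
    and "f \<otimes>\<^bsub>F\<^esub> \<zero>\<^bsub>F\<^esub> = \<zero>\<^bsub>F\<^esub>"
  using assms by (auto simp: free_simps free_carrier)

text \<open>Finiteness of the support cannot be read off from the convolution formula; bilinearity
  reduces the claim to words, first in the right factor and then in the left one.\<close>

lemma free_mult_closed:
  assumes "f \<in> carrier F" "g \<in> carrier F"
  shows "f \<otimes>\<^bsub>F\<^esub> g \<in> carrier F"
proof -
  interpret F: module K F
    by (rule free_module)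
  have word: "word_elem K w \<otimes>\<^bsub>F\<^esub> g \<in> carrier F"
    if "w \<in> lists S" for w
    using assms(2) UNIV_I
  proof (induction rule: free_induct)
    case (word v)
    then show ?case
      using that by (simp add: free_mult_word free_word_closed)
  next
    case (add f g)
    then show ?case
      using that by (simp add: free_distr free_word_closed)
  next
    case (smult c f)
    then show ?case
      using that by (simp add: free_smult_mult free_word_closed)
  qed (use that in \<open>simp add: free_mult_zero free_word_closed\<close>)
  show ?thesis
    using assms(1) UNIV_I
    by (induction rule: free_induct)
      (simp_all add: assms(2) word free_distr free_smult_mult free_mult_zero)
qed

lemma free_mult_assoc:
  assumes "f \<in> carrier F" "g \<in> carrier F"
    "h \<in> carrier F"
  shows "f \<otimes>\<^bsub>F\<^esub> g \<otimes>\<^bsub>F\<^esub> h =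
    f \<otimes>\<^bsub>F\<^esub> (g \<otimes>\<^bsub>F\<^esub> h)"
proof -
  interpret F: module K F
    by (rule free_module)
  note simps = free_distr free_smult_mult free_mult_zero
    free_mult_closed free_word_closed free_mult_word
  have 1: "word_elem K u \<otimes>\<^bsub>F\<^esub> word_elem K v \<otimes>\<^bsub>F\<^esub> h =
      word_elem K u \<otimes>\<^bsub>F\<^esub> (word_elem K v \<otimes>\<^bsub>F\<^esub> h)"
    if "u \<in> lists S" "v \<in> lists S" for u v
    using assms(3) UNIV_I
    by (induction rule: free_induct) (use that in \<open>simp_all add: simps\<close>)
  have 2: "word_elem K u \<otimes>\<^bsub>F\<^esub> g \<otimes>\<^bsub>F\<^esub> h =
      word_elem K u \<otimes>\<^bsub>F\<^esub> (g \<otimes>\<^bsub>F\<^esub> h)"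
    if "u \<in> lists S" for u
    using assms(2) UNIV_I
    by (induction rule: free_induct)
      (use that 1 assms(3) in \<open>simp_all add: simps del: free_mult_word\<close>)
  show ?thesis
    using assms(1) UNIV_I
    by (induction rule: free_induct) (use 2 assms in \<open>simp_all add: simps\<close>)
qed

lemma free_assoc_algebra: "assoc_algebra K F"
proof (rule assoc_algebraI[OF free_module])
  have one: "\<one>\<^bsub>F\<^esub> \<otimes>\<^bsub>F\<^esub> f = f \<and>
      f \<otimes>\<^bsub>F\<^esub> \<one>\<^bsub>F\<^esub> = f"
    if "f \<in> carrier F" for f
    using that UNIV_I
    by (induction rule: free_induct)
      (simp_all add: free_simps(2) free_distr free_smult_mult
        free_mult_zero free_word_closed free_mult_word)
  have "Group.monoid F"
    by (rule monoidI)
      (simp_all add: free_mult_closed free_mult_assoc one,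
        simp add: free_simps(2) free_word_closed)
  moreover have "abelian_group F"
    using free_module by (simp add: module_def)
  ultimately show "ring F"
    by (intro ringI) (simp_all add: free_distr)
qed (simp_all add: free_smult_mult)

subsection \<open>The universal property\<close>

context
  fixes E :: "('k, 'e, 'n) module_scheme" and \<phi> :: "'s \<Rightarrow> 'e"
  assumes E: "assoc_algebra K E" and \<phi>: "\<And>s. s \<in> S \<Longrightarrow> \<phi> s \<in> carrier E"
begin

interpretation E: assoc_algebra K E by (rule E)

lemma word_prod_closed: "w \<in> lists S \<Longrightarrow> word_prod E \<phi> w \<in> carrier E"
  by (induction w) (auto simp: \<phi>)

lemma word_prod_append:
  "u \<in> lists S \<Longrightarrow> v \<in> lists S \<Longrightarrow> word_prod E \<phi> (u @ v) = word_prod E \<phi> u \<otimes>\<^bsub>E\<^esub> word_prod E \<phi> v"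
  by (induction u) (auto simp: \<phi> word_prod_closed E.M.m_assoc)

text \<open>Words outside the support contribute zero. The freedom in \<open>W\<close> gives two
  elements and their sum a common index set, which is how additivity is proved.\<close>

lemma free_eval_superset:
  assumes "f \<in> carrier F" "finite W" "{w. f w \<noteq> \<zero>} \<subseteq> W" "W \<subseteq> lists S"
  shows "free_eval K E \<phi> f = (\<Oplus>\<^bsub>E\<^esub>w\<in>W. f w \<odot>\<^bsub>E\<^esub> word_prod E \<phi> w)"
proof -
  have "f w \<odot>\<^bsub>E\<^esub> word_prod E \<phi> w \<in> carrier E" "f w = \<zero> \<Longrightarrow> f w \<odot>\<^bsub>E\<^esub> word_prod E \<phi> w = \<zero>\<^bsub>E\<^esub>"
    if "w \<in> W" for w
    using that assms word_prod_closed[of w] by (auto simp: free_carrier subsetD)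
  then show ?thesis
    unfolding free_eval_def using assms
    by (intro E.M.add.finprod_mono_neutral_cong_left) auto
qed

lemma free_eval_word:
  assumes "w \<in> lists S"
  shows "free_eval K E \<phi> (word_elem K w) = word_prod E \<phi> w"
proof -
  have "free_eval K E \<phi> (word_elem K w) = (\<Oplus>\<^bsub>E\<^esub>v\<in>{w}. word_elem K w v \<odot>\<^bsub>E\<^esub> word_prod E \<phi> v)"
    using assms by (intro free_eval_superset free_word_closed) (auto simp: word_elem_def)
  also have "\<dots> = word_prod E \<phi> w"
    using assms word_prod_closed by (simp add: word_elem_def)
  finally show ?thesis .
qed

lemma free_eval_mod_hom: "free_eval K E \<phi> \<in> mod_hom K F E"
proof (rule mod_homI)
  fix f assume f: "f \<in> carrier F"
  then show "free_eval K E \<phi> f \<in> carrier E"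
    unfolding free_eval_def
    by (intro E.M.finsum_closed) (auto simp: free_carrier subset_iff word_prod_closed)
  let ?W = "{w. f w \<noteq> \<zero>}"
  fix c assume c: "c \<in> carrier K"
  have "free_eval K E \<phi> (c \<odot>\<^bsub>F\<^esub> f) =
      (\<Oplus>\<^bsub>E\<^esub>w\<in>?W. (c \<otimes> f w) \<odot>\<^bsub>E\<^esub> word_prod E \<phi> w)"
    using f c free_smult_closed[OF c f]
    by (subst free_eval_superset[where W = ?W]) (auto simp: free_simps free_carrier)
  also have "\<dots> = (\<Oplus>\<^bsub>E\<^esub>w\<in>?W. c \<odot>\<^bsub>E\<^esub> (f w \<odot>\<^bsub>E\<^esub> word_prod E \<phi> w))"
    using f c by (intro E.M.finsum_cong')
      (auto simp: free_carrier subset_iff word_prod_closed E.smult_assoc1)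
  also have "\<dots> = c \<odot>\<^bsub>E\<^esub> free_eval K E \<phi> f"
    unfolding free_eval_def using f c
    by (intro E.finsum_smult_ldistr[symmetric])
      (auto simp: free_carrier subset_iff word_prod_closed)
  finally show "free_eval K E \<phi> (c \<odot>\<^bsub>F\<^esub> f) = c \<odot>\<^bsub>E\<^esub> free_eval K E \<phi> f" .
next
  fix f g assume fg: "f \<in> carrier F" "g \<in> carrier F"
  define W where "W = {w. f w \<noteq> \<zero>} \<union> {w. g w \<noteq> \<zero>}"
  have W: "finite W" "W \<subseteq> lists S"
    using fg by (auto simp: W_def free_carrier)
  have fgK: "f w \<in> carrier K" "g w \<in> carrier K" for w
    using fg by (auto simp: free_carrier)
  have "free_eval K E \<phi> (f \<oplus>\<^bsub>F\<^esub> g) =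
      (\<Oplus>\<^bsub>E\<^esub>w\<in>W. (f w \<oplus> g w) \<odot>\<^bsub>E\<^esub> word_prod E \<phi> w)"
    using fg W by (subst free_eval_superset[where W = W])
      (auto simp: free_add_closed, auto simp: W_def free_simps)
  also have "\<dots> = (\<Oplus>\<^bsub>E\<^esub>w\<in>W. f w \<odot>\<^bsub>E\<^esub> word_prod E \<phi> w \<oplus>\<^bsub>E\<^esub> g w \<odot>\<^bsub>E\<^esub> word_prod E \<phi> w)"
    using fgK W by (intro E.M.finsum_cong') (auto simp: word_prod_closed E.smult_l_distr subset_iff)
  also have "\<dots> = (\<Oplus>\<^bsub>E\<^esub>w\<in>W. f w \<odot>\<^bsub>E\<^esub> word_prod E \<phi> w) \<oplus>\<^bsub>E\<^esub> (\<Oplus>\<^bsub>E\<^esub>w\<in>W. g w \<odot>\<^bsub>E\<^esub> word_prod E \<phi> w)"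
    using fgK W by (intro E.M.finsum_addf) (auto simp: word_prod_closed subset_iff)
  also have "\<dots> = free_eval K E \<phi> f \<oplus>\<^bsub>E\<^esub> free_eval K E \<phi> g"
    using fg W by (subst (1 2) free_eval_superset[where W = W]) (auto simp: W_def)
  finally show "free_eval K E \<phi> (f \<oplus>\<^bsub>F\<^esub> g) = free_eval K E \<phi> f \<oplus>\<^bsub>E\<^esub> free_eval K E \<phi> g" .
qed

lemma free_eval_alg_hom: "free_eval K E \<phi> \<in> alg_hom K F E"
proof (rule alg_homI[OF free_eval_mod_hom])
  interpret F: assoc_algebra K F
    by (rule free_assoc_algebra)
  note hom = mod_homD[OF free_eval_mod_hom]
    mod_hom_zero[OF free_module assoc_algebra_module[OF E] free_eval_mod_hom]
  fix f g assume fg: "f \<in> carrier F" "g \<in> carrier F"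
  have word: "free_eval K E \<phi> (word_elem K w \<otimes>\<^bsub>F\<^esub> g) =
      free_eval K E \<phi> (word_elem K w) \<otimes>\<^bsub>E\<^esub> free_eval K E \<phi> g" if w: "w \<in> lists S" for w
    using fg(2) UNIV_I
  proof (induction rule: free_induct)
    case (word v)
    then show ?case
      using w by (simp add: free_mult_word free_eval_word word_prod_append)
  qed (use w in \<open>simp_all add: hom F.M.r_distr E.M.r_distr F.smult_mult_right E.smult_mult_right
        free_word_closed\<close>)
  show "free_eval K E \<phi> (f \<otimes>\<^bsub>F\<^esub> g) = free_eval K E \<phi> f \<otimes>\<^bsub>E\<^esub> free_eval K E \<phi> g"
    using fg(1) UNIV_I
    by (induction rule: free_induct)
      (simp_all add: word hom fg F.M.l_distr E.M.l_distr F.smult_mult_left E.smult_mult_left)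
next
  show "free_eval K E \<phi> \<one>\<^bsub>F\<^esub> = \<one>\<^bsub>E\<^esub>"
    by (simp add: free_simps(2) free_eval_word)
qed

lemma free_eval_letter: "s \<in> S \<Longrightarrow> free_eval K E \<phi> (word_elem K [s]) = \<phi> s"
  by (simp add: free_eval_word \<phi>)

lemma free_eval_unique:
  assumes h: "h \<in> alg_hom K F E"
    and letter: "\<And>s. s \<in> S \<Longrightarrow> h (word_elem K [s]) = \<phi> s"
    and f: "f \<in> carrier F"
  shows "h f = free_eval K E \<phi> f"
proof -
  note hom = alg_homD[OF free_eval_alg_hom] alg_homD[OF h]
    mod_hom_zero[OF free_module assoc_algebra_module[OF E] free_eval_mod_hom]
    mod_hom_zero[OF free_module assoc_algebra_module[OF E] alg_homD(1)[OF h]]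
  have "h (word_elem K w) = free_eval K E \<phi> (word_elem K w)" if "w \<in> lists S" for w
    using that
  proof (induction w)
    case Nil
    then show ?case
      using hom by (simp add: free_simps(2))
  next
    case (Cons s w)
    have "word_elem K (s # w) = word_elem K [s] \<otimes>\<^bsub>F\<^esub> word_elem K w"
      by (simp add: free_mult_word)
    then show ?case
      using Cons by (simp add: hom free_word_closed letter free_eval_letter)
  qed
  with f UNIV_I show ?thesis
    by (induction rule: free_induct) (simp_all add: hom)
qed

end

end

section \<open>Quotients\<close>

lemma quot_module_simps:
  "carrier (quot_module M H) = a_rcosets\<^bsub>M\<^esub> H"
  "zero (quot_module M H) = H"
  "one (quot_module M H) = H +>\<^bsub>M\<^esub> \<one>\<^bsub>M\<^esub>"
  "X \<oplus>\<^bsub>quot_module M H\<^esub> Y = X <+>\<^bsub>M\<^esub> Y"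
  "X \<otimes>\<^bsub>quot_module M H\<^esub> Y = rcoset_mult M H X Y"
  "c \<odot>\<^bsub>quot_module M H\<^esub> X = (\<Union>x\<in>X. H +>\<^bsub>M\<^esub> (c \<odot>\<^bsub>M\<^esub> x))"
  by (simp_all add: quot_module_def FactRing_def ring.extend_def module.fields_def)

lemma quot_carrier: "carrier (quot_module M H) = (\<lambda>x. H +>\<^bsub>M\<^esub> x) ` carrier M"
  by (auto simp: quot_module_simps A_RCOSETS_def RCOSETS_def a_r_coset_def)

context
  fixes K :: "('k, 'm) ring_scheme" and M :: "('k, 'a, 'n) module_scheme" and H
  assumes M: "module K M" and H: "submodule H K M"
begin

interpretation M: module K M by (rule M)

interpretation H: abelian_subgroup H M
  by (rule abelian_subgroupI3)
    (auto intro: additive_subgroup.intro submodule.axioms(1)[OF H] M.abelian_group_axioms)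

text \<open>Scalar multiplication on the quotient is a union over all representatives; since
  \<open>H\<close> is closed under scalars, every representative yields the same coset and the union
  collapses.\<close>

lemma coset_smult:
  assumes "c \<in> carrier K" "x \<in> carrier M"
  shows "c \<odot>\<^bsub>quot_module M H\<^esub> (H +>\<^bsub>M\<^esub> x) = H +>\<^bsub>M\<^esub> (c \<odot>\<^bsub>M\<^esub> x)"
proof -
  have "H +>\<^bsub>M\<^esub> (c \<odot>\<^bsub>M\<^esub> y) = H +>\<^bsub>M\<^esub> (c \<odot>\<^bsub>M\<^esub> x)" if y: "y \<in> H +>\<^bsub>M\<^esub> x" for y
  proof -
    obtain h where h: "h \<in> H" "y = h \<oplus>\<^bsub>M\<^esub> x"
      using y by (auto simp: a_r_coset_def')
    then have "c \<odot>\<^bsub>M\<^esub> y = c \<odot>\<^bsub>M\<^esub> h \<oplus>\<^bsub>M\<^esub> c \<odot>\<^bsub>M\<^esub> x" "c \<odot>\<^bsub>M\<^esub> h \<in> H"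
      using assms M.smult_r_distr submodule.smult_closed[OF H] by auto
    then have "c \<odot>\<^bsub>M\<^esub> y \<in> H +>\<^bsub>M\<^esub> (c \<odot>\<^bsub>M\<^esub> x)"
      by (auto simp: a_r_coset_def')
    then show ?thesis
      using assms by (metis H.a_repr_independence' M.smult_closed)
  qed
  moreover have "x \<in> H +>\<^bsub>M\<^esub> x"
    using assms by (simp add: H.a_rcos_self)
  ultimately show ?thesis
    unfolding quot_module_simps by blast
qed

lemma coset_add:
  assumes "x \<in> carrier M" "y \<in> carrier M"
  shows "(H +>\<^bsub>M\<^esub> x) \<oplus>\<^bsub>quot_module M H\<^esub> (H +>\<^bsub>M\<^esub> y) = H +>\<^bsub>M\<^esub> (x \<oplus>\<^bsub>M\<^esub> y)"
  using assms by (simp add: quot_module_simps H.a_rcos_sum)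

lemma coset_mod_hom: "(\<lambda>x. H +>\<^bsub>M\<^esub> x) \<in> mod_hom K M (quot_module M H)"
  by (rule mod_homI) (auto simp: coset_add coset_smult quot_carrier)

lemma coset_zero_iff: "x \<in> carrier M \<Longrightarrow> H +>\<^bsub>M\<^esub> x = \<zero>\<^bsub>quot_module M H\<^esub> \<longleftrightarrow> x \<in> H"
  unfolding quot_module_simps
  using H.a_rcos_self H.a_rcos_const by blast

lemma quot_zero_eq: "\<zero>\<^bsub>quot_module M H\<^esub> = H +>\<^bsub>M\<^esub> \<zero>\<^bsub>M\<^esub>"
  using coset_zero_iff[of "\<zero>\<^bsub>M\<^esub>"] by simp

lemma quot_module_is_module: "module K (quot_module M H)"
proof (rule moduleI[OF M.R.is_cring])
  show "abelian_group (quot_module M H)"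
  proof (rule abelian_groupI)
    fix X assume "X \<in> carrier (quot_module M H)"
    then obtain x where x: "x \<in> carrier M" "X = H +>\<^bsub>M\<^esub> x"
      by (auto simp: quot_carrier)
    then have "(H +>\<^bsub>M\<^esub> (\<ominus>\<^bsub>M\<^esub> x)) \<oplus>\<^bsub>quot_module M H\<^esub> X = \<zero>\<^bsub>quot_module M H\<^esub>"
      by (simp add: coset_add M.M.l_neg coset_zero_iff)
    then show "\<exists>Y\<in>carrier (quot_module M H). Y \<oplus>\<^bsub>quot_module M H\<^esub> X = \<zero>\<^bsub>quot_module M H\<^esub>"
      using x(1) by (auto simp: quot_carrier)
  next
    show "\<zero>\<^bsub>quot_module M H\<^esub> \<in> carrier (quot_module M H)"
      unfolding quot_carrier quot_zero_eq by blast
  next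
    fix X assume "X \<in> carrier (quot_module M H)"
    then show "\<zero>\<^bsub>quot_module M H\<^esub> \<oplus>\<^bsub>quot_module M H\<^esub> X = X"
      by (auto simp: quot_carrier quot_zero_eq coset_add)
  qed (auto simp: quot_carrier coset_add M.M.a_ac)
qed (auto simp: quot_carrier coset_add coset_smult M.smult_l_distr M.smult_r_distr M.smult_assoc1)

lemma coset_eq_iff:
  assumes "x \<in> carrier M" "y \<in> carrier M"
  shows "H +>\<^bsub>M\<^esub> x = H +>\<^bsub>M\<^esub> y \<longleftrightarrow> x \<ominus>\<^bsub>M\<^esub> y \<in> H"
proof -
  interpret Q: module K "quot_module M H"
    by (rule quot_module_is_module)
  note hom = coset_mod_hom
  have "H +>\<^bsub>M\<^esub> x = H +>\<^bsub>M\<^esub> y \<longleftrightarrow> (H +>\<^bsub>M\<^esub> x) \<ominus>\<^bsub>quot_module M H\<^esub> (H +>\<^bsub>M\<^esub> y) = \<zero>\<^bsub>quot_module M H\<^esub>"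
    using mod_homD(1)[OF hom] assms
    by (metis Q.M.add.inv_closed Q.M.add.inv_solve_right' Q.M.l_zero Q.M.minus_eq Q.M.zero_closed)
  also have "\<dots> \<longleftrightarrow> H +>\<^bsub>M\<^esub> (x \<ominus>\<^bsub>M\<^esub> y) = \<zero>\<^bsub>quot_module M H\<^esub>"
    using mod_hom_minus[OF M quot_module_is_module hom] assms by simp
  also have "\<dots> \<longleftrightarrow> x \<ominus>\<^bsub>M\<^esub> y \<in> H"
    using assms by (simp add: coset_zero_iff)
  finally show ?thesis .
qed

end

section \<open>Quotient algebras and images of ideals\<close>

context
  fixes K :: "('k, 'm) ring_scheme" and A :: "('k, 'a, 'n) module_scheme" and J
  assumes A: "assoc_algebra K A" and J: "ideal J A"
begin

interpretation A: assoc_algebra K A by (rule A)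
interpretation J: ideal J A by (rule J)

lemmas quot_alg_rules =
  coset_add[OF assoc_algebra_module[OF A] ideal_imp_submodule[OF A J]]
  coset_smult[OF assoc_algebra_module[OF A] ideal_imp_submodule[OF A J]]
  J.rcoset_mult_add

lemma quot_assoc_algebra: "assoc_algebra K (quot_module A J)"
proof (rule assoc_algebraI)
  show mod: "module K (quot_module A J)"
    by (rule quot_module_is_module[OF assoc_algebra_module[OF A] ideal_imp_submodule[OF A J]])
  have "Group.monoid (quot_module A J)"
    by (rule monoidI)
      (auto simp: quot_carrier quot_module_simps(3,5) J.rcoset_mult_add A.M.m_assoc)
  moreover have "abelian_group (quot_module A J)"
    using mod by (simp add: module_def)
  ultimately show "ring (quot_module A J)"
    by (intro ringI)
      (auto simp: quot_carrier quot_alg_rules quot_module_simps(5) A.M.l_distr A.M.r_distr)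
qed (auto simp: quot_carrier quot_alg_rules quot_module_simps(5) A.smult_mult_left A.smult_mult_right)

lemma coset_alg_hom: "(\<lambda>x. J +>\<^bsub>A\<^esub> x) \<in> alg_hom K A (quot_module A J)"
  by (rule alg_homI)
    (simp_all add: coset_mod_hom[OF assoc_algebra_module[OF A] ideal_imp_submodule[OF A J]]
      quot_module_simps(3,5) J.rcoset_mult_add)

end

lemma ideal_image:
  assumes "assoc_algebra K A" "assoc_algebra K B" "h \<in> alg_hom K A B"
    and surj: "h ` carrier A = carrier B" and "ideal J A"
  shows "ideal (h ` J) B"
proof -
  interpret A: assoc_algebra K A by fact
  interpret B: assoc_algebra K B by fact
  interpret J: ideal J A by fact
  note hom = alg_homD[OF assms(3)]
  have sub: "J \<subseteq> carrier A"
    using J.a_Hcarr by auto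
  have "submodule (h ` J) K B"
  proof (rule B.submoduleI)
    show "\<zero>\<^bsub>B\<^esub> \<in> h ` J"
      using J.zero_closed mod_hom_zero[OF A.module_axioms B.module_axioms hom(1)]
      by (metis imageI)
    show "\<ominus>\<^bsub>B\<^esub> b \<in> h ` J" if "b \<in> h ` J" for b
    proof -
      obtain a where a: "a \<in> J" "b = h a"
        using \<open>b \<in> h ` J\<close> by blast
      then have "\<ominus>\<^bsub>B\<^esub> b = h (\<ominus>\<^bsub>A\<^esub> a)"
        using mod_hom_a_inv[OF A.module_axioms B.module_axioms hom(1)] J.a_Hcarr by simp
      then show ?thesis
        using a J.a_inv_closed by simp
    qed
    show "a \<oplus>\<^bsub>B\<^esub> b \<in> h ` J" if "a \<in> h ` J" "b \<in> h ` J" for a b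
      using that by (auto simp flip: hom(3)[OF J.a_Hcarr J.a_Hcarr])
    show "c \<odot>\<^bsub>B\<^esub> a \<in> h ` J" if "c \<in> carrier K" "a \<in> h ` J" for a c
      using that submodule.smult_closed[OF ideal_imp_submodule[OF assms(1,5)]]
      by (auto simp flip: hom(4)[OF _ J.a_Hcarr])
    show "h ` J \<subseteq> carrier B"
      using sub surj by auto
  qed
  then have "subgroup (h ` J) (add_monoid B)"
    by (rule submodule.axioms(1))
  moreover have "b \<otimes>\<^bsub>B\<^esub> a \<in> h ` J \<and> a \<otimes>\<^bsub>B\<^esub> b \<in> h ` J" if "a \<in> h ` J" "b \<in> carrier B" for a b
  proof -
    obtain a' b' where a': "a' \<in> J" "a = h a'" and b': "b' \<in> carrier A" "b = h b'"
      using \<open>a \<in> h ` J\<close> \<open>b \<in> carrier B\<close> surj by blast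
    then have "b \<otimes>\<^bsub>B\<^esub> a = h (b' \<otimes>\<^bsub>A\<^esub> a')" "a \<otimes>\<^bsub>B\<^esub> b = h (a' \<otimes>\<^bsub>A\<^esub> b')"
      using J.a_Hcarr by (simp_all add: hom)
    then show ?thesis
      using a' b' J.I_l_closed J.I_r_closed by simp
  qed
  ultimately show ?thesis
    by (intro idealI) (auto intro: B.M.ring_axioms)
qed

section \<open>Homomorphisms and endomorphisms of modules\<close>

text \<open>Extensionality makes maps that agree on \<open>carrier M\<close> equal, so the module
  laws hold as equations between functions. \<open>mult\<close> and \<open>one\<close> are filled in
  only for endomorphisms.\<close>

definition hom_module ::
    "('k, 'm) ring_scheme \<Rightarrow> ('k, 'a, 'n) module_scheme \<Rightarrow> ('k, 'b, 'p) module_scheme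
      \<Rightarrow> ('k, 'a \<Rightarrow> 'b) module"
  where "hom_module K M N =
    \<lparr>carrier = mod_hom K M N \<inter> extensional (carrier M),
     mult = undefined, one = undefined,
     zero = (\<lambda>x\<in>carrier M. \<zero>\<^bsub>N\<^esub>),
     add = (\<lambda>f g. \<lambda>x\<in>carrier M. f x \<oplus>\<^bsub>N\<^esub> g x),
     smult = (\<lambda>c f. \<lambda>x\<in>carrier M. c \<odot>\<^bsub>N\<^esub> f x)\<rparr>"

definition end_algebra ::
    "('k, 'm) ring_scheme \<Rightarrow> ('k, 'a, 'n) module_scheme \<Rightarrow> ('k, 'a \<Rightarrow> 'a) module"
  where "end_algebra K M =
    (hom_module K M M)\<lparr>mult := (\<lambda>f g. compose (carrier M) f g), one := (\<lambda>x\<in>carrier M. x)\<rparr>"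

lemma hom_module_simps:
  "h \<in> carrier (hom_module K M N) \<longleftrightarrow> h \<in> mod_hom K M N \<and> h \<in> extensional (carrier M)"
  "zero (hom_module K M N) = (\<lambda>x\<in>carrier M. \<zero>\<^bsub>N\<^esub>)"
  "f \<oplus>\<^bsub>hom_module K M N\<^esub> g = (\<lambda>x\<in>carrier M. f x \<oplus>\<^bsub>N\<^esub> g x)"
  "c \<odot>\<^bsub>hom_module K M N\<^esub> f = (\<lambda>x\<in>carrier M. c \<odot>\<^bsub>N\<^esub> f x)"
  by (simp_all add: hom_module_def)

lemma end_algebra_simps:
  "carrier (end_algebra K M) = carrier (hom_module K M M)"
  "zero (end_algebra K M) = zero (hom_module K M M)"
  "add (end_algebra K M) = add (hom_module K M M)"
  "smult (end_algebra K M) = smult (hom_module K M M)"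
  "f \<otimes>\<^bsub>end_algebra K M\<^esub> g = compose (carrier M) f g"
  "one (end_algebra K M) = (\<lambda>x\<in>carrier M. x)"
  by (simp_all add: end_algebra_def hom_module_def)

lemma hom_moduleI:
  assumes "\<And>x. x \<in> carrier M \<Longrightarrow> h x \<in> carrier N"
    and "\<And>x y. x \<in> carrier M \<Longrightarrow> y \<in> carrier M \<Longrightarrow> h (x \<oplus>\<^bsub>M\<^esub> y) = h x \<oplus>\<^bsub>N\<^esub> h y"
    and "\<And>c x. c \<in> carrier K \<Longrightarrow> x \<in> carrier M \<Longrightarrow> h (c \<odot>\<^bsub>M\<^esub> x) = c \<odot>\<^bsub>N\<^esub> h x"
    and "module K M"
  shows "(\<lambda>x\<in>carrier M. h x) \<in> carrier (hom_module K M N)"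
proof -
  interpret M: module K M by fact
  show ?thesis
    using assms by (auto simp: hom_module_simps intro!: mod_homI)
qed

lemma hom_moduleD:
  assumes "h \<in> carrier (hom_module K M N)"
  shows "x \<in> carrier M \<Longrightarrow> h x \<in> carrier N"
    and "x \<in> carrier M \<Longrightarrow> y \<in> carrier M \<Longrightarrow> h (x \<oplus>\<^bsub>M\<^esub> y) = h x \<oplus>\<^bsub>N\<^esub> h y"
    and "c \<in> carrier K \<Longrightarrow> x \<in> carrier M \<Longrightarrow> h (c \<odot>\<^bsub>M\<^esub> x) = c \<odot>\<^bsub>N\<^esub> h x"
    and "h \<in> extensional (carrier M)"
  using assms by (auto simp: hom_module_simps mod_hom_def)

lemma hom_module_closed:
  assumes "module K M" "module K N"
  shows "f \<in> carrier (hom_module K M N) \<Longrightarrow> g \<in> carrier (hom_module K M N) \<Longrightarrow>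
      f \<oplus>\<^bsub>hom_module K M N\<^esub> g \<in> carrier (hom_module K M N)"
    and "c \<in> carrier K \<Longrightarrow> f \<in> carrier (hom_module K M N) \<Longrightarrow>
      c \<odot>\<^bsub>hom_module K M N\<^esub> f \<in> carrier (hom_module K M N)"
    and "\<zero>\<^bsub>hom_module K M N\<^esub> \<in> carrier (hom_module K M N)"
proof -
  interpret M: module K M by fact
  interpret N: module K N by fact
  show "f \<oplus>\<^bsub>hom_module K M N\<^esub> g \<in> carrier (hom_module K M N)"
    if "f \<in> carrier (hom_module K M N)" "g \<in> carrier (hom_module K M N)"
    unfolding hom_module_simps(3)
    by (rule hom_moduleI)
      (use that in \<open>simp_all add: hom_moduleD N.smult_r_distr N.M.a_ac assms\<close>)
  show "c \<odot>\<^bsub>hom_module K M N\<^esub> f \<in> carrier (hom_module K M N)"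
    if c: "c \<in> carrier K" and f: "f \<in> carrier (hom_module K M N)"
    unfolding hom_module_simps(4)
  proof (rule hom_moduleI)
    fix d x assume dx: "d \<in> carrier K" "x \<in> carrier M"
    \<comment> \<open>Commutativity of \<open>K\<close> is what makes a scalar multiple of a linear
      map linear again.\<close>
    have "c \<odot>\<^bsub>N\<^esub> (d \<odot>\<^bsub>N\<^esub> f x) = (c \<otimes>\<^bsub>K\<^esub> d) \<odot>\<^bsub>N\<^esub> f x"
      using c dx hom_moduleD[OF f] by (simp add: N.smult_assoc1)
    also have "\<dots> = d \<odot>\<^bsub>N\<^esub> (c \<odot>\<^bsub>N\<^esub> f x)"
      using c dx hom_moduleD(1)[OF f] by (subst M.R.m_comm) (simp_all add: N.smult_assoc1)
    finally show "c \<odot>\<^bsub>N\<^esub> f (d \<odot>\<^bsub>M\<^esub> x) = d \<odot>\<^bsub>N\<^esub> (c \<odot>\<^bsub>N\<^esub> f x)"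
      using dx hom_moduleD[OF f] by simp
  qed (use c f in \<open>simp_all add: hom_moduleD N.smult_r_distr assms\<close>)
  show "\<zero>\<^bsub>hom_module K M N\<^esub> \<in> carrier (hom_module K M N)"
    unfolding hom_module_simps(2) by (rule hom_moduleI) (simp_all add: assms)
qed

lemma hom_module_is_module:
  assumes "module K M" "module K N"
  shows "module K (hom_module K M N)"
proof -
  interpret M: module K M by fact
  interpret N: module K N by fact
  note simps = hom_module_simps(2-4) restrict_def fun_eq_iff hom_moduleD
  show ?thesis
  proof (rule moduleI[OF M.R.is_cring])
    show "abelian_group (hom_module K M N)"
    proof (rule abelian_groupI)
      fix f assume f: "f \<in> carrier (hom_module K M N)"
      have "\<ominus>\<^bsub>K\<^esub> \<one>\<^bsub>K\<^esub> \<odot>\<^bsub>hom_module K M N\<^esub> f \<oplus>\<^bsub>hom_module K M N\<^esub> f = \<zero>\<^bsub>hom_module K M N\<^esub>"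
        using f by (auto simp: simps N.smult_l_minus N.M.l_neg)
      then show "\<exists>g\<in>carrier (hom_module K M N). g \<oplus>\<^bsub>hom_module K M N\<^esub> f = \<zero>\<^bsub>hom_module K M N\<^esub>"
        using hom_module_closed(2)[OF assms _ f] by blast
    next
      fix f assume f: "f \<in> carrier (hom_module K M N)"
      show "\<zero>\<^bsub>hom_module K M N\<^esub> \<oplus>\<^bsub>hom_module K M N\<^esub> f = f"
        using f hom_moduleD(4)[OF f] by (auto simp: simps extensional_def)
    qed (auto simp: hom_module_closed[OF assms], auto simp: simps N.M.a_ac)
  next
    fix f assume f: "f \<in> carrier (hom_module K M N)"
    show "\<one>\<^bsub>K\<^esub> \<odot>\<^bsub>hom_module K M N\<^esub> f = f"
      using f hom_moduleD(4)[OF f] by (auto simp: simps extensional_def)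
  qed (auto simp: hom_module_closed[OF assms],
      auto simp: simps N.smult_l_distr N.smult_r_distr N.smult_assoc1)
qed

lemma end_algebra_assoc_algebra:
  assumes "module K M"
  shows "assoc_algebra K (end_algebra K M)"
proof -
  interpret M: module K M by fact
  interpret H: module K "hom_module K M M"
    by (rule hom_module_is_module[OF assms assms])
  note simps = hom_module_simps(2-4) end_algebra_simps compose_def restrict_def fun_eq_iff hom_moduleD
  have mod: "module K (end_algebra K M)"
  proof (rule moduleI[OF M.R.is_cring])
    have "add_monoid (end_algebra K M) = add_monoid (hom_module K M M)"
      by (simp add: end_algebra_def)
    then show "abelian_group (end_algebra K M)"
      using H.M.a_comm_group by (intro comm_group_abelian_groupI) simp
  qed (simp_all add: end_algebra_simps H.smult_l_distr H.smult_r_distr H.smult_assoc1)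
  moreover have "Group.monoid (end_algebra K M)"
  proof (rule monoidI)
    show "f \<otimes>\<^bsub>end_algebra K M\<^esub> g \<in> carrier (end_algebra K M)"
      if "f \<in> carrier (end_algebra K M)" "g \<in> carrier (end_algebra K M)" for f g
      using that unfolding end_algebra_simps compose_def
      by (intro hom_moduleI) (simp_all add: hom_moduleD assms)
    show "\<one>\<^bsub>end_algebra K M\<^esub> \<in> carrier (end_algebra K M)"
      unfolding end_algebra_simps by (intro hom_moduleI) (simp_all add: assms)
    show "\<one>\<^bsub>end_algebra K M\<^esub> \<otimes>\<^bsub>end_algebra K M\<^esub> f = f"
      "f \<otimes>\<^bsub>end_algebra K M\<^esub> \<one>\<^bsub>end_algebra K M\<^esub> = f"
      if "f \<in> carrier (end_algebra K M)" for f
      using that hom_moduleD(4)[of f K M M] by (auto simp: simps extensional_def)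
  qed (auto simp: simps)
  ultimately have "ring (end_algebra K M)"
    by (intro ringI) (auto simp: module_def, auto simp: simps)
  with mod show ?thesis
    by (rule assoc_algebraI) (auto simp: simps)
qed

section \<open>Coefficients in the truncated polynomial ring\<close>

lemma base_algebra_simps [simp]:
  "carrier (base_algebra K) = carrier K" "zero (base_algebra K) = zero K"
  "one (base_algebra K) = one K" "add (base_algebra K) = add K" "mult (base_algebra K) = mult K"
  "smult (base_algebra K) = mult K"
  by (simp_all add: base_algebra_def)

lemma UP_assoc_algebra:
  assumes "cring K"
  shows "assoc_algebra K (UP K)"
proof -
  interpret UP_cring K "UP K"
    using assms by (simp add: UP_cring_def)
  show ?thesis
    by (rule assoc_algebraI)
      (simp_all add: module P.ring_axioms UP_smult_assoc2 P.m_comm[of _ "_ \<odot>\<^bsub>UP K\<^esub> _"],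
        simp add: P.m_comm)
qed

lemma cubed_ideal:
  assumes "cring K"
  shows "ideal (poly_x_cubed_ideal K) (UP K)"
    and "p \<in> poly_x_cubed_ideal K \<Longrightarrow> i < 3 \<Longrightarrow> coeff (UP K) p i = \<zero>\<^bsub>K\<^esub>"
proof -
  interpret UP_cring K "UP K"
    using assms by (simp add: UP_cring_def)
  have x3: "poly_x K [^]\<^bsub>UP K\<^esub> (3::nat) = monom (UP K) \<one>\<^bsub>K\<^esub> 3"
    unfolding poly_x_def by (subst monom_pow) simp_all
  show "ideal (poly_x_cubed_ideal K) (UP K)"
    unfolding poly_x_cubed_ideal_def x3 by (rule P.cgenideal_ideal) simp
  assume p: "p \<in> poly_x_cubed_ideal K" and i: "i < 3"
  then obtain q where q: "q \<in> carrier (UP K)" "p = q \<otimes>\<^bsub>UP K\<^esub> monom (UP K) \<one>\<^bsub>K\<^esub> 3"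
    unfolding poly_x_cubed_ideal_def x3 cgenideal_def by blast
  then have "coeff (UP K) p i =
      (\<Oplus>\<^bsub>K\<^esub>j\<in>{..i}. coeff (UP K) q j \<otimes>\<^bsub>K\<^esub> coeff (UP K) (monom (UP K) \<one>\<^bsub>K\<^esub> 3) (i - j))"
    by simp
  \<comment> \<open>The index \<open>i - j\<close> stays below 3, where the coefficient of
    \<open>x^3\<close> vanishes.\<close>
  also have "\<dots> = \<zero>\<^bsub>K\<^esub>"
    using i q(1) by (intro R.add.finprod_one_eqI) auto
  finally show "coeff (UP K) p i = \<zero>\<^bsub>K\<^esub>" .
qed

text \<open>The coefficient of an arbitrarily chosen representative. For \<open>i < 3\<close> the
  choice does not matter, because elements of the ideal have zero coefficients there.\<close>

definition truncated_coeff :: "('k, 'm) ring_scheme \<Rightarrow> nat \<Rightarrow> (nat \<Rightarrow> 'k) set \<Rightarrow> 'k"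
  where "truncated_coeff K i X =
    coeff (UP K) (SOME p. p \<in> carrier (UP K) \<and> X = poly_x_cubed_ideal K +>\<^bsub>UP K\<^esub> p) i"

lemma truncated_coeff_coset:
  assumes "cring K" "p \<in> carrier (UP K)" "i < 3"
  shows "truncated_coeff K i (poly_x_cubed_ideal K +>\<^bsub>UP K\<^esub> p) = coeff (UP K) p i"
proof -
  interpret UP_cring K "UP K"
    using assms by (simp add: UP_cring_def)
  let ?I = "poly_x_cubed_ideal K"
  define q where "q = (SOME q. q \<in> carrier (UP K) \<and> ?I +>\<^bsub>UP K\<^esub> p = ?I +>\<^bsub>UP K\<^esub> q)"
  have q: "q \<in> carrier (UP K)" "?I +>\<^bsub>UP K\<^esub> p = ?I +>\<^bsub>UP K\<^esub> q"
    using someI[of "\<lambda>q. q \<in> carrier (UP K) \<and> ?I +>\<^bsub>UP K\<^esub> p = ?I +>\<^bsub>UP K\<^esub> q" p] assms(2)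
    by (auto simp: q_def)
  note I = cubed_ideal(1)[OF assms(1)]
  note alg = UP_assoc_algebra[OF assms(1)]
  have "q \<ominus>\<^bsub>UP K\<^esub> p \<in> ?I"
    using coset_eq_iff[OF assoc_algebra_module[OF alg] ideal_imp_submodule[OF alg I] q(1) assms(2)] q(2)
    by simp
  then have "coeff (UP K) (q \<ominus>\<^bsub>UP K\<^esub> p) i = \<zero>\<^bsub>K\<^esub>"
    using cubed_ideal(2)[OF assms(1) _ assms(3)] by simp
  moreover have "q = (q \<ominus>\<^bsub>UP K\<^esub> p) \<oplus>\<^bsub>UP K\<^esub> p"
    using q(1) assms(2) by (simp add: P.minus_eq P.a_assoc P.l_neg)
  ultimately have "coeff (UP K) q i = coeff (UP K) p i"
    using q(1) assms(2) by (metis coeff_add P.minus_closed coeff_closed R.l_zero)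
  then show ?thesis
    by (simp add: truncated_coeff_def q_def)
qed

context
  fixes K :: "('k, 'm) ring_scheme"
  assumes K: "cring K"
begin

interpretation UP_cring K "UP K"
  using K by (simp add: UP_cring_def)

lemmas truncated_coset_hom =
  coset_alg_hom[OF UP_assoc_algebra[OF K] cubed_ideal(1)[OF K], folded truncated_poly_def]

lemma truncated_poly_cases:
  assumes "X \<in> carrier (truncated_poly K)"
  obtains p where "p \<in> carrier (UP K)" "X = poly_x_cubed_ideal K +>\<^bsub>UP K\<^esub> p"
  using assms by (auto simp: truncated_poly_def quot_carrier)

lemma truncated_coeff_closed:
  assumes "X \<in> carrier (truncated_poly K)" "i < 3"
  shows "truncated_coeff K i X \<in> carrier K"
  using assms by (auto elim!: truncated_poly_cases simp: truncated_coeff_coset[OF K])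

lemma truncated_coeff_add:
  assumes "X \<in> carrier (truncated_poly K)" "Y \<in> carrier (truncated_poly K)" "i < 3"
  shows "truncated_coeff K i (X \<oplus>\<^bsub>truncated_poly K\<^esub> Y) =
    truncated_coeff K i X \<oplus>\<^bsub>K\<^esub> truncated_coeff K i Y"
  using assms alg_homD(3)[OF truncated_coset_hom, symmetric]
  by (auto elim!: truncated_poly_cases simp: truncated_coeff_coset[OF K])

lemma truncated_coeff_smult:
  assumes "X \<in> carrier (truncated_poly K)" "c \<in> carrier K" "i < 3"
  shows "truncated_coeff K i (c \<odot>\<^bsub>truncated_poly K\<^esub> X) = c \<otimes>\<^bsub>K\<^esub> truncated_coeff K i X"
  using assms alg_homD(4)[OF truncated_coset_hom, symmetric]
  by (auto elim!: truncated_poly_cases simp: truncated_coeff_coset[OF K])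

lemma truncated_coeff_convolution:
  assumes "X \<in> carrier (truncated_poly K)" "Y \<in> carrier (truncated_poly K)" "i < 3"
  shows "truncated_coeff K i (X \<otimes>\<^bsub>truncated_poly K\<^esub> Y) =
    (\<Oplus>\<^bsub>K\<^esub>j\<in>{..i}. truncated_coeff K j X \<otimes>\<^bsub>K\<^esub> truncated_coeff K (i - j) Y)"
proof -
  obtain p q where p: "p \<in> carrier (UP K)" "X = poly_x_cubed_ideal K +>\<^bsub>UP K\<^esub> p"
    and q: "q \<in> carrier (UP K)" "Y = poly_x_cubed_ideal K +>\<^bsub>UP K\<^esub> q"
    using assms(1,2) by (auto elim!: truncated_poly_cases)
  have "truncated_coeff K i (X \<otimes>\<^bsub>truncated_poly K\<^esub> Y) =
      (\<Oplus>\<^bsub>K\<^esub>j\<in>{..i}. coeff (UP K) p j \<otimes>\<^bsub>K\<^esub> coeff (UP K) q (i - j))"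
    using alg_homD(5)[OF truncated_coset_hom p(1) q(1), symmetric] p q assms(3)
    by (simp add: truncated_coeff_coset[OF K])
  also have "\<dots> = (\<Oplus>\<^bsub>K\<^esub>j\<in>{..i}. truncated_coeff K j X \<otimes>\<^bsub>K\<^esub> truncated_coeff K (i - j) Y)"
    using p q assms(3) by (intro R.finsum_cong') (auto simp: truncated_coeff_coset[OF K])
  finally show ?thesis .
qed

lemma truncated_coeff_one:
  "i < 3 \<Longrightarrow> truncated_coeff K i \<one>\<^bsub>truncated_poly K\<^esub> = (if i = 0 then \<one>\<^bsub>K\<^esub> else \<zero>\<^bsub>K\<^esub>)"
  using alg_homD(6)[OF truncated_coset_hom, symmetric]
  by (simp add: truncated_coeff_coset[OF K])

lemma truncated_coeff_x:
  "i < 3 \<Longrightarrow> truncated_coeff K i (truncated_x K) = (if i = 1 then \<one>\<^bsub>K\<^esub> else \<zero>\<^bsub>K\<^esub>)"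
  by (simp add: truncated_x_def truncated_coeff_coset[OF K] poly_x_def)

end

lemma truncated_coeff_hom:
  assumes "cring K" "\<psi> \<in> alg_hom K A (truncated_poly K)" "i < 3"
  shows "(\<lambda>y. truncated_coeff K i (\<psi> y)) \<in> mod_hom K A (base_algebra K)"
  using assms(3)
  by (intro mod_homI)
    (simp_all add: truncated_coeff_closed truncated_coeff_add truncated_coeff_smult assms(1)
      alg_homD[OF assms(2)])

text \<open>The convolution sums written out. In these three formulas the ring
  \<open>K[x]/(x^3)\<close> enters the verification that the operators defined from
  \<open>e 1\<close> and \<open>e 2\<close> give an action of \<open>A2\<close>.\<close>

lemma truncated_coeff_mult:
  assumes "cring K" "\<psi> \<in> alg_hom K A (truncated_poly K)" "y \<in> carrier A" "z \<in> carrier A"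
  defines "e \<equiv> \<lambda>i y. truncated_coeff K i (\<psi> y)"
  shows "e 0 (y \<otimes>\<^bsub>A\<^esub> z) = e 0 y \<otimes>\<^bsub>K\<^esub> e 0 z"
    and "e 1 (y \<otimes>\<^bsub>A\<^esub> z) = e 0 y \<otimes>\<^bsub>K\<^esub> e 1 z \<oplus>\<^bsub>K\<^esub> e 1 y \<otimes>\<^bsub>K\<^esub> e 0 z"
    and "e 2 (y \<otimes>\<^bsub>A\<^esub> z) = e 0 y \<otimes>\<^bsub>K\<^esub> e 2 z \<oplus>\<^bsub>K\<^esub> e 1 y \<otimes>\<^bsub>K\<^esub> e 1 z \<oplus>\<^bsub>K\<^esub> e 2 y \<otimes>\<^bsub>K\<^esub> e 0 z"
proof -
  interpret K: cring K by fact
  have c: "truncated_coeff K i (\<psi> y) \<in> carrier K" "truncated_coeff K i (\<psi> z) \<in> carrier K"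
    if "i < 3" for i
    using that assms(3,4) by (simp_all add: truncated_coeff_closed assms(1) alg_homD[OF assms(2)])
  have 2: "{..2::nat} = insert 2 (insert 1 {0})" and 1: "{..1::nat} = insert 1 {0}"
    by auto
  note simps = e_def alg_homD[OF assms(2)] assms(3,4) truncated_coeff_convolution[OF assms(1)]
  show "e 0 (y \<otimes>\<^bsub>A\<^esub> z) = e 0 y \<otimes>\<^bsub>K\<^esub> e 0 z"
    by (simp add: simps c)
  show "e 1 (y \<otimes>\<^bsub>A\<^esub> z) = e 0 y \<otimes>\<^bsub>K\<^esub> e 1 z \<oplus>\<^bsub>K\<^esub> e 1 y \<otimes>\<^bsub>K\<^esub> e 0 z"
    unfolding simps by (subst simps) (simp_all add: simps 1 c K.a_ac)
  show "e 2 (y \<otimes>\<^bsub>A\<^esub> z) = e 0 y \<otimes>\<^bsub>K\<^esub> e 2 z \<oplus>\<^bsub>K\<^esub> e 1 y \<otimes>\<^bsub>K\<^esub> e 1 z \<oplus>\<^bsub>K\<^esub> e 2 y \<otimes>\<^bsub>K\<^esub> e 0 z"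
    by (simp add: simps 2 c K.a_ac)
qed

section \<open>Representations of the coproduct on coinduced modules\<close>

text \<open>
  On \<open>Hom(A1, P)\<close> an element \<open>y\<close> of \<open>A2\<close> acts as \<open>\<eta> y\<close> plus an operator that depends on \<open>h\<close> only through
  \<open>h(1)\<close>, namely \<open>h \<mapsto> (b \<mapsto> Z y b (h 1))\<close>; \<open>Z_mult\<close> says that this is an action.
\<close>

locale coinduced_rep =
  fixes K :: "('k, 'm) ring_scheme"
    and A1 :: "('k, 'a, 'n) module_scheme"
    and A2 :: "('k, 'b, 'p) module_scheme"
    and P :: "('k, 'q, 'r) module_scheme"
    and \<eta> :: "'b \<Rightarrow> 'k"
    and Z :: "'b \<Rightarrow> 'a \<Rightarrow> 'q \<Rightarrow> 'q"
  assumes A1: "assoc_algebra K A1" and A2: "assoc_algebra K A2" and P: "module K P"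
    and \<eta>: "\<eta> \<in> alg_hom K A2 (base_algebra K)"
    and Z_closed: "\<lbrakk>y \<in> carrier A2; b \<in> carrier A1; p \<in> carrier P\<rbrakk> \<Longrightarrow> Z y b p \<in> carrier P"
    and Z_add1: "\<lbrakk>y \<in> carrier A2; z \<in> carrier A2; b \<in> carrier A1; p \<in> carrier P\<rbrakk> \<Longrightarrow>
      Z (y \<oplus>\<^bsub>A2\<^esub> z) b p = Z y b p \<oplus>\<^bsub>P\<^esub> Z z b p"
    and Z_smult1: "\<lbrakk>c \<in> carrier K; y \<in> carrier A2; b \<in> carrier A1; p \<in> carrier P\<rbrakk> \<Longrightarrow>
      Z (c \<odot>\<^bsub>A2\<^esub> y) b p = c \<odot>\<^bsub>P\<^esub> Z y b p"
    and Z_add2: "\<lbrakk>y \<in> carrier A2; a \<in> carrier A1; b \<in> carrier A1; p \<in> carrier P\<rbrakk> \<Longrightarrow>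
      Z y (a \<oplus>\<^bsub>A1\<^esub> b) p = Z y a p \<oplus>\<^bsub>P\<^esub> Z y b p"
    and Z_smult2: "\<lbrakk>c \<in> carrier K; y \<in> carrier A2; b \<in> carrier A1; p \<in> carrier P\<rbrakk> \<Longrightarrow>
      Z y (c \<odot>\<^bsub>A1\<^esub> b) p = c \<odot>\<^bsub>P\<^esub> Z y b p"
    and Z_add3: "\<lbrakk>y \<in> carrier A2; b \<in> carrier A1; p \<in> carrier P; q \<in> carrier P\<rbrakk> \<Longrightarrow>
      Z y b (p \<oplus>\<^bsub>P\<^esub> q) = Z y b p \<oplus>\<^bsub>P\<^esub> Z y b q"
    and Z_smult3: "\<lbrakk>c \<in> carrier K; y \<in> carrier A2; b \<in> carrier A1; p \<in> carrier P\<rbrakk> \<Longrightarrow>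
      Z y b (c \<odot>\<^bsub>P\<^esub> p) = c \<odot>\<^bsub>P\<^esub> Z y b p"
    and Z_one: "\<lbrakk>b \<in> carrier A1; p \<in> carrier P\<rbrakk> \<Longrightarrow> Z \<one>\<^bsub>A2\<^esub> b p = \<zero>\<^bsub>P\<^esub>"
    and Z_mult: "\<lbrakk>y \<in> carrier A2; z \<in> carrier A2; b \<in> carrier A1; p \<in> carrier P\<rbrakk> \<Longrightarrow>
      Z (y \<otimes>\<^bsub>A2\<^esub> z) b p =
        \<eta> y \<odot>\<^bsub>P\<^esub> Z z b p \<oplus>\<^bsub>P\<^esub> \<eta> z \<odot>\<^bsub>P\<^esub> Z y b p \<oplus>\<^bsub>P\<^esub> Z y b (Z z \<one>\<^bsub>A1\<^esub> p)"
begin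

sublocale A1: assoc_algebra K A1 by (rule A1)
sublocale A2: assoc_algebra K A2 by (rule A2)
sublocale P: module K P by (rule P)

abbreviation V where "V \<equiv> hom_module K A1 P"

definition act1 :: "'a \<Rightarrow> ('a \<Rightarrow> 'q) \<Rightarrow> 'a \<Rightarrow> 'q"
  where "act1 a = (\<lambda>h\<in>carrier V. \<lambda>b\<in>carrier A1. h (b \<otimes>\<^bsub>A1\<^esub> a))"

definition act2 :: "'b \<Rightarrow> ('a \<Rightarrow> 'q) \<Rightarrow> 'a \<Rightarrow> 'q"
  where "act2 y = (\<lambda>h\<in>carrier V. \<lambda>b\<in>carrier A1. \<eta> y \<odot>\<^bsub>P\<^esub> h b \<oplus>\<^bsub>P\<^esub> Z y b (h \<one>\<^bsub>A1\<^esub>))"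

lemma V_module: "module K V"
  by (rule hom_module_is_module[OF A1.module_axioms P])

lemmas \<eta>_rules = alg_homD[OF \<eta>, simplified]
lemmas V_rules = hom_moduleD[where M = A1 and N = P and K = K]
lemmas V_closed = hom_module_closed[OF A1.module_axioms P]

lemma smult_left_commute:
  "c \<in> carrier K \<Longrightarrow> d \<in> carrier K \<Longrightarrow> p \<in> carrier P \<Longrightarrow> c \<odot>\<^bsub>P\<^esub> (d \<odot>\<^bsub>P\<^esub> p) = d \<odot>\<^bsub>P\<^esub> (c \<odot>\<^bsub>P\<^esub> p)"
  by (metis P.smult_assoc1 A1.R.m_comm)

lemma act1_V:
  assumes "a \<in> carrier A1" "h \<in> carrier V"
  shows "act1 a h \<in> carrier V"
proof -
  have "(\<lambda>b\<in>carrier A1. h (b \<otimes>\<^bsub>A1\<^esub> a)) \<in> carrier V"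
    by (rule hom_moduleI)
      (use assms in \<open>simp_all add: V_rules A1.M.l_distr A1.smult_mult_left A1.module_axioms\<close>)
  then show ?thesis
    using assms by (simp add: act1_def)
qed

lemma act2_V:
  assumes "y \<in> carrier A2" "h \<in> carrier V"
  shows "act2 y h \<in> carrier V"
proof -
  have "(\<lambda>b\<in>carrier A1. \<eta> y \<odot>\<^bsub>P\<^esub> h b \<oplus>\<^bsub>P\<^esub> Z y b (h \<one>\<^bsub>A1\<^esub>)) \<in> carrier V"
    by (rule hom_moduleI)
      (use assms in \<open>simp_all add: V_rules Z_closed Z_add2 Z_smult2 \<eta>_rules P.smult_r_distr P.M.a_ac
        smult_left_commute A1.module_axioms\<close>)
  then show ?thesis
    using assms by (simp add: act2_def)
qed

lemma act1_closed:
  assumes "a \<in> carrier A1"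
  shows "act1 a \<in> carrier (end_algebra K V)"
proof -
  have "(\<lambda>h\<in>carrier V. act1 a h) = act1 a"
    by (auto simp: act1_def restrict_def fun_eq_iff)
  moreover have "(\<lambda>h\<in>carrier V. act1 a h) \<in> carrier (hom_module K V V)"
  proof (rule hom_moduleI[OF _ _ _ V_module])
    fix h k assume hk: "h \<in> carrier V" "k \<in> carrier V"
    then have "h \<oplus>\<^bsub>V\<^esub> k \<in> carrier V"
      by (simp add: V_closed)
    then show "act1 a (h \<oplus>\<^bsub>V\<^esub> k) = act1 a h \<oplus>\<^bsub>V\<^esub> act1 a k"
      using hk assms by (auto simp: act1_def hom_module_simps(3) restrict_def fun_eq_iff)
  next
    fix c h assume ch: "c \<in> carrier K" "h \<in> carrier V"
    then have "c \<odot>\<^bsub>V\<^esub> h \<in> carrier V"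
      by (simp add: V_closed)
    then show "act1 a (c \<odot>\<^bsub>V\<^esub> h) = c \<odot>\<^bsub>V\<^esub> act1 a h"
      using ch assms by (auto simp: act1_def hom_module_simps(4) restrict_def fun_eq_iff)
  qed (rule act1_V[OF assms])
  ultimately show ?thesis
    by (simp add: end_algebra_simps)
qed

lemma act2_closed:
  assumes "y \<in> carrier A2"
  shows "act2 y \<in> carrier (end_algebra K V)"
proof -
  have "(\<lambda>h\<in>carrier V. act2 y h) = act2 y"
    by (auto simp: act2_def restrict_def fun_eq_iff)
  moreover have "(\<lambda>h\<in>carrier V. act2 y h) \<in> carrier (hom_module K V V)"
  proof (rule hom_moduleI[OF _ _ _ V_module])
    fix h k assume hk: "h \<in> carrier V" "k \<in> carrier V"
    then have "h \<oplus>\<^bsub>V\<^esub> k \<in> carrier V"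
      by (simp add: V_closed)
    then show "act2 y (h \<oplus>\<^bsub>V\<^esub> k) = act2 y h \<oplus>\<^bsub>V\<^esub> act2 y k"
      using hk assms
      by (auto simp: act2_def hom_module_simps(3) restrict_def fun_eq_iff V_rules Z_closed Z_add3
        P.smult_r_distr \<eta>_rules P.M.a_ac)
  next
    fix c h assume ch: "c \<in> carrier K" "h \<in> carrier V"
    then have "c \<odot>\<^bsub>V\<^esub> h \<in> carrier V"
      by (simp add: V_closed)
    then show "act2 y (c \<odot>\<^bsub>V\<^esub> h) = c \<odot>\<^bsub>V\<^esub> act2 y h"
      using ch assms
      by (auto simp: act2_def hom_module_simps(4) restrict_def fun_eq_iff V_rules Z_closed Z_smult3
        P.smult_r_distr \<eta>_rules smult_left_commute)
  qed (rule act2_V[OF assms])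
  ultimately show ?thesis
    by (simp add: end_algebra_simps)
qed

text \<open>Translating the argument on the right gives a left action:
  \<open>act1 a (act1 a' h)\<close> at \<open>b\<close> is \<open>act1 a' h\<close> at
  \<open>b a\<close>, which is \<open>h (b a a')\<close>.\<close>

lemma act1_hom: "act1 \<in> alg_hom K A1 (end_algebra K V)"
proof (intro alg_homI mod_homI)
  fix a a' assume a: "a \<in> carrier A1" "a' \<in> carrier A1"
  show "act1 (a \<oplus>\<^bsub>A1\<^esub> a') = act1 a \<oplus>\<^bsub>end_algebra K V\<^esub> act1 a'"
    using a by (auto simp: act1_def end_algebra_simps hom_module_simps(3) restrict_def fun_eq_iff
        V_rules A1.M.r_distr)
  show "act1 (a \<otimes>\<^bsub>A1\<^esub> a') = act1 a \<otimes>\<^bsub>end_algebra K V\<^esub> act1 a'"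
    using a act1_V[OF a(2)]
    by (auto simp: act1_def end_algebra_simps compose_def restrict_def fun_eq_iff A1.M.m_assoc)
next
  fix c a assume a: "c \<in> carrier K" "a \<in> carrier A1"
  show "act1 (c \<odot>\<^bsub>A1\<^esub> a) = c \<odot>\<^bsub>end_algebra K V\<^esub> act1 a"
    using a by (auto simp: act1_def end_algebra_simps hom_module_simps(4) restrict_def fun_eq_iff
        V_rules A1.smult_mult_right)
next
  show "act1 \<one>\<^bsub>A1\<^esub> = \<one>\<^bsub>end_algebra K V\<^esub>"
    by (auto simp: act1_def end_algebra_simps restrict_def fun_eq_iff extensional_arb[OF V_rules(4)])
qed (rule act1_closed)

text \<open>In \<open>act2 y (act2 z h)\<close> the inner function is read at \<open>b\<close> and
  at 1. Expanding gives \<open>\<eta> y \<eta> z h(b)\<close> together with exactly the three terms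
  on the right of \<open>Z_mult\<close>.\<close>

lemma act2_hom: "act2 \<in> alg_hom K A2 (end_algebra K V)"
proof (intro alg_homI mod_homI)
  fix y z assume y: "y \<in> carrier A2" "z \<in> carrier A2"
  show "act2 (y \<oplus>\<^bsub>A2\<^esub> z) = act2 y \<oplus>\<^bsub>end_algebra K V\<^esub> act2 z"
    using y by (auto simp: act2_def end_algebra_simps hom_module_simps(3) restrict_def fun_eq_iff
        V_rules \<eta>_rules Z_add1 Z_closed P.smult_l_distr P.M.a_ac)
  show "act2 (y \<otimes>\<^bsub>A2\<^esub> z) = act2 y \<otimes>\<^bsub>end_algebra K V\<^esub> act2 z"
    using y act2_V[OF y(2)]
    by (auto simp: act2_def end_algebra_simps compose_def restrict_def fun_eq_iff
        V_rules \<eta>_rules Z_mult Z_add3 Z_smult3 Z_closed P.smult_r_distr P.smult_assoc1 P.M.a_ac)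
next
  fix c y assume y: "c \<in> carrier K" "y \<in> carrier A2"
  show "act2 (c \<odot>\<^bsub>A2\<^esub> y) = c \<odot>\<^bsub>end_algebra K V\<^esub> act2 y"
    using y by (auto simp: act2_def end_algebra_simps hom_module_simps(4) restrict_def fun_eq_iff
        V_rules \<eta>_rules Z_smult1 Z_closed P.smult_r_distr P.smult_assoc1)
next
  show "act2 \<one>\<^bsub>A2\<^esub> = \<one>\<^bsub>end_algebra K V\<^esub>"
    by (auto simp: act2_def end_algebra_simps restrict_def fun_eq_iff extensional_arb[OF V_rules(4)]
      V_rules \<eta>_rules Z_one)
qed (rule act2_closed)

text \<open>As \<open>\<eta> x = 0\<close>, the operator of \<open>x\<close> reads its argument only
  at 1. The outer \<open>x\<close> therefore needs the value of \<open>m x h\<close> at 1, which is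
  the value of \<open>x h\<close> at \<open>m\<close>.\<close>

lemma act_sandwich:
  assumes "x \<in> carrier A2" "\<eta> x = \<zero>\<^bsub>K\<^esub>" "m \<in> carrier A1" "h \<in> carrier V" "b \<in> carrier A1"
  shows "(act2 x \<otimes>\<^bsub>end_algebra K V\<^esub> (act1 m \<otimes>\<^bsub>end_algebra K V\<^esub> act2 x)) h b =
    Z x b (Z x m (h \<one>\<^bsub>A1\<^esub>))"
proof -
  have 1: "act2 x g c = Z x c (g \<one>\<^bsub>A1\<^esub>)" if "g \<in> carrier V" "c \<in> carrier A1" for g c
    using that assms by (simp add: act2_def V_rules Z_closed)
  have 2: "act1 m g c = g (c \<otimes>\<^bsub>A1\<^esub> m)" if "g \<in> carrier V" "c \<in> carrier A1" for g c
    using that by (simp add: act1_def)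
  show ?thesis
    using assms act1_V act2_V by (simp add: end_algebra_simps compose_def 1 2)
qed

end

section \<open>Direct products of modules, and evaluations that kill relations or letters\<close>

definition prod_module ::
    "('k, 'a, 'n) module_scheme \<Rightarrow> ('k, 'b, 'p) module_scheme \<Rightarrow> ('k, 'a \<times> 'b) module"
  where "prod_module M N =
    \<lparr>carrier = carrier M \<times> carrier N, mult = undefined, one = undefined,
     zero = (\<zero>\<^bsub>M\<^esub>, \<zero>\<^bsub>N\<^esub>),
     add = (\<lambda>p q. (fst p \<oplus>\<^bsub>M\<^esub> fst q, snd p \<oplus>\<^bsub>N\<^esub> snd q)),
     smult = (\<lambda>c p. (c \<odot>\<^bsub>M\<^esub> fst p, c \<odot>\<^bsub>N\<^esub> snd p))\<rparr>"

lemma prod_module_simps: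
  "carrier (prod_module M N) = carrier M \<times> carrier N"
  "zero (prod_module M N) = (\<zero>\<^bsub>M\<^esub>, \<zero>\<^bsub>N\<^esub>)"
  "p \<oplus>\<^bsub>prod_module M N\<^esub> q = (fst p \<oplus>\<^bsub>M\<^esub> fst q, snd p \<oplus>\<^bsub>N\<^esub> snd q)"
  "c \<odot>\<^bsub>prod_module M N\<^esub> p = (c \<odot>\<^bsub>M\<^esub> fst p, c \<odot>\<^bsub>N\<^esub> snd p)"
  by (simp_all add: prod_module_def)

lemma prod_module_is_module:
  assumes "module K M" "module K N"
  shows "module K (prod_module M N)"
proof -
  interpret M: module K M by fact
  interpret N: module K N by fact
  show ?thesis
  proof (rule moduleI[OF M.R.is_cring])
    show "abelian_group (prod_module M N)"
    proof (rule abelian_groupI)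
      fix p assume "p \<in> carrier (prod_module M N)"
      then show "\<exists>q\<in>carrier (prod_module M N). q \<oplus>\<^bsub>prod_module M N\<^esub> p = \<zero>\<^bsub>prod_module M N\<^esub>"
        by (intro bexI[of _ "(\<ominus>\<^bsub>M\<^esub> fst p, \<ominus>\<^bsub>N\<^esub> snd p)"])
          (auto simp: prod_module_simps M.M.l_neg N.M.l_neg)
    qed (auto simp: prod_module_simps M.M.a_ac N.M.a_ac)
  qed (auto simp: prod_module_simps M.smult_l_distr N.smult_l_distr M.smult_r_distr N.smult_r_distr
      M.smult_assoc1 N.smult_assoc1)
qed

text \<open>Each relation is a difference of two elements with the same image. Hence the kernel of
  every pair of algebra maps into a common algebra lies above the ideal that defines the
  coproduct.\<close>

lemma hom_relations_kernel:
  assumes A: "assoc_algebra K A" and E: "assoc_algebra K E"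
    and i: "\<And>a. a \<in> carrier A \<Longrightarrow> i a \<in> S"
    and h: "h \<in> alg_hom K (free_algebra K S) E"
    and hi: "(\<lambda>a. h (word_elem K [i a])) \<in> alg_hom K A E"
  shows "hom_relations K (free_algebra K S) A i \<subseteq> {f \<in> carrier (free_algebra K S). h f = \<zero>\<^bsub>E\<^esub>}"
proof -
  interpret A: assoc_algebra K A by fact
  interpret E: assoc_algebra K E by fact
  note K = A.R.is_cring
  interpret F: assoc_algebra K "free_algebra K S"
    by (rule free_assoc_algebra[OF K])
  have w: "word_elem K [i a] \<in> carrier (free_algebra K S)" if "a \<in> carrier A" for a
    using that i by (intro free_word_closed K) simp
  define N where "N = {f \<in> carrier (free_algebra K S). h f = \<zero>\<^bsub>E\<^esub>}"
  have diff: "f \<ominus>\<^bsub>free_algebra K S\<^esub> g \<in> N"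
    if "f \<in> carrier (free_algebra K S)" "g \<in> carrier (free_algebra K S)" "h f = h g" for f g
    using that alg_homD(2)[OF h]
    by (simp add: N_def mod_hom_minus[OF F.module_axioms E.module_axioms alg_homD(1)[OF h]]
        E.M.minus_eq E.M.r_neg)
  show ?thesis
    unfolding hom_relations_def Let_def N_def[symmetric]
    by (intro Un_least subsetI; clarify; intro diff) (simp_all add: alg_homD[OF hi] alg_homD[OF h] w)
qed

text \<open>Every nonempty word contains a letter and so evaluates to zero; only the constant term
  survives.\<close>

lemma free_eval_null:
  assumes "cring K" "assoc_algebra K E" "\<And>s. s \<in> S \<Longrightarrow> \<phi> s = \<zero>\<^bsub>E\<^esub>"
    and "f \<in> carrier (free_algebra K S)"
  shows "free_eval K E \<phi> f = f [] \<odot>\<^bsub>E\<^esub> \<one>\<^bsub>E\<^esub>"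
proof -
  interpret E: assoc_algebra K E by fact
  note K = assms(1)
  have \<phi>: "\<phi> s \<in> carrier E" if "s \<in> S" for s
    using assms(3) that by simp
  note hom = mod_homD[OF free_eval_mod_hom[where S = S and \<phi> = \<phi>, OF K assms(2) \<phi>]]
    mod_hom_zero[OF free_module[OF K] assoc_algebra_module[OF assms(2)]
      free_eval_mod_hom[where S = S and \<phi> = \<phi>, OF K assms(2) \<phi>]]
  have fK: "f w \<in> carrier K" if "f \<in> carrier (free_algebra K S)" for f w
    using that by (simp add: free_carrier)
  from assms(4) UNIV_I show ?thesis
  proof (induction rule: free_induct[OF K, consumes 2, case_names word add smult])
    case (word w)
    show ?case
    proof (cases w)
      case Nil
      then show ?thesis
        using free_eval_word[where S = S and \<phi> = \<phi>, OF K assms(2) \<phi>, of w]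
        by (simp add: word_elem_def)
    next
      case (Cons s v)
      then have "word_prod E \<phi> w = \<zero>\<^bsub>E\<^esub>"
        using word assms(3) word_prod_closed[where S = S and \<phi> = \<phi>, OF K assms(2) \<phi>, of v] by simp
      then show ?thesis
        using free_eval_word[where S = S and \<phi> = \<phi>, OF K assms(2) \<phi>, of w] word Cons
        by (simp add: word_elem_def)
    qed
  next
    case (add f g)
    have "free_eval K E \<phi> (f \<oplus>\<^bsub>free_algebra K S\<^esub> g) = free_eval K E \<phi> f \<oplus>\<^bsub>E\<^esub> free_eval K E \<phi> g"
      using add by (simp add: hom \<phi>)
    then show ?case
      using add by (simp add: fK E.smult_l_distr free_simps(3))
  next
    case (smult c f)
    have "free_eval K E \<phi> (c \<odot>\<^bsub>free_algebra K S\<^esub> f) = c \<odot>\<^bsub>E\<^esub> free_eval K E \<phi> f"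
      using smult by (simp add: hom \<phi>)
    then show ?case
      using smult by (simp add: fK E.smult_assoc1 free_simps(4))
  qed (subst hom(4), simp_all add: \<phi> free_simps(1))
qed

section \<open>Separating representations\<close>

locale split_pair =
  fixes K :: "('k, 'm) ring_scheme" (structure)
    and A1 :: "('k, 'a, 'n) module_scheme"
    and A2 :: "('k, 'b, 'p) module_scheme"
    and \<pi> :: "'a \<Rightarrow> 'k"
    and \<psi> :: "'b \<Rightarrow> (nat \<Rightarrow> 'k) set"
    and x :: 'b
  assumes K: "cring K" and A1: "assoc_algebra K A1" and A2: "assoc_algebra K A2"
    and \<pi>: "\<pi> \<in> mod_hom K A1 (base_algebra K)"
    and \<pi>_section: "\<And>c. c \<in> carrier K \<Longrightarrow> \<pi> (c \<odot>\<^bsub>A1\<^esub> \<one>\<^bsub>A1\<^esub>) = c"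
    and \<psi>: "\<psi> \<in> alg_hom K A2 (truncated_poly K)"
    and x: "x \<in> carrier A2" and \<psi>_x: "\<psi> x = truncated_x K"
begin

sublocale K: cring K by (rule K)
sublocale A1: assoc_algebra K A1 by (rule A1)
sublocale A2: assoc_algebra K A2 by (rule A2)

definition M1 where "M1 = A1\<lparr>carrier := a_kernel A1 (base_algebra K) \<pi>\<rparr>"
abbreviation W where "W \<equiv> word_elem K"
abbreviation FM where "FM \<equiv> free_algebra K (carrier M1)"
abbreviation F where "F \<equiv> free_algebra K (carrier A1 <+> carrier A2)"
abbreviation e where "e i y \<equiv> truncated_coeff K i (\<psi> y)"

sublocale FM: assoc_algebra K FM by (rule free_assoc_algebra[OF K])
sublocale F: assoc_algebra K F by (rule free_assoc_algebra[OF K])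

text \<open>The map from the tensor algebra to the coproduct, lifted to free algebras on both sides.
  On this level it can be composed with any representation and with any quotient of
  \<open>F\<close>, not only with \<open>B\<close>.\<close>

definition \<Theta> :: "('a list \<Rightarrow> 'k) \<Rightarrow> ('a + 'b) list \<Rightarrow> 'k"
  where "\<Theta> = free_eval K F (\<lambda>m. W [Inr x, Inl m, Inr x])"

lemma M1_carrier: "m \<in> carrier M1 \<longleftrightarrow> m \<in> carrier A1 \<and> \<pi> m = \<zero>"
  by (simp add: M1_def a_kernel_def')

lemma M1_simps [simp]:
  "zero M1 = zero A1" "add M1 = add A1" "smult M1 = smult A1" "one M1 = one A1" "mult M1 = mult A1"
  by (simp_all add: M1_def)

lemmas \<pi>_rules = mod_homD[OF \<pi>, simplified]

lemma \<pi>_one: "\<pi> \<one>\<^bsub>A1\<^esub> = \<one>"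
  using \<pi>_section[of "\<one>"] by simp

lemma M1_submodule: "submodule (carrier M1) K A1"
proof -
  note base = assoc_algebra_module[OF assoc_algebra_base[OF K]]
  show ?thesis
    using submodule_vimage[OF A1.module_axioms base \<pi> A1.carrier_is_submodule zero_submodule[OF base]]
    by (simp add: M1_def a_kernel_def')
qed

lemma M1_module: "module K M1"
  using submodule.submodule_is_module[OF M1_submodule A1.module_axioms] by (simp add: M1_def)

lemma sandwich_closed:
  "m \<in> carrier M1 \<Longrightarrow> W [Inr x, Inl m, Inr x] \<in> carrier F"
  using x by (intro free_word_closed K) (auto simp: M1_carrier intro: InlI InrI)

lemma \<Theta>_hom: "\<Theta> \<in> alg_hom K FM F"
  unfolding \<Theta>_def by (rule free_eval_alg_hom[OF K F.assoc_algebra_axioms sandwich_closed])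

lemma \<Theta>_letter: "m \<in> carrier M1 \<Longrightarrow> \<Theta> (W [m]) = W [Inr x, Inl m, Inr x]"
  unfolding \<Theta>_def by (rule free_eval_letter[OF K F.assoc_algebra_axioms sandwich_closed])

lemmas e_hom = truncated_coeff_hom[OF K \<psi>]
lemmas e_rules = mod_homD[OF e_hom, simplified]
lemmas e_mult = truncated_coeff_mult[OF K \<psi>]

lemma e_one: "i < 3 \<Longrightarrow> e i \<one>\<^bsub>A2\<^esub> = (if i = 0 then \<one> else \<zero>)"
  by (simp add: alg_homD(6)[OF \<psi>] truncated_coeff_one[OF K])

lemma e_x: "i < 3 \<Longrightarrow> e i x = (if i = 1 then \<one> else \<zero>)"
  by (simp add: \<psi>_x truncated_coeff_x[OF K])

lemma \<eta>_hom: "e 0 \<in> alg_hom K A2 (base_algebra K)"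
  by (rule alg_homI[OF e_hom]) (simp_all add: e_mult e_one)

section \<open>Homomorphisms from \<open>F\<close> given by a pair of algebra maps\<close>

context
  fixes E :: "('k, 'e, 'r) module_scheme" and \<phi>1 \<phi>2
  assumes E: "assoc_algebra K E"
    and \<phi>1: "\<phi>1 \<in> alg_hom K A1 E" and \<phi>2: "\<phi>2 \<in> alg_hom K A2 E"
begin

interpretation E: assoc_algebra K E by (rule E)

abbreviation "\<rho> \<equiv> free_eval K E (case_sum \<phi>1 \<phi>2)"

lemma \<phi>_closed: "s \<in> carrier A1 <+> carrier A2 \<Longrightarrow> case_sum \<phi>1 \<phi>2 s \<in> carrier E"
  using alg_homD(2)[OF \<phi>1] alg_homD(2)[OF \<phi>2] by auto

lemma \<rho>_hom: "\<rho> \<in> alg_hom K F E"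
  by (rule free_eval_alg_hom[OF K E \<phi>_closed])

lemma \<rho>_word: "w \<in> lists (carrier A1 <+> carrier A2) \<Longrightarrow> \<rho> (W w) = word_prod E (case_sum \<phi>1 \<phi>2) w"
  by (rule free_eval_word[OF K E \<phi>_closed])

lemma \<rho>_letter:
  "a \<in> carrier A1 \<Longrightarrow> \<rho> (W [Inl a]) = \<phi>1 a"
  "b \<in> carrier A2 \<Longrightarrow> \<rho> (W [Inr b]) = \<phi>2 b"
  using alg_homD(2)[OF \<phi>1] alg_homD(2)[OF \<phi>2] alg_homD(6)[OF \<phi>1] by (simp_all add: \<rho>_word InlI InrI)

lemma \<rho>_kernel_relations:
  "hom_relations K F A1 Inl \<subseteq> {f \<in> carrier F. \<rho> f = \<zero>\<^bsub>E\<^esub>}"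
  "hom_relations K F A2 Inr \<subseteq> {f \<in> carrier F. \<rho> f = \<zero>\<^bsub>E\<^esub>}"
proof -
  have "(\<lambda>a. \<rho> (W [Inl a])) \<in> alg_hom K A1 E"
    using alg_homD[OF \<phi>1] by (intro alg_homI mod_homI) (simp_all add: \<rho>_letter)
  then show "hom_relations K F A1 Inl \<subseteq> {f \<in> carrier F. \<rho> f = \<zero>\<^bsub>E\<^esub>}"
    by (intro hom_relations_kernel[OF A1 E _ \<rho>_hom]) auto
  have "(\<lambda>a. \<rho> (W [Inr a])) \<in> alg_hom K A2 E"
    using alg_homD[OF \<phi>2] by (intro alg_homI mod_homI) (simp_all add: \<rho>_letter)
  then show "hom_relations K F A2 Inr \<subseteq> {f \<in> carrier F. \<rho> f = \<zero>\<^bsub>E\<^esub>}"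
    by (intro hom_relations_kernel[OF A2 E _ \<rho>_hom]) auto
qed

text \<open>Both sides are algebra homomorphisms on \<open>FM\<close> with the same values on
  letters. Membership of \<open>\<Theta> f\<close> in the kernel of \<rho> thus depends only on the
  operators of the products \<open>x m x\<close>.\<close>

lemma \<rho>_\<Theta>:
  assumes "f \<in> carrier FM"
  shows "\<rho> (\<Theta> f) = free_eval K E (\<lambda>m. \<phi>2 x \<otimes>\<^bsub>E\<^esub> (\<phi>1 m \<otimes>\<^bsub>E\<^esub> \<phi>2 x)) f"
proof -
  have "(\<rho> \<circ> \<Theta>) f = free_eval K E (\<lambda>m. \<phi>2 x \<otimes>\<^bsub>E\<^esub> (\<phi>1 m \<otimes>\<^bsub>E\<^esub> \<phi>2 x)) f"
  proof (rule free_eval_unique[OF K E _ alg_hom_comp[OF \<Theta>_hom \<rho>_hom] _ assms])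
    fix m assume m: "m \<in> carrier M1"
    then have cl: "\<phi>1 m \<in> carrier E" "\<phi>2 x \<in> carrier E" "m \<in> carrier A1"
      using alg_homD(2)[OF \<phi>1] alg_homD(2)[OF \<phi>2] x
      by (auto simp: M1_carrier)
    then show "\<phi>2 x \<otimes>\<^bsub>E\<^esub> (\<phi>1 m \<otimes>\<^bsub>E\<^esub> \<phi>2 x) \<in> carrier E"
      by simp
    show "(\<rho> \<circ> \<Theta>) (W [m]) = \<phi>2 x \<otimes>\<^bsub>E\<^esub> (\<phi>1 m \<otimes>\<^bsub>E\<^esub> \<phi>2 x)"
      unfolding o_def \<Theta>_letter[OF m] using cl x by (subst \<rho>_word) (simp_all add: InlI InrI)
  qed
  then show ?thesis
    by simp
qed

lemma \<rho>_inj: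
  "a \<in> carrier A1 \<Longrightarrow> b \<in> carrier A1 \<Longrightarrow>
    \<rho> (W [Inl a] \<ominus>\<^bsub>F\<^esub> W [Inl b]) = \<zero>\<^bsub>E\<^esub> \<Longrightarrow> \<phi>1 a = \<phi>1 b"
  "y \<in> carrier A2 \<Longrightarrow> z \<in> carrier A2 \<Longrightarrow>
    \<rho> (W [Inr y] \<ominus>\<^bsub>F\<^esub> W [Inr z]) = \<zero>\<^bsub>E\<^esub> \<Longrightarrow> \<phi>2 y = \<phi>2 z"
proof -
  have eq: "u = v" if "u \<ominus>\<^bsub>E\<^esub> v = \<zero>\<^bsub>E\<^esub>" "u \<in> carrier E" "v \<in> carrier E" for u v
  proof -
    have "u = u \<ominus>\<^bsub>E\<^esub> v \<oplus>\<^bsub>E\<^esub> v"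
      using that(2,3) by (simp add: E.M.minus_eq E.M.a_assoc E.M.l_neg)
    then show ?thesis
      using that by simp
  qed
  have w: "W [s] \<in> carrier F" if "s \<in> carrier A1 <+> carrier A2" for s
    using that by (intro free_word_closed K) simp
  note minus = mod_hom_minus[OF F.module_axioms E.module_axioms alg_homD(1)[OF \<rho>_hom]]
  show "\<phi>1 a = \<phi>1 b" if "a \<in> carrier A1" "b \<in> carrier A1"
    "\<rho> (W [Inl a] \<ominus>\<^bsub>F\<^esub> W [Inl b]) = \<zero>\<^bsub>E\<^esub>"
    using that alg_homD(2)[OF \<phi>1] by - (rule eq; simp add: minus w \<rho>_letter InlI InrI)
  show "\<phi>2 y = \<phi>2 z" if "y \<in> carrier A2" "z \<in> carrier A2"
    "\<rho> (W [Inr y] \<ominus>\<^bsub>F\<^esub> W [Inr z]) = \<zero>\<^bsub>E\<^esub>"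
    using that alg_homD(2)[OF \<phi>2] by - (rule eq; simp add: minus w \<rho>_letter InlI InrI)
qed

end

section \<open>Three representations and the intersection of their kernels\<close>

abbreviation rels where "rels \<equiv> hom_relations K F A1 Inl \<union> hom_relations K F A2 Inr"

lemma \<Theta>_closed: "f \<in> carrier FM \<Longrightarrow> \<Theta> f \<in> carrier F"
  by (rule alg_homD(2)[OF \<Theta>_hom])

lemma \<pi>_zero: "\<pi> \<zero>\<^bsub>A1\<^esub> = \<zero>"
  using mod_hom_zero[OF A1.module_axioms assoc_algebra_module[OF assoc_algebra_base[OF K]] \<pi>] by simp

text \<open>\<open>A1\<close> is mapped identically to itself and \<open>A2\<close> through the
  constant coefficient \<open>e 0\<close>. Then \<open>x\<close> goes to zero, so
  \<open>\<Theta> f\<close> goes to \<open>f [] 1\<close>, and \<pi> recovers \<open>f []\<close>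
  from this.\<close>

lemma separate_A1:
  "\<exists>J. ideal J F \<and> rels \<subseteq> J \<and> (\<forall>f\<in>carrier FM. \<Theta> f \<in> J \<longleftrightarrow> f [] = \<zero>) \<and>
    (\<forall>a\<in>carrier A1. \<forall>b\<in>carrier A1. W [Inl a] \<ominus>\<^bsub>F\<^esub> W [Inl b] \<in> J \<longrightarrow> a = b)"
proof -
  define \<phi>2 where "\<phi>2 y = e 0 y \<odot>\<^bsub>A1\<^esub> \<one>\<^bsub>A1\<^esub>" for y
  have id: "(\<lambda>a. a) \<in> alg_hom K A1 A1"
    by (intro alg_homI mod_homI) simp_all
  have \<phi>2: "\<phi>2 \<in> alg_hom K A2 A1"
    by (intro alg_homI mod_homI)
      (simp_all add: \<phi>2_def e_rules e_mult e_one A1.smult_l_distr A1.smult_assoc1 A1.smult_mult_left)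
  let ?\<rho> = "free_eval K A1 (case_sum (\<lambda>a. a) \<phi>2)"
  let ?J = "{f \<in> carrier F. ?\<rho> f = \<zero>\<^bsub>A1\<^esub>}"
  have "\<Theta> f \<in> ?J \<longleftrightarrow> f [] = \<zero>" if f: "f \<in> carrier FM" for f
  proof -
    have x0: "\<phi>2 x = \<zero>\<^bsub>A1\<^esub>"
      by (simp add: \<phi>2_def e_x)
    have "?\<rho> (\<Theta> f) = f [] \<odot>\<^bsub>A1\<^esub> \<one>\<^bsub>A1\<^esub>"
      unfolding \<rho>_\<Theta>[OF A1 id \<phi>2 f]
      by (rule free_eval_null[OF K A1 _ f]) (simp add: x0 M1_carrier)
    moreover have "f [] \<in> carrier K"
      using f by (simp add: free_carrier)
    ultimately show ?thesis
      using \<Theta>_closed[OF f] \<pi>_section[of "f []"] \<pi>_zero by auto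
  qed
  moreover have "ideal ?J F"
    by (rule kernel_ideal[OF F.assoc_algebra_axioms A1 \<rho>_hom[OF A1 id \<phi>2]])
  ultimately show ?thesis
    using \<rho>_kernel_relations[OF A1 id \<phi>2] \<rho>_inj(1)[OF A1 id \<phi>2]
    by (intro exI[of _ ?J]) simp
qed

text \<open>Sending \<open>A1\<close> to \<open>A2\<close> by \<open>a \<mapsto> \<pi> a 1\<close>
  is not possible, since \<pi> need not be multiplicative. The coinduced module with
  \<open>P = A2\<close> gets around this: there \<pi> is used only as a linear map, and each
  \<open>x m x\<close> acts with a factor \<open>\<pi> m = 0\<close>.\<close>

lemma separate_A2:
  "\<exists>J. ideal J F \<and> rels \<subseteq> J \<and> (\<forall>f\<in>carrier FM. f [] = \<zero> \<longrightarrow> \<Theta> f \<in> J) \<and>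
    (\<forall>a\<in>carrier A2. \<forall>b\<in>carrier A2. W [Inr a] \<ominus>\<^bsub>F\<^esub> W [Inr b] \<in> J \<longrightarrow> a = b)"
proof -
  \<comment> \<open>The projection of \<open>A2\<close> onto the kernel of the augmentation
    \<open>e 0\<close> along \<open>K 1\<close>.\<close>
  define N where "N y = y \<ominus>\<^bsub>A2\<^esub> e 0 y \<odot>\<^bsub>A2\<^esub> \<one>\<^bsub>A2\<^esub>" for y
  have N_closed: "N y \<in> carrier A2" if "y \<in> carrier A2" for y
    using that by (simp add: N_def e_rules)
  have N_unique: "N y = u" if "y = u \<oplus>\<^bsub>A2\<^esub> e 0 y \<odot>\<^bsub>A2\<^esub> \<one>\<^bsub>A2\<^esub>" "u \<in> carrier A2" "e 0 y \<in> carrier K" for y u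
  proof -
    have "N y = (u \<oplus>\<^bsub>A2\<^esub> e 0 y \<odot>\<^bsub>A2\<^esub> \<one>\<^bsub>A2\<^esub>) \<ominus>\<^bsub>A2\<^esub> e 0 y \<odot>\<^bsub>A2\<^esub> \<one>\<^bsub>A2\<^esub>"
      unfolding N_def using that(1) by simp
    also have "\<dots> = u"
      using that(2,3) by (simp add: A2.M.minus_eq A2.M.a_assoc A2.M.r_neg)
    finally show ?thesis .
  qed
  have split: "y = N y \<oplus>\<^bsub>A2\<^esub> e 0 y \<odot>\<^bsub>A2\<^esub> \<one>\<^bsub>A2\<^esub>" if "y \<in> carrier A2" for y
    using that by (simp add: N_def e_rules A2.M.minus_eq A2.M.a_assoc A2.M.l_neg)
  have N_add: "N (y \<oplus>\<^bsub>A2\<^esub> z) = N y \<oplus>\<^bsub>A2\<^esub> N z" if y: "y \<in> carrier A2" and z: "z \<in> carrier A2" for y z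
  proof (rule N_unique)
    have "y \<oplus>\<^bsub>A2\<^esub> z = (N y \<oplus>\<^bsub>A2\<^esub> e 0 y \<odot>\<^bsub>A2\<^esub> \<one>\<^bsub>A2\<^esub>) \<oplus>\<^bsub>A2\<^esub> (N z \<oplus>\<^bsub>A2\<^esub> e 0 z \<odot>\<^bsub>A2\<^esub> \<one>\<^bsub>A2\<^esub>)"
      using split[OF y] split[OF z] by simp
    moreover have "e 0 (y \<oplus>\<^bsub>A2\<^esub> z) = e 0 y \<oplus> e 0 z"
      using y z by (simp add: e_rules)
    ultimately show "y \<oplus>\<^bsub>A2\<^esub> z = N y \<oplus>\<^bsub>A2\<^esub> N z \<oplus>\<^bsub>A2\<^esub> e 0 (y \<oplus>\<^bsub>A2\<^esub> z) \<odot>\<^bsub>A2\<^esub> \<one>\<^bsub>A2\<^esub>"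
      using y z by (simp add: e_rules(1) N_closed A2.smult_l_distr A2.M.a_ac)
  qed (use y z in \<open>simp_all add: N_closed e_rules\<close>)
  have N_smult: "N (c \<odot>\<^bsub>A2\<^esub> y) = c \<odot>\<^bsub>A2\<^esub> N y" if c: "c \<in> carrier K" and y: "y \<in> carrier A2" for c y
  proof (rule N_unique)
    have "c \<odot>\<^bsub>A2\<^esub> y = c \<odot>\<^bsub>A2\<^esub> (N y \<oplus>\<^bsub>A2\<^esub> e 0 y \<odot>\<^bsub>A2\<^esub> \<one>\<^bsub>A2\<^esub>)"
      using split[OF y] by simp
    moreover have "e 0 (c \<odot>\<^bsub>A2\<^esub> y) = c \<otimes> e 0 y"
      using c y by (simp add: e_rules)
    ultimately show "c \<odot>\<^bsub>A2\<^esub> y = c \<odot>\<^bsub>A2\<^esub> N y \<oplus>\<^bsub>A2\<^esub> e 0 (c \<odot>\<^bsub>A2\<^esub> y) \<odot>\<^bsub>A2\<^esub> \<one>\<^bsub>A2\<^esub>"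
      using c y by (simp add: e_rules(1) N_closed A2.smult_r_distr A2.smult_assoc1)
  qed (use c y in \<open>simp_all add: N_closed e_rules\<close>)
  have comm: "c \<odot>\<^bsub>A2\<^esub> (d \<odot>\<^bsub>A2\<^esub> p) = d \<odot>\<^bsub>A2\<^esub> (c \<odot>\<^bsub>A2\<^esub> p)"
    if "c \<in> carrier K" "d \<in> carrier K" "p \<in> carrier A2" for c d p
    using that by (metis A2.smult_assoc1 K.m_comm)
  have N_mult: "N (y \<otimes>\<^bsub>A2\<^esub> z) = e 0 y \<odot>\<^bsub>A2\<^esub> N z \<oplus>\<^bsub>A2\<^esub> e 0 z \<odot>\<^bsub>A2\<^esub> N y \<oplus>\<^bsub>A2\<^esub> N y \<otimes>\<^bsub>A2\<^esub> N z"
    if y: "y \<in> carrier A2" and z: "z \<in> carrier A2" for y z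
  proof (rule N_unique)
    have "y \<otimes>\<^bsub>A2\<^esub> z = (N y \<oplus>\<^bsub>A2\<^esub> e 0 y \<odot>\<^bsub>A2\<^esub> \<one>\<^bsub>A2\<^esub>) \<otimes>\<^bsub>A2\<^esub> (N z \<oplus>\<^bsub>A2\<^esub> e 0 z \<odot>\<^bsub>A2\<^esub> \<one>\<^bsub>A2\<^esub>)"
      using split[OF y] split[OF z] by simp
    moreover have "e 0 (y \<otimes>\<^bsub>A2\<^esub> z) = e 0 y \<otimes> e 0 z"
      using y z by (simp add: e_mult)
    ultimately show "y \<otimes>\<^bsub>A2\<^esub> z = e 0 y \<odot>\<^bsub>A2\<^esub> N z \<oplus>\<^bsub>A2\<^esub> e 0 z \<odot>\<^bsub>A2\<^esub> N y \<oplus>\<^bsub>A2\<^esub> N y \<otimes>\<^bsub>A2\<^esub> N z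
        \<oplus>\<^bsub>A2\<^esub> e 0 (y \<otimes>\<^bsub>A2\<^esub> z) \<odot>\<^bsub>A2\<^esub> \<one>\<^bsub>A2\<^esub>"
      using y z by (simp add: e_rules(1) N_closed A2.smult_r_distr A2.smult_assoc1 A2.smult_mult_left comm
          A2.smult_mult_right A2.M.l_distr A2.M.r_distr A2.M.a_ac)
  qed (use y z in \<open>simp_all add: N_closed e_rules\<close>)
  have N_one: "N \<one>\<^bsub>A2\<^esub> = \<zero>\<^bsub>A2\<^esub>"
    by (rule N_unique) (simp_all add: e_one)
  \<comment> \<open>Because \<open>\<pi> 1 = 1\<close>, the operator of \<open>y\<close> at
    \<open>b = 1\<close> is multiplication by \<open>N y\<close>, and \<open>Z_mult\<close> becomes
    \<open>N_mult\<close>.\<close>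
  define Z where "Z y b p = \<pi> b \<odot>\<^bsub>A2\<^esub> (N y \<otimes>\<^bsub>A2\<^esub> p)" for y b p
  interpret rep: coinduced_rep K A1 A2 A2 "e 0" Z
    by (unfold_locales; (rule \<eta>_hom)?)
      (simp_all add: Z_def N_closed N_add N_smult N_mult N_one \<pi>_rules \<pi>_one e_rules A2.smult_l_distr
        A2.smult_r_distr A2.smult_assoc1 A2.smult_mult_left A2.smult_mult_right A2.M.l_distr
        A2.M.r_distr A2.M.m_assoc comm)
  let ?E = "end_algebra K rep.V"
  note E = end_algebra_assoc_algebra[OF rep.V_module] rep.act1_hom rep.act2_hom
  let ?J = "{f \<in> carrier F. free_eval K ?E (case_sum rep.act1 rep.act2) f = \<zero>\<^bsub>?E\<^esub>}"
  interpret E: assoc_algebra K ?E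
    by (rule E)
  have "\<Theta> f \<in> ?J" if f: "f \<in> carrier FM" "f [] = \<zero>" for f
  proof -
    have "rep.act2 x \<otimes>\<^bsub>?E\<^esub> (rep.act1 m \<otimes>\<^bsub>?E\<^esub> rep.act2 x) = \<zero>\<^bsub>?E\<^esub>" if "m \<in> carrier M1" for m
    proof -
      have m: "m \<in> carrier A1" "\<pi> m = \<zero>"
        using that by (auto simp: M1_carrier)
      have mem: "rep.act2 x \<otimes>\<^bsub>?E\<^esub> (rep.act1 m \<otimes>\<^bsub>?E\<^esub> rep.act2 x) \<in> carrier ?E"
        using m x by (simp add: alg_homD(2)[OF E(2)] alg_homD(2)[OF E(3)])
      show ?thesis
      proof (rule extensionalityI[of _ "carrier rep.V"])
        fix h assume h: "h \<in> carrier rep.V"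
        have "(rep.act2 x \<otimes>\<^bsub>?E\<^esub> (rep.act1 m \<otimes>\<^bsub>?E\<^esub> rep.act2 x)) h \<in> carrier rep.V"
          using mem h unfolding end_algebra_simps by (rule hom_moduleD(1))
        then show "(rep.act2 x \<otimes>\<^bsub>?E\<^esub> (rep.act1 m \<otimes>\<^bsub>?E\<^esub> rep.act2 x)) h = \<zero>\<^bsub>?E\<^esub> h"
          using h m x rep.V_rules(1)[OF h]
          by (intro extensionalityI[of _ "carrier A1"])
            (auto simp: rep.act_sandwich e_x end_algebra_simps(2) hom_module_simps Z_def N_closed \<pi>_rules
              dest: rep.V_rules(4))
      qed (use mem E.M.zero_closed in \<open>auto simp: end_algebra_simps(1) dest: hom_moduleD(4)\<close>)
    qed
    then have "free_eval K ?E (case_sum rep.act1 rep.act2) (\<Theta> f) = f [] \<odot>\<^bsub>?E\<^esub> \<one>\<^bsub>?E\<^esub>"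
      unfolding \<rho>_\<Theta>[OF E f(1)] by (intro free_eval_null[OF K E(1) _ f(1)])
    then show ?thesis
      using \<Theta>_closed[OF f(1)] f(2) by simp
  qed
  moreover have "y = z" if y: "y \<in> carrier A2" and z: "z \<in> carrier A2" and eq: "rep.act2 y = rep.act2 z" for y z
  proof -
    \<comment> \<open>A function with value 1 at 1: the value of \<open>act2 y h\<close> at 1 is
      \<open>e 0 y + N y\<close>, that is, \<open>y\<close> itself.\<close>
    define h where "h = (\<lambda>b\<in>carrier A1. \<pi> b \<odot>\<^bsub>A2\<^esub> \<one>\<^bsub>A2\<^esub>)"
    have h: "h \<in> carrier rep.V"
      unfolding h_def
      by (rule hom_moduleI) (simp_all add: \<pi>_rules A2.smult_l_distr A2.smult_assoc1 A1.module_axioms)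
    have "rep.act2 y h \<one>\<^bsub>A1\<^esub> = y" if "y \<in> carrier A2" for y
      using split[OF that] that h N_closed[OF that]
      by (simp add: rep.act2_def h_def \<pi>_one Z_def A2.M.a_comm e_rules)
    then show ?thesis
      using y z eq by metis
  qed
  moreover have "ideal ?J F"
    by (rule kernel_ideal[OF F.assoc_algebra_axioms E(1) \<rho>_hom[OF E]])
  ultimately show ?thesis
    using \<rho>_kernel_relations[OF E] \<rho>_inj(2)[OF E]
    by (intro exI[of _ ?J] conjI; auto)
qed

lemma separate_tensor:
  assumes Q: "assoc_algebra K Q" and \<mu>: "\<mu> \<in> mod_hom K M1 Q"
  shows "\<exists>J. ideal J F \<and> rels \<subseteq> J \<and>
    (\<forall>f\<in>carrier FM. f [] = \<zero> \<longrightarrow> (\<Theta> f \<in> J \<longleftrightarrow> free_eval K Q \<mu> f = \<zero>\<^bsub>Q\<^esub>))"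
proof -
  interpret Q: assoc_algebra K Q by (rule Q)
  \<comment> \<open>The projection of \<open>A1\<close> onto \<open>M1\<close> along
    \<open>K 1\<close>.\<close>
  define pr where "pr b = b \<ominus>\<^bsub>A1\<^esub> \<pi> b \<odot>\<^bsub>A1\<^esub> \<one>\<^bsub>A1\<^esub>" for b
  have pr_M1: "pr b \<in> carrier M1" if "b \<in> carrier A1" for b
  proof -
    have "\<pi> (pr b) = \<pi> (b \<oplus>\<^bsub>A1\<^esub> (\<ominus> \<pi> b) \<odot>\<^bsub>A1\<^esub> \<one>\<^bsub>A1\<^esub>)"
      using that by (simp add: pr_def A1.M.minus_eq \<pi>_rules A1.smult_l_minus)
    also have "\<dots> = \<zero>"
      using that by (simp add: \<pi>_rules \<pi>_one K.r_neg)
    finally show ?thesis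
      using that by (simp add: M1_carrier) (simp add: pr_def \<pi>_rules)
  qed
  have pr_closed: "pr b \<in> carrier A1" if "b \<in> carrier A1" for b
    using pr_M1[OF that] by (simp add: M1_carrier)
  have pr_add: "pr (a \<oplus>\<^bsub>A1\<^esub> b) = pr a \<oplus>\<^bsub>A1\<^esub> pr b" if "a \<in> carrier A1" "b \<in> carrier A1" for a b
    using that by (simp add: pr_def \<pi>_rules A1.smult_l_distr A1.M.minus_eq A1.M.minus_add A1.M.a_ac)
  have pr_smult: "pr (c \<odot>\<^bsub>A1\<^esub> b) = c \<odot>\<^bsub>A1\<^esub> pr b" if "c \<in> carrier K" "b \<in> carrier A1" for c b
    using that by (simp add: pr_def \<pi>_rules A1.smult_r_distr A1.M.minus_eq A1.smult_r_minus A1.smult_assoc1)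
  have pr_one: "pr \<one>\<^bsub>A1\<^esub> = \<zero>\<^bsub>A1\<^esub>"
    by (simp add: pr_def \<pi>_one A1.M.minus_eq A1.M.r_neg)
  have pr_eq: "pr m = m" if "m \<in> carrier M1" for m
    using that by (simp add: pr_def M1_carrier A1.M.minus_eq)
  note \<mu>_rules = mod_homD[OF \<mu>, simplified]
  have \<mu>_zero: "\<mu> \<zero>\<^bsub>A1\<^esub> = \<zero>\<^bsub>Q\<^esub>"
    using mod_hom_zero[OF M1_module Q.module_axioms \<mu>] by simp
  define P where "P = prod_module Q Q"
  note P_ops = prod_module_simps[where M = Q and N = Q, folded P_def]
  have P: "module K P"
    unfolding P_def by (rule prod_module_is_module[OF Q.module_axioms Q.module_axioms])
  txt \<open>This is \<open>e 1 y \<cdot> Y b + e 2 y \<cdot> Y b \<circ> Y 1\<close>, where \<open>Y b (p1, p2) = (\<mu> (pr b) p2, \<pi> b p1)\<close>.\<close>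
  define Z where "Z y b p =
    (e 1 y \<odot>\<^bsub>Q\<^esub> (\<mu> (pr b) \<otimes>\<^bsub>Q\<^esub> snd p) \<oplus>\<^bsub>Q\<^esub> e 2 y \<odot>\<^bsub>Q\<^esub> (\<mu> (pr b) \<otimes>\<^bsub>Q\<^esub> fst p),
     (e 1 y \<otimes> \<pi> b) \<odot>\<^bsub>Q\<^esub> fst p)" for y b p
  have comm: "c \<odot>\<^bsub>Q\<^esub> (d \<odot>\<^bsub>Q\<^esub> p) = d \<odot>\<^bsub>Q\<^esub> (c \<odot>\<^bsub>Q\<^esub> p)"
    if "c \<in> carrier K" "d \<in> carrier K" "p \<in> carrier Q" for c d p
    using that by (metis Q.smult_assoc1 K.m_comm)
  \<comment> \<open>The condition \<open>Z_mult\<close> rests on \<open>Y 1 (Y 1 p) = 0\<close>, a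
    consequence of \<open>pr 1 = 0\<close>. It reduces \<open>Z y b (Z z 1 p)\<close> to
    \<open>e 1 y e 1 z Y b (Y 1 p)\<close>, which is the middle term in the formula for
    \<open>e 2\<close> of a product.\<close>
  interpret rep: coinduced_rep K A1 A2 P "e 0" Z
  proof (rule coinduced_rep.intro[OF A1 A2 P \<eta>_hom])
  qed (auto simp: P_def Z_def prod_module_simps pr_M1 pr_add pr_smult pr_one \<mu>_rules \<mu>_zero \<pi>_rules
        \<pi>_one e_rules e_mult e_mult(2)[unfolded One_nat_def] e_one Q.smult_l_distr Q.smult_r_distr Q.smult_assoc1 Q.smult_mult_left
        Q.smult_mult_right Q.M.l_distr Q.M.r_distr comm Q.M.a_ac)
  let ?E = "end_algebra K rep.V"
  note E = end_algebra_assoc_algebra[OF rep.V_module] rep.act1_hom rep.act2_hom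
  let ?\<rho> = "free_eval K ?E (case_sum rep.act1 rep.act2)"
  let ?J = "{f \<in> carrier F. ?\<rho> f = \<zero>\<^bsub>?E\<^esub>}"
  interpret E: assoc_algebra K ?E
    by (rule E)
  \<comment> \<open>With \<open>h(1) = (p1, p2)\<close>, the first \<open>x\<close> takes the value
    \<open>(\<mu> m p2, 0)\<close> at \<open>m\<close>, as \<open>\<pi> m = 0\<close>; the second
    \<open>x\<close> turns this into \<open>(0, \<pi> b (\<mu> m p2))\<close>. So \<open>q\<close>
    stands for the element of \<open>Q\<close> by which a product of such operators multiplies the
    second slot.\<close>
  let ?val = "\<lambda>q h b. (\<zero>\<^bsub>Q\<^esub>, \<pi> b \<odot>\<^bsub>Q\<^esub> (q \<otimes>\<^bsub>Q\<^esub> snd (h \<one>\<^bsub>A1\<^esub>)))"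
  let ?T = "\<lambda>m. rep.act2 x \<otimes>\<^bsub>?E\<^esub> (rep.act1 m \<otimes>\<^bsub>?E\<^esub> rep.act2 x)"
  have T_closed: "?T m \<in> carrier ?E" if "m \<in> carrier M1" for m
    using that x by (simp add: M1_carrier alg_homD(2)[OF E(2)] alg_homD(2)[OF E(3)])
  have ev_T: "free_eval K ?E ?T (W w) = word_prod ?E ?T w" "word_prod ?E ?T w \<in> carrier ?E"
    if "w \<in> lists (carrier M1)" for w
    by (rule free_eval_word[where S = "carrier M1", OF K E(1)] word_prod_closed[where S = "carrier M1", OF K E(1)],
        erule T_closed, rule that)+
  have ev_T_hom: "free_eval K ?E ?T \<in> alg_hom K FM ?E"
    by (rule free_eval_alg_hom[OF K E(1) T_closed])
  have ev_\<mu>: "free_eval K Q \<mu> (W w) = word_prod Q \<mu> w" "word_prod Q \<mu> w \<in> carrier Q"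
    if "w \<in> lists (carrier M1)" for w
    by (rule free_eval_word[where S = "carrier M1", OF K Q] word_prod_closed[where S = "carrier M1", OF K Q],
        erule \<mu>_rules(1), rule that)+
  have ev_\<mu>_hom: "free_eval K Q \<mu> \<in> alg_hom K FM Q"
    by (rule free_eval_alg_hom[OF K Q \<mu>_rules(1)])
  have V_one: "fst (h \<one>\<^bsub>A1\<^esub>) \<in> carrier Q" "snd (h \<one>\<^bsub>A1\<^esub>) \<in> carrier Q" if "h \<in> carrier rep.V" for h
    using rep.V_rules(1)[OF that, of "\<one>\<^bsub>A1\<^esub>"] by (auto simp: P_def prod_module_simps)
  have T: "?T m h b = ?val (\<mu> m) h b"
    if "m \<in> carrier M1" "h \<in> carrier rep.V" "b \<in> carrier A1" for m h b
  proof -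
    have "m \<in> carrier A1" "\<pi> m = \<zero>"
      using that(1) by (auto simp: M1_carrier)
    then show ?thesis
      using that V_one[OF that(2)] x
      by (simp add: rep.act_sandwich e_x Z_def pr_eq pr_M1 \<mu>_rules \<pi>_rules)
  qed
  have E_apply: "(u \<otimes>\<^bsub>?E\<^esub> v) h = u (v h)" "(u \<oplus>\<^bsub>?E\<^esub> v) h b = u h b \<oplus>\<^bsub>P\<^esub> v h b"
    "(c \<odot>\<^bsub>?E\<^esub> u) h b = c \<odot>\<^bsub>P\<^esub> u h b" "\<zero>\<^bsub>?E\<^esub> h b = (\<zero>\<^bsub>Q\<^esub>, \<zero>\<^bsub>Q\<^esub>)"
    if "h \<in> carrier rep.V" "b \<in> carrier A1" for u v c h b
    using that by (simp_all add: end_algebra_simps compose_def hom_module_simps P_def prod_module_simps)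
  have E_V: "u h \<in> carrier rep.V" if "u \<in> carrier ?E" "h \<in> carrier rep.V" for u h
    using that unfolding end_algebra_simps by (rule hom_moduleD(1))
  \<comment> \<open>The second slot of \<open>?val q h\<close> at 1 is again \<open>q\<close> times
    the second slot of \<open>h(1)\<close>, so factors accumulate along the word. The empty word is
    excluded because it acts as the identity.\<close>
  have word_apply: "word_prod ?E ?T w h b = ?val (word_prod Q \<mu> w) h b"
    if "w \<in> lists (carrier M1)" "w \<noteq> []" "h \<in> carrier rep.V" "b \<in> carrier A1" for w h b
    using that
  proof (induction w arbitrary: b)
    case (Cons m v)
    note mvhb = Cons.hyps Cons.prems(2,3)
    show ?case
    proof (cases "v = []")
      case True
      then show ?thesis
        using mvhb T_closed by (simp add: T \<mu>_rules)
    next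
      case False
      let ?W = "word_prod ?E ?T v"
      note W = ev_T(2)[OF mvhb(2)] ev_\<mu>(2)[OF mvhb(2)]
      have Qv: "word_prod Q \<mu> v \<otimes>\<^bsub>Q\<^esub> snd (h \<one>\<^bsub>A1\<^esub>) \<in> carrier Q"
        using W(2) V_one(2)[OF mvhb(3)] by simp
      then have "snd (?W h \<one>\<^bsub>A1\<^esub>) = word_prod Q \<mu> v \<otimes>\<^bsub>Q\<^esub> snd (h \<one>\<^bsub>A1\<^esub>)"
        unfolding Cons.IH[OF False mvhb(3) A1.M.one_closed] by (simp add: \<pi>_one)
      then have "?T m (?W h) b = (\<zero>\<^bsub>Q\<^esub>, \<pi> b \<odot>\<^bsub>Q\<^esub> (\<mu> m \<otimes>\<^bsub>Q\<^esub> (word_prod Q \<mu> v \<otimes>\<^bsub>Q\<^esub> snd (h \<one>\<^bsub>A1\<^esub>))))"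
        using T[OF mvhb(1) E_V[OF W(1) mvhb(3)] mvhb(4)] by simp
      moreover have "word_prod ?E ?T (m # v) h b = ?T m (?W h) b"
        by (simp only: word_prod_simps E_apply(1)[OF mvhb(3,4)])
      moreover have "word_prod Q \<mu> (m # v) \<otimes>\<^bsub>Q\<^esub> snd (h \<one>\<^bsub>A1\<^esub>) =
          \<mu> m \<otimes>\<^bsub>Q\<^esub> (word_prod Q \<mu> v \<otimes>\<^bsub>Q\<^esub> snd (h \<one>\<^bsub>A1\<^esub>))"
        using \<mu>_rules(1)[OF mvhb(1)] W(2) V_one(2)[OF mvhb(3)] by (simp add: Q.M.m_assoc)
      ultimately show ?thesis
        by (simp only:)
    qed
  qed simp
  note FM_Q = mod_hom_zero[OF FM.module_axioms Q.module_axioms alg_homD(1)[OF ev_\<mu>_hom]]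
  note FM_E = mod_hom_zero[OF FM.module_axioms E.module_axioms alg_homD(1)[OF ev_T_hom]]
  have main: "free_eval K ?E ?T f h b = ?val (free_eval K Q \<mu> f) h b"
    if f: "f \<in> carrier FM" "f [] = \<zero>" and hb: "h \<in> carrier rep.V" "b \<in> carrier A1" for f h b
  proof -
    have supp: "w \<in> {w. w \<noteq> []}" if "f w \<noteq> \<zero>" for w
      using f that by auto
    show ?thesis
    proof (rule free_induct[OF K f(1) supp], assumption)
      fix w :: "'a list" assume "w \<in> lists (carrier M1)" "w \<in> {w. w \<noteq> []}"
      then show "free_eval K ?E ?T (W w) h b =
          ?val (free_eval K Q \<mu> (W w)) h b"
        using hb ev_T(1)[of w] ev_\<mu>(1)[of w] word_apply[of w h b] by simp
    next
      fix f g assume fg: "f \<in> carrier FM" "g \<in> carrier FM"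
        "free_eval K ?E ?T f h b = ?val (free_eval K Q \<mu> f) h b"
        "free_eval K ?E ?T g h b = ?val (free_eval K Q \<mu> g) h b"
      have "free_eval K ?E ?T (f \<oplus>\<^bsub>FM\<^esub> g) = free_eval K ?E ?T f \<oplus>\<^bsub>?E\<^esub> free_eval K ?E ?T g"
        using fg by (intro alg_homD(3)[OF ev_T_hom])
      moreover have "free_eval K Q \<mu> (f \<oplus>\<^bsub>FM\<^esub> g) = free_eval K Q \<mu> f \<oplus>\<^bsub>Q\<^esub> free_eval K Q \<mu> g"
        using fg by (intro alg_homD(3)[OF ev_\<mu>_hom])
      ultimately show "free_eval K ?E ?T (f \<oplus>\<^bsub>FM\<^esub> g) h b =
          ?val (free_eval K Q \<mu> (f \<oplus>\<^bsub>FM\<^esub> g)) h b"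
        using fg hb V_one alg_homD(2)[OF ev_\<mu>_hom]
        by (simp add: E_apply P_ops Q.M.l_distr Q.smult_r_distr \<pi>_rules)
    next
      fix c f assume cf: "c \<in> carrier K" "f \<in> carrier FM"
        "free_eval K ?E ?T f h b = ?val (free_eval K Q \<mu> f) h b"
      have "free_eval K ?E ?T (c \<odot>\<^bsub>FM\<^esub> f) = c \<odot>\<^bsub>?E\<^esub> free_eval K ?E ?T f"
        using cf by (intro alg_homD(4)[OF ev_T_hom])
      moreover have "free_eval K Q \<mu> (c \<odot>\<^bsub>FM\<^esub> f) = c \<odot>\<^bsub>Q\<^esub> free_eval K Q \<mu> f"
        using cf by (intro alg_homD(4)[OF ev_\<mu>_hom])
      ultimately show "free_eval K ?E ?T (c \<odot>\<^bsub>FM\<^esub> f) h b =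
          ?val (free_eval K Q \<mu> (c \<odot>\<^bsub>FM\<^esub> f)) h b"
        using cf hb V_one alg_homD(2)[OF ev_\<mu>_hom]
        by (simp add: E_apply P_ops Q.smult_mult_left comm \<pi>_rules)
    qed (use hb V_one in \<open>simp add: FM_Q FM_E E_apply \<pi>_rules\<close>)
  qed
  have "\<Theta> f \<in> ?J \<longleftrightarrow> free_eval K Q \<mu> f = \<zero>\<^bsub>Q\<^esub>" if f: "f \<in> carrier FM" "f [] = \<zero>" for f
  proof -
    let ?G = "free_eval K ?E ?T f"
    have G: "?G \<in> carrier ?E"
      by (rule alg_homD(2)[OF ev_T_hom f(1)])
    have "?G = \<zero>\<^bsub>?E\<^esub>" if "free_eval K Q \<mu> f = \<zero>\<^bsub>Q\<^esub>"
    proof (rule extensionalityI[of _ "carrier rep.V"])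
      fix h assume h: "h \<in> carrier rep.V"
      show "?G h = \<zero>\<^bsub>?E\<^esub> h"
      proof (rule extensionalityI[of _ "carrier A1"])
        show "?G h b = \<zero>\<^bsub>?E\<^esub> h b" if "b \<in> carrier A1" for b
          using h that f V_one[OF h] \<open>free_eval K Q \<mu> f = \<zero>\<^bsub>Q\<^esub>\<close> by (simp add: main E_apply \<pi>_rules)
      qed (use E_V[OF G h] E_V[OF E.M.zero_closed h] in \<open>auto dest: rep.V_rules(4)\<close>)
    qed (use G E.M.zero_closed in \<open>auto simp: end_algebra_simps(1) dest: hom_moduleD(4)\<close>)
    moreover have "free_eval K Q \<mu> f = \<zero>\<^bsub>Q\<^esub>" if "?G = \<zero>\<^bsub>?E\<^esub>"
    proof -
      \<comment> \<open>At 1 this function has slots 0 and 1, so \<open>?G h\<close> at 1 shows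
        \<open>free_eval K Q \<mu> f\<close> in its second slot.\<close>
      define h where "h = (\<lambda>b\<in>carrier A1. (\<zero>\<^bsub>Q\<^esub>, \<pi> b \<odot>\<^bsub>Q\<^esub> \<one>\<^bsub>Q\<^esub>))"
      have h: "h \<in> carrier rep.V"
        unfolding h_def P_def
        by (rule hom_moduleI) (simp_all add: prod_module_simps \<pi>_rules Q.smult_l_distr Q.smult_assoc1
            A1.module_axioms)
      have "?G h \<one>\<^bsub>A1\<^esub> = (\<zero>\<^bsub>Q\<^esub>, free_eval K Q \<mu> f)"
        using main[OF f h, of "\<one>\<^bsub>A1\<^esub>"] alg_homD(2)[OF ev_\<mu>_hom f(1)] by (simp add: h_def \<pi>_one)
      then show ?thesis
        using that h by (simp add: E_apply)
    qed
    ultimately show ?thesis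
      using \<Theta>_closed[OF f(1)] by (auto simp: \<rho>_\<Theta>[OF E f(1)])
  qed
  moreover have "ideal ?J F"
    by (rule kernel_ideal[OF F.assoc_algebra_axioms E(1) \<rho>_hom[OF E]])
  ultimately show ?thesis
    using \<rho>_kernel_relations[OF E] by (intro exI[of _ ?J]) blast
qed

text \<open>\<open>J1\<close> decides the constant term. Once that vanishes, \<open>J2\<close>
  contains \<open>\<Theta> f\<close> anyway and \<open>J3\<close> decides the value in
  \<open>Q\<close>. Injectivity on the two algebras is inherited from \<open>J1\<close> and
  \<open>J2\<close>, since a smaller ideal identifies fewer letters.\<close>

lemma separating_ideal:
  assumes "assoc_algebra K Q" "\<mu> \<in> mod_hom K M1 Q"
  obtains J where "ideal J F" "rels \<subseteq> J"
    and "\<And>f. f \<in> carrier FM \<Longrightarrow> \<Theta> f \<in> J \<longleftrightarrow> f [] = \<zero> \<and> free_eval K Q \<mu> f = \<zero>\<^bsub>Q\<^esub>"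
    and "\<And>a b. a \<in> carrier A1 \<Longrightarrow> b \<in> carrier A1 \<Longrightarrow>
      W [Inl a] \<ominus>\<^bsub>F\<^esub> W [Inl b] \<in> J \<Longrightarrow> a = b"
    and "\<And>a b. a \<in> carrier A2 \<Longrightarrow> b \<in> carrier A2 \<Longrightarrow>
      W [Inr a] \<ominus>\<^bsub>F\<^esub> W [Inr b] \<in> J \<Longrightarrow> a = b"
proof -
  obtain J1 where J1: "ideal J1 F" "rels \<subseteq> J1" "\<forall>f\<in>carrier FM. \<Theta> f \<in> J1 \<longleftrightarrow> f [] = \<zero>"
    "\<forall>a\<in>carrier A1. \<forall>b\<in>carrier A1. W [Inl a] \<ominus>\<^bsub>F\<^esub> W [Inl b] \<in> J1 \<longrightarrow> a = b"
    using separate_A1 by blast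
  obtain J2 where J2: "ideal J2 F" "rels \<subseteq> J2" "\<forall>f\<in>carrier FM. f [] = \<zero> \<longrightarrow> \<Theta> f \<in> J2"
    "\<forall>a\<in>carrier A2. \<forall>b\<in>carrier A2. W [Inr a] \<ominus>\<^bsub>F\<^esub> W [Inr b] \<in> J2 \<longrightarrow> a = b"
    using separate_A2 by blast
  obtain J3 where J3: "ideal J3 F" "rels \<subseteq> J3"
    "\<forall>f\<in>carrier FM. f [] = \<zero> \<longrightarrow> (\<Theta> f \<in> J3 \<longleftrightarrow> free_eval K Q \<mu> f = \<zero>\<^bsub>Q\<^esub>)"
    using separate_tensor[OF assms] by blast
  show thesis
  proof (rule that[of "J1 \<inter> J2 \<inter> J3"])
    show "ideal (J1 \<inter> J2 \<inter> J3) F"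
      by (intro F.M.i_intersect J1 J2 J3)
    show "rels \<subseteq> J1 \<inter> J2 \<inter> J3"
      by (intro Int_greatest J1(2) J2(2) J3(2))
    show "\<Theta> f \<in> J1 \<inter> J2 \<inter> J3 \<longleftrightarrow> f [] = \<zero> \<and> free_eval K Q \<mu> f = \<zero>\<^bsub>Q\<^esub>"
      if "f \<in> carrier FM" for f
      using J1(3)[rule_format, OF that] J2(3)[rule_format, OF that] J3(3)[rule_format, OF that]
      by (metis IntD1 IntD2 IntI)
    show "a = b" if "a \<in> carrier A1" "b \<in> carrier A1"
      "W [Inl a] \<ominus>\<^bsub>F\<^esub> W [Inl b] \<in> J1 \<inter> J2 \<inter> J3" for a b
      using J1(4)[rule_format, OF that(1,2)] that(3) by simp
    show "a = b" if "a \<in> carrier A2" "b \<in> carrier A2"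
      "W [Inr a] \<ominus>\<^bsub>F\<^esub> W [Inr b] \<in> J1 \<inter> J2 \<inter> J3" for a b
      using J2(4)[rule_format, OF that(1,2)] that(3) by simp
  qed
qed

end

section \<open>Images of submodules and maps with equal kernels\<close>

lemma submodule_image:
  assumes "module K M" "module K N" "h \<in> mod_hom K M N" "submodule H K M"
  shows "submodule (h ` H) K N"
proof -
  interpret M: module K M by fact
  interpret N: module K N by fact
  note H = M.submoduleE[OF assms(4)]
  note hom = mod_homD[OF assms(3)]
  have HM: "a \<in> carrier M" if "a \<in> H" for a
    using that H(1) by auto
  show ?thesis
  proof (rule N.submoduleI)
    show "h ` H \<subseteq> carrier N"
      using HM hom(1) by auto
    show "\<zero>\<^bsub>N\<^esub> \<in> h ` H"
      using submodule_zero[OF assms(4)] mod_hom_zero[OF assms(1-3)] by (metis imageI)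
    show "\<ominus>\<^bsub>N\<^esub> b \<in> h ` H" if "b \<in> h ` H" for b
      using that H(3) mod_hom_a_inv[OF assms(1-3), symmetric] HM by fastforce
    show "a \<oplus>\<^bsub>N\<^esub> b \<in> h ` H" if ab: "a \<in> h ` H" "b \<in> h ` H" for a b
    proof -
      obtain a' b' where "a' \<in> H" "a = h a'" "b' \<in> H" "b = h b'"
        using ab by blast
      then have "a \<oplus>\<^bsub>N\<^esub> b = h (a' \<oplus>\<^bsub>M\<^esub> b')" "a' \<oplus>\<^bsub>M\<^esub> b' \<in> H"
        using HM H(5) hom(2) by simp_all
      then show ?thesis
        by blast
    qed
    show "c \<odot>\<^bsub>N\<^esub> b \<in> h ` H" if cb: "c \<in> carrier K" "b \<in> h ` H" for c b
    proof -
      obtain b' where "b' \<in> H" "b = h b'"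
        using cb by blast
      then have "c \<odot>\<^bsub>N\<^esub> b = h (c \<odot>\<^bsub>M\<^esub> b')" "c \<odot>\<^bsub>M\<^esub> b' \<in> H"
        using HM H(4) hom(3) cb by simp_all
      then show ?thesis
        by blast
    qed
  qed
qed

lemma (in abelian_group) minus_eq_zero_iff:
  assumes "u \<in> carrier G" "v \<in> carrier G"
  shows "u \<ominus> v = \<zero> \<longleftrightarrow> u = v"
proof -
  have "u = u \<ominus> v \<oplus> v"
    using assms by (simp add: minus_eq a_assoc l_neg)
  then show ?thesis
    using assms by (auto simp: minus_eq r_neg)
qed

text \<open>Since \<open>p\<close> and \<open>h\<close> have the same kernel, \<open>M\<close> and
  the image of \<open>h\<close> are the same quotient of \<open>L\<close>. All three comparisons are
  made in this way: of \<open>xMx\<close> with \<open>M1\<close>, of \<open>A\<close> with the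
  tensor algebra, and of \<open>A0\<close> with its copy in \<open>R\<close>.\<close>

lemma factor_mod_hom:
  assumes "module K L" "module K M" "module K N"
    and p: "p \<in> mod_hom K L M" "p ` carrier L = carrier M" and h: "h \<in> mod_hom K L N"
    and ker: "\<And>f. f \<in> carrier L \<Longrightarrow> p f = \<zero>\<^bsub>M\<^esub> \<longleftrightarrow> h f = \<zero>\<^bsub>N\<^esub>"
  obtains j where "j \<in> mod_hom K M N" "inj_on j (carrier M)"
    "\<And>f. f \<in> carrier L \<Longrightarrow> j (p f) = h f"
proof -
  interpret L: module K L by fact
  interpret M: module K M by fact
  interpret N: module K N by fact
  have eq: "p f = p g \<longleftrightarrow> h f = h g" if fg: "f \<in> carrier L" "g \<in> carrier L" for f g
  proof -
    have "p f = p g \<longleftrightarrow> p (f \<ominus>\<^bsub>L\<^esub> g) = \<zero>\<^bsub>M\<^esub>"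
      using fg mod_homD(1)[OF p(1)] M.M.minus_eq_zero_iff
      by (simp add: mod_hom_minus[OF assms(1,2) p(1)])
    also have "\<dots> \<longleftrightarrow> h (f \<ominus>\<^bsub>L\<^esub> g) = \<zero>\<^bsub>N\<^esub>"
      using fg by (intro ker) simp
    also have "\<dots> \<longleftrightarrow> h f = h g"
      using fg mod_homD(1)[OF h] N.M.minus_eq_zero_iff
      by (simp add: mod_hom_minus[OF assms(1,3) h])
    finally show ?thesis .
  qed
  define j where "j = (\<lambda>m. h (inv_into (carrier L) p m))"
  have j: "j (p f) = h f" if f: "f \<in> carrier L" for f
  proof -
    have "p f \<in> p ` carrier L"
      using f by simp
    then have "inv_into (carrier L) p (p f) \<in> carrier L" "p (inv_into (carrier L) p (p f)) = p f"
      by (rule inv_into_into, rule f_inv_into_f)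
    then show ?thesis
      using eq f by (simp add: j_def)
  qed
  have cases: "\<exists>f\<in>carrier L. m = p f" if "m \<in> carrier M" for m
    using that p(2) by blast
  have "j \<in> mod_hom K M N"
  proof (rule mod_homI)
    fix m assume "m \<in> carrier M"
    then obtain f where f: "f \<in> carrier L" "m = p f"
      using cases by blast
    then show "j m \<in> carrier N"
      using mod_homD(1)[OF h] by (simp add: j)
    fix c assume "c \<in> carrier K"
    then show "j (c \<odot>\<^bsub>M\<^esub> m) = c \<odot>\<^bsub>N\<^esub> j m"
      using f mod_homD(3)[OF h] by (simp add: j flip: mod_homD(3)[OF p(1)])
  next
    fix m n assume "m \<in> carrier M" "n \<in> carrier M"
    then obtain f g where f: "f \<in> carrier L" "m = p f" "g \<in> carrier L" "n = p g"
      using cases by blast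
    then show "j (m \<oplus>\<^bsub>M\<^esub> n) = j m \<oplus>\<^bsub>N\<^esub> j n"
      using mod_homD(2)[OF h] by (simp add: j flip: mod_homD(2)[OF p(1)])
  qed
  moreover have "inj_on j (carrier M)"
  proof (rule inj_onI)
    fix m n assume "m \<in> carrier M" "n \<in> carrier M" "j m = j n"
    then show "m = n"
      using cases eq j by metis
  qed
  ultimately show thesis
    using that j by blast
qed

lemma free_mult_Nil:
  assumes "cring K" "f \<in> carrier (free_algebra K S)" "g \<in> carrier (free_algebra K S)"
  shows "(f \<otimes>\<^bsub>free_algebra K S\<^esub> g) [] = f [] \<otimes>\<^bsub>K\<^esub> g []"
proof -
  interpret K: cring K by fact
  show ?thesis
    using assms by (simp add: free_simps free_carrier)
qed

lemma unital_subalgebra_carrier: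
  assumes "assoc_algebra K A"
  shows "unital_subalgebra (carrier A) K A"
proof -
  interpret A: assoc_algebra K A by fact
  show ?thesis
    using A.carrier_is_submodule by (simp add: unital_subalgebra_def nonunital_subalgebra_def)
qed

lemma unital_subalgebra_image:
  assumes "assoc_algebra K A" "assoc_algebra K B" "h \<in> alg_hom K A B"
  shows "unital_subalgebra (h ` carrier A) K B"
proof -
  interpret A: assoc_algebra K A by fact
  interpret B: assoc_algebra K B by fact
  have "submodule (h ` carrier A) K B"
    by (rule submodule_image[OF A.module_axioms B.module_axioms alg_homD(1)[OF assms(3)]
        A.carrier_is_submodule])
  moreover have "\<one>\<^bsub>B\<^esub> \<in> h ` carrier A"
    using alg_homD(6)[OF assms(3)] by (metis A.M.one_closed imageI)
  ultimately show ?thesis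
    by (auto simp: unital_subalgebra_def nonunital_subalgebra_def simp flip: alg_homD(5)[OF assms(3)])
qed

section \<open>Quotients of \<open>F\<close> by ideals above the relations\<close>

context split_pair
begin

lemma letter_closed:
  "a \<in> carrier A1 \<Longrightarrow> W [Inl a] \<in> carrier F"
  "b \<in> carrier A2 \<Longrightarrow> W [Inr b] \<in> carrier F"
  by (auto intro!: free_word_closed K InlI InrI)

context
  fixes J assumes J: "ideal J F" "rels \<subseteq> J"
begin

interpretation J: ideal J F by (rule J)

abbreviation "FJ \<equiv> quot_module F J"

definition inl where "inl a = J +>\<^bsub>F\<^esub> W [Inl a]"
definition inr where "inr a = J +>\<^bsub>F\<^esub> W [Inr a]"

lemmas FJ_algebra = quot_assoc_algebra[OF F.assoc_algebra_axioms J(1)]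
lemmas FJ_hom = coset_alg_hom[OF F.assoc_algebra_axioms J(1)]
lemmas FJ_eq_iff = coset_eq_iff[OF F.module_axioms ideal_imp_submodule[OF F.assoc_algebra_axioms J(1)]]
lemmas FJ_zero_iff = coset_zero_iff[OF F.module_axioms ideal_imp_submodule[OF F.assoc_algebra_axioms J(1)]]
lemmas FJ_rules = alg_homD[OF FJ_hom]

lemma relations_imp_hom:
  assumes A: "assoc_algebra K A" and i: "\<And>a. a \<in> carrier A \<Longrightarrow> W [i a] \<in> carrier F"
    and rel: "hom_relations K F A i \<subseteq> J"
  shows "(\<lambda>a. J +>\<^bsub>F\<^esub> W [i a]) \<in> alg_hom K A FJ"
proof -
  interpret A: assoc_algebra K A by fact
  have rel: "a \<in> carrier A \<Longrightarrow> b \<in> carrier A \<Longrightarrow>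
      W [i (a \<oplus>\<^bsub>A\<^esub> b)] \<ominus>\<^bsub>F\<^esub> (W [i a] \<oplus>\<^bsub>F\<^esub> W [i b]) \<in> J"
    "a \<in> carrier A \<Longrightarrow> b \<in> carrier A \<Longrightarrow>
      W [i (a \<otimes>\<^bsub>A\<^esub> b)] \<ominus>\<^bsub>F\<^esub> (W [i a] \<otimes>\<^bsub>F\<^esub> W [i b]) \<in> J"
    "c \<in> carrier K \<Longrightarrow> a \<in> carrier A \<Longrightarrow>
      W [i (c \<odot>\<^bsub>A\<^esub> a)] \<ominus>\<^bsub>F\<^esub> (c \<odot>\<^bsub>F\<^esub> W [i a]) \<in> J"
    "W [i \<one>\<^bsub>A\<^esub>] \<ominus>\<^bsub>F\<^esub> \<one>\<^bsub>F\<^esub> \<in> J" for a b c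
    by (rule subsetD[OF rel], unfold hom_relations_def Let_def, blast)+
  have "J +>\<^bsub>F\<^esub> W [i (a \<oplus>\<^bsub>A\<^esub> b)] = J +>\<^bsub>F\<^esub> (W [i a] \<oplus>\<^bsub>F\<^esub> W [i b])"
    "J +>\<^bsub>F\<^esub> W [i (a \<otimes>\<^bsub>A\<^esub> b)] = J +>\<^bsub>F\<^esub> (W [i a] \<otimes>\<^bsub>F\<^esub> W [i b])"
    if "a \<in> carrier A" "b \<in> carrier A" for a b
    using rel(1,2)[OF that] that by (simp_all add: FJ_eq_iff i)
  moreover have "J +>\<^bsub>F\<^esub> W [i (c \<odot>\<^bsub>A\<^esub> a)] = J +>\<^bsub>F\<^esub> (c \<odot>\<^bsub>F\<^esub> W [i a])"
    if "c \<in> carrier K" "a \<in> carrier A" for c a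
    using rel(3)[OF that] that by (simp_all add: FJ_eq_iff i)
  moreover have "J +>\<^bsub>F\<^esub> W [i \<one>\<^bsub>A\<^esub>] = J +>\<^bsub>F\<^esub> \<one>\<^bsub>F\<^esub>"
    using rel(4) by (simp_all add: FJ_eq_iff i)
  ultimately show ?thesis
    by (intro alg_homI mod_homI) (simp_all add: i FJ_rules)
qed

lemma inl_hom: "inl \<in> alg_hom K A1 FJ"
  unfolding inl_def[abs_def] using J(2) by (intro relations_imp_hom A1 letter_closed) auto

lemma inr_hom: "inr \<in> alg_hom K A2 FJ"
  unfolding inr_def[abs_def] using J(2) by (intro relations_imp_hom A2 letter_closed) auto

text \<open>The cosets of letters are the images of \<open>A1\<close> and \<open>A2\<close>;
  products of them give the words, and linear combinations give everything.\<close>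

lemma FJ_generated: "unital_subalgebra_generated K FJ (inl ` carrier A1 \<union> inr ` carrier A2) = carrier FJ"
proof
  show "unital_subalgebra_generated K FJ (inl ` carrier A1 \<union> inr ` carrier A2) \<subseteq> carrier FJ"
    unfolding unital_subalgebra_generated_def
    using unital_subalgebra_carrier[OF FJ_algebra] alg_homD(2)[OF inl_hom] alg_homD(2)[OF inr_hom]
    by (intro Inter_lower) auto
  show "carrier FJ \<subseteq> unital_subalgebra_generated K FJ (inl ` carrier A1 \<union> inr ` carrier A2)"
    unfolding unital_subalgebra_generated_def
  proof (intro Inter_greatest)
    fix H assume "H \<in> {H. unital_subalgebra H K FJ \<and> inl ` carrier A1 \<union> inr ` carrier A2 \<subseteq> H}"
    then have H: "submodule H K FJ" "\<And>u v. u \<in> H \<Longrightarrow> v \<in> H \<Longrightarrow> u \<otimes>\<^bsub>FJ\<^esub> v \<in> H" "\<one>\<^bsub>FJ\<^esub> \<in> H"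
      "inl ` carrier A1 \<union> inr ` carrier A2 \<subseteq> H"
      by (auto simp: unital_subalgebra_def nonunital_subalgebra_def)
    note H' = module.submoduleE[OF assoc_algebra_module[OF FJ_algebra] H(1)]
    have letter: "J +>\<^bsub>F\<^esub> W [s] \<in> H" "W [s] \<in> carrier F"
      if "s \<in> carrier A1 <+> carrier A2" for s
      using that H(4) letter_closed by (auto simp: inl_def inr_def)
    have word: "J +>\<^bsub>F\<^esub> W w \<in> H" if "w \<in> lists (carrier A1 <+> carrier A2)" for w
      using that
    proof (induction w)
      case Nil
      then show ?case
        using H(3) FJ_rules(6) by (simp add: free_simps(2))
    next
      case (Cons s w)
      have "W (s # w) = W [s] \<otimes>\<^bsub>F\<^esub> W w"
        by (simp add: free_mult_word[OF K])
      then show ?case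
        using Cons H(2) letter[of s] by (simp add: FJ_rules free_word_closed[OF K])
    qed
    have "J +>\<^bsub>F\<^esub> f \<in> H" if "f \<in> carrier F" for f
      using that UNIV_I
      by (rule free_induct[OF K])
        (use word H' submodule_zero[OF H(1)] mod_hom_zero[OF F.module_axioms
            assoc_algebra_module[OF FJ_algebra] FJ_rules(1)] in \<open>simp_all add: FJ_rules(3,4)\<close>)
    then show "carrier FJ \<subseteq> H"
      by (auto simp: quot_carrier)
  qed
qed

end

section \<open>The subalgebra generated by xMx\<close>

abbreviation C where "C \<equiv> coprod_ideal K A1 A2"
abbreviation B where "B \<equiv> coprod_algebra K A1 A2"

lemma rels_closed: "rels \<subseteq> carrier F"
proof -
  \<comment> \<open>Any ideal above the relations bounds them by the carrier, so an ideal already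
    constructed saves inspecting the relations one by one.\<close>
  obtain J where J: "ideal J F" "rels \<subseteq> J"
    using separate_A1 by blast
  have "J \<subseteq> carrier F"
    by (rule additive_subgroup.a_subset[OF ideal.axioms(1)[OF J(1)]])
  with J(2) show ?thesis
    by (rule subset_trans)
qed

lemma C_ideal: "ideal C F"
  unfolding coprod_ideal_def Let_def by (rule F.M.genideal_ideal[OF rels_closed])

lemma rels_C: "rels \<subseteq> C"
  unfolding coprod_ideal_def Let_def by (rule F.M.genideal_self[OF rels_closed])

lemma C_minimal: "ideal J F \<Longrightarrow> rels \<subseteq> J \<Longrightarrow> C \<subseteq> J"
  unfolding coprod_ideal_def Let_def by (rule F.M.genideal_minimal)

lemma B_eq: "B = quot_module F C"
  by (simp add: coprod_algebra_def)

lemmas C = C_ideal rels_C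
lemmas B_algebra = FJ_algebra[OF C, folded B_eq]
lemmas B_hom = FJ_hom[OF C, folded B_eq]
lemmas B_rules = alg_homD[OF B_hom]
lemmas B_zero_iff = FJ_zero_iff[OF C, folded B_eq]

sublocale B: assoc_algebra K B by (rule B_algebra)

definition \<theta> where "\<theta> f = C +>\<^bsub>F\<^esub> \<Theta> f"

lemma \<theta>_hom: "\<theta> \<in> alg_hom K FM B"
  using alg_hom_comp[OF \<Theta>_hom B_hom] by (simp add: \<theta>_def[abs_def] o_def)

lemmas \<theta>_rules = alg_homD[OF \<theta>_hom]

definition \<tau> where "\<tau> m = coprod_inr K A1 A2 x \<otimes>\<^bsub>B\<^esub> coprod_inl K A1 A2 m \<otimes>\<^bsub>B\<^esub> coprod_inr K A1 A2 x"

lemma coprod_inl_hom: "coprod_inl K A1 A2 \<in> alg_hom K A1 B"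
  using inl_hom[OF C] unfolding inl_def[OF C, abs_def] by (simp add: coprod_inl_def[abs_def] B_eq)

lemma coprod_inr_hom: "coprod_inr K A1 A2 \<in> alg_hom K A2 B"
  using inr_hom[OF C] unfolding inr_def[OF C, abs_def] by (simp add: coprod_inr_def[abs_def] B_eq)

lemma M1_A1: "m \<in> carrier M1 \<Longrightarrow> m \<in> carrier A1"
  by (simp add: M1_carrier)

lemma \<tau>_hom: "\<tau> \<in> mod_hom K M1 B"
  using alg_homD[OF coprod_inl_hom] alg_homD(2)[OF coprod_inr_hom x]
  by (intro mod_homI)
    (simp_all add: \<tau>_def M1_A1 B.M.l_distr B.M.r_distr B.smult_mult_left B.smult_mult_right)

lemma \<tau>_eq: "m \<in> carrier M1 \<Longrightarrow> \<tau> m = \<theta> (W [m])"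
proof -
  assume m: "m \<in> carrier M1"
  have "\<theta> (W [m]) =
      C +>\<^bsub>F\<^esub> (W [Inr x] \<otimes>\<^bsub>F\<^esub> W [Inl m] \<otimes>\<^bsub>F\<^esub> W [Inr x])"
    by (simp add: \<theta>_def \<Theta>_letter[OF m] free_mult_word[OF K])
  also have "\<dots> = \<tau> m"
    using letter_closed(1)[OF M1_A1[OF m]] letter_closed(2)[OF x]
    by (simp add: B_rules \<tau>_def coprod_inl_def coprod_inr_def)
  finally show ?thesis
    by simp
qed

lemma letter_FM: "m \<in> carrier M1 \<Longrightarrow> W [m] \<in> carrier FM"
  by (intro free_word_closed K) simp

abbreviation xMx where "xMx \<equiv> \<tau> ` carrier M1"
abbreviation A where "A \<equiv> nonunital_subalgebra_generated K B xMx"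

lemma xMx_submodule: "submodule xMx K B"
  by (rule submodule_image[OF M1_module B.module_axioms \<tau>_hom module.carrier_is_submodule[OF M1_module]])

text \<open>By minimality of \<open>C\<close>. An element is shown to be nonzero in \<open>B\<close>
  by exhibiting an ideal \<open>J\<close> above the relations that avoids it.\<close>

lemma \<theta>_kernel_le:
  assumes "ideal J F" "rels \<subseteq> J" "f \<in> carrier FM" "\<theta> f = \<zero>\<^bsub>B\<^esub>"
  shows "\<Theta> f \<in> J"
  using assms C_minimal[OF assms(1,2)] B_zero_iff[OF \<Theta>_closed[OF assms(3)]] by (auto simp: \<theta>_def)

text \<open>For \<open>Q = A1\<close> and the inclusion of \<open>M1\<close>, the letter
  \<open>m\<close> evaluates to \<open>m\<close> itself.\<close>

lemma \<tau>_eq_zero: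
  assumes m: "m \<in> carrier M1" and z: "\<tau> m = \<zero>\<^bsub>B\<^esub>"
  shows "m = \<zero>\<^bsub>A1\<^esub>"
proof -
  have id: "(\<lambda>m. m) \<in> mod_hom K M1 A1"
    by (intro mod_homI) (simp_all add: M1_A1)
  obtain J where J: "ideal J F" "rels \<subseteq> J"
    "\<And>f. f \<in> carrier FM \<Longrightarrow> \<Theta> f \<in> J \<longleftrightarrow> f [] = \<zero> \<and> free_eval K A1 (\<lambda>m. m) f = \<zero>\<^bsub>A1\<^esub>"
    using separating_ideal[OF A1 id] by metis
  have "\<Theta> (W [m]) \<in> J"
    using \<theta>_kernel_le[OF J(1,2) letter_FM[OF m]] z by (simp add: \<tau>_eq[OF m])
  then have "free_eval K A1 (\<lambda>m. m) (W [m]) = \<zero>\<^bsub>A1\<^esub>"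
    using J(3)[OF letter_FM[OF m]] by simp
  then show ?thesis
    using free_eval_letter[where S = "carrier M1" and \<phi> = "\<lambda>m. m", OF K A1 M1_A1 m] by simp
qed

lemma xMx_isomorphic: "mod_isomorphic K (B\<lparr>carrier := xMx\<rparr>) M1"
proof -
  interpret X: module K "B\<lparr>carrier := xMx\<rparr>"
    by (rule submodule.submodule_is_module[OF xMx_submodule B.module_axioms])
  have p: "\<tau> \<in> mod_hom K M1 (B\<lparr>carrier := xMx\<rparr>)"
    using mod_homD[OF \<tau>_hom] by (intro mod_homI) simp_all
  have id: "(\<lambda>m. m) \<in> mod_hom K M1 M1"
    by (intro mod_homI) simp_all
  obtain j where j: "j \<in> mod_hom K (B\<lparr>carrier := xMx\<rparr>) M1" "inj_on j xMx"
    "\<And>m. m \<in> carrier M1 \<Longrightarrow> j (\<tau> m) = m"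
  proof (rule factor_mod_hom[OF M1_module X.module_axioms M1_module p _ id])
    show "\<tau> m = \<zero>\<^bsub>B\<lparr>carrier := xMx\<rparr>\<^esub> \<longleftrightarrow> m = \<zero>\<^bsub>M1\<^esub>" if "m \<in> carrier M1" for m
      using \<tau>_eq_zero[OF that] mod_hom_zero[OF M1_module B.module_axioms \<tau>_hom] by auto
  qed (auto simp: that)
  have "j ` xMx = carrier M1"
    using j(3) by force
  then show ?thesis
    using j(1,2) by (auto simp: mod_isomorphic_def bij_betw_def)
qed

section \<open>Elements without constant term and their ideals\<close>

lemma FM_coeff: "f \<in> carrier FM \<Longrightarrow> f w \<in> carrier K"
  by (simp add: free_carrier)

abbreviation FMp where "FMp \<equiv> {f \<in> carrier FM. f [] = \<zero>}"

lemma FMp_submodule: "submodule FMp K FM"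
proof -
  note base = assoc_algebra_module[OF assoc_algebra_base[OF K]]
  have "(\<lambda>f. f []) \<in> mod_hom K FM (base_algebra K)"
    by (rule mod_homI) (simp_all add: FM_coeff free_simps)
  from submodule_vimage[OF FM.module_axioms base this FM.carrier_is_submodule zero_submodule[OF base]]
  show ?thesis
    by simp
qed

text \<open>Elements without constant term are combinations of nonempty words, and the image of a
  nonempty word is a product of elements of \<open>xMx\<close>. From here on \<open>A\<close> is
  handled through preimages in \<open>FMp\<close>.\<close>

lemma A_eq: "A = \<theta> ` FMp"
proof
  have "submodule (\<theta> ` FMp) K B"
    by (rule submodule_image[OF FM.module_axioms B.module_axioms \<theta>_rules(1) FMp_submodule])
  moreover have "u \<otimes>\<^bsub>B\<^esub> v \<in> \<theta> ` FMp" if uv: "u \<in> \<theta> ` FMp" "v \<in> \<theta> ` FMp" for u v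
  proof -
    obtain f g where fg: "f \<in> FMp" "u = \<theta> f" "g \<in> FMp" "v = \<theta> g"
      using uv by blast
    then have "f \<in> carrier FM" "g \<in> carrier FM" "f [] = \<zero>" "g [] = \<zero>"
      by auto
    then have "f \<otimes>\<^bsub>FM\<^esub> g \<in> FMp"
      using free_mult_Nil[OF K, of f "carrier M1" g] by simp
    moreover have "u \<otimes>\<^bsub>B\<^esub> v = \<theta> (f \<otimes>\<^bsub>FM\<^esub> g)"
      unfolding fg(2,4) using \<theta>_rules(5) \<open>f \<in> carrier FM\<close> \<open>g \<in> carrier FM\<close> by simp
    ultimately show ?thesis
      by (simp only: image_eqI)
  qed
  moreover have "xMx \<subseteq> \<theta> ` FMp"
  proof (rule image_subsetI)
    fix m assume "m \<in> carrier M1"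
    then have "W [m] \<in> FMp" "\<tau> m = \<theta> (W [m])"
      by (simp_all add: \<tau>_eq letter_FM) (simp add: word_elem_def)
    then show "\<tau> m \<in> \<theta> ` FMp"
      by simp
  qed
  ultimately show "A \<subseteq> \<theta> ` FMp"
    unfolding nonunital_subalgebra_generated_def nonunital_subalgebra_def by (intro Inter_lower) simp
  show "\<theta> ` FMp \<subseteq> A"
    unfolding nonunital_subalgebra_generated_def
  proof (intro Inter_greatest)
    fix H assume "H \<in> {H. nonunital_subalgebra H K B \<and> xMx \<subseteq> H}"
    then have H: "submodule H K B" "\<And>u v. u \<in> H \<Longrightarrow> v \<in> H \<Longrightarrow> u \<otimes>\<^bsub>B\<^esub> v \<in> H" "xMx \<subseteq> H"
      by (auto simp: nonunital_subalgebra_def)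
    note H' = B.submoduleE[OF H(1)]
    have letter: "\<theta> (W [m]) \<in> H" if "m \<in> carrier M1" for m
      using that H(3) by (auto simp flip: \<tau>_eq)
    have word: "\<theta> (W w) \<in> H" if "w \<in> lists (carrier M1)" "w \<noteq> []" for w
      using that
    proof (induction w)
      case (Cons m w)
      show ?case
      proof (cases "w = []")
        case False
        have "W (m # w) = W [m] \<otimes>\<^bsub>FM\<^esub> W w"
          by (simp add: free_mult_word[OF K])
        then show ?thesis
          using Cons False H(2) letter[of m] letter_FM by (simp add: \<theta>_rules free_word_closed[OF K])
      qed (use Cons letter in simp)
    qed simp
    have "\<theta> f \<in> H" if f: "f \<in> FMp" for f
    proof (rule free_induct[OF K, where X = "{w. w \<noteq> []}"])
      show "f \<in> carrier FM" "\<And>w. f w \<noteq> \<zero> \<Longrightarrow> w \<in> {w. w \<noteq> []}"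
        using f by auto
    qed (use word H' submodule_zero[OF H(1)] mod_hom_zero[OF FM.module_axioms B.module_axioms \<theta>_rules(1)]
        in \<open>simp_all add: \<theta>_rules(3,4)\<close>)
    then show "\<theta> ` FMp \<subseteq> H"
      by blast
  qed
qed

lemma \<theta>_zero: "\<theta> \<zero>\<^bsub>FM\<^esub> = \<zero>\<^bsub>B\<^esub>"
  by (rule mod_hom_zero[OF FM.module_axioms B.module_axioms \<theta>_rules(1)])

lemma FM_split:
  assumes "f \<in> carrier FM"
  obtains g where "g \<in> FMp" "f = f [] \<odot>\<^bsub>FM\<^esub> \<one>\<^bsub>FM\<^esub> \<oplus>\<^bsub>FM\<^esub> g"
proof -
  let ?c = "f [] \<odot>\<^bsub>FM\<^esub> \<one>\<^bsub>FM\<^esub>"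
  define g where "g = f \<oplus>\<^bsub>FM\<^esub> (\<ominus> \<one>) \<odot>\<^bsub>FM\<^esub> ?c"
  have c: "?c \<in> carrier FM"
    using FM_coeff[OF assms] by simp
  then have "g \<in> carrier FM"
    using assms by (simp add: g_def)
  moreover have "g [] = \<zero>"
    using FM_coeff[OF assms, of "[]"]
    by (simp add: g_def free_simps word_elem_def K.l_minus K.r_neg)
  moreover have "?c \<oplus>\<^bsub>FM\<^esub> g = f"
  proof
    fix w
    show "(?c \<oplus>\<^bsub>FM\<^esub> g) w = f w"
      using FM_coeff[OF assms]
      by (cases "w = []") (simp_all add: g_def free_simps word_elem_def K.l_minus K.r_neg)
  qed
  ultimately show thesis
    using that[of g] by simp
qed

text \<open>\<open>FM\<close> is the sum of \<open>K 1\<close> and \<open>FMp\<close>, and for the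
  scalar part closure under scalars suffices. Thus an ideal of the nonunital algebra
  \<open>FMp\<close> gives a unital quotient of \<open>FM\<close>, as the representation on
  \<open>Q\<close> requires.\<close>

lemma FMp_ideal_imp_ideal:
  assumes S: "submodule S K FM" "S \<subseteq> FMp"
    and mult: "\<And>f g. f \<in> S \<Longrightarrow> g \<in> FMp \<Longrightarrow> g \<otimes>\<^bsub>FM\<^esub> f \<in> S \<and> f \<otimes>\<^bsub>FM\<^esub> g \<in> S"
  shows "ideal S FM"
proof (rule idealI)
  note S_rules = FM.submoduleE[OF S(1)]
  show "ring FM"
    by (rule FM.M.ring_axioms)
  show "subgroup S (add_monoid FM)"
    by (rule submodule.axioms(1)[OF S(1)])
  fix f g assume f: "f \<in> S" and g: "g \<in> carrier FM"
  obtain g' where g': "g' \<in> FMp" "g = g [] \<odot>\<^bsub>FM\<^esub> \<one>\<^bsub>FM\<^esub> \<oplus>\<^bsub>FM\<^esub> g'"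
    using FM_split[OF g] .
  have fg: "f \<in> carrier FM" "g' \<in> carrier FM" "g [] \<in> carrier K"
    using f g'(1) FM_coeff[OF g] S(2) by auto
  have "g \<otimes>\<^bsub>FM\<^esub> f = g [] \<odot>\<^bsub>FM\<^esub> f \<oplus>\<^bsub>FM\<^esub> g' \<otimes>\<^bsub>FM\<^esub> f"
    by (subst g'(2)) (simp add: fg FM.M.l_distr FM.smult_mult_left)
  then show "g \<otimes>\<^bsub>FM\<^esub> f \<in> S"
    using S_rules(4)[OF fg(3) f] mult[OF f g'(1)] S_rules(5) by simp
  have "f \<otimes>\<^bsub>FM\<^esub> g = g [] \<odot>\<^bsub>FM\<^esub> f \<oplus>\<^bsub>FM\<^esub> f \<otimes>\<^bsub>FM\<^esub> g'"
    by (subst g'(2)) (simp add: fg FM.M.r_distr FM.smult_mult_right)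
  then show "f \<otimes>\<^bsub>FM\<^esub> g \<in> S"
    using S_rules(4)[OF fg(3) f] mult[OF f g'(1)] S_rules(5) by simp
qed

lemma M1_closed:
  "m \<in> carrier M1 \<Longrightarrow> n \<in> carrier M1 \<Longrightarrow> m \<oplus>\<^bsub>A1\<^esub> n \<in> carrier M1"
  "c \<in> carrier K \<Longrightarrow> m \<in> carrier M1 \<Longrightarrow> c \<odot>\<^bsub>A1\<^esub> m \<in> carrier M1"
  using A1.submoduleE(4,5)[OF M1_submodule] by simp_all

text \<open>Take \<open>Q\<close> to be \<open>FM\<close> modulo \<open>S\<close>. The two relations
  say exactly that \<open>m \<mapsto> [m]\<close> is linear into \<open>Q\<close>; evaluation is
  then the quotient map, whose kernel is \<open>S\<close>, and the condition on the constant term is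
  absorbed by \<open>S \<subseteq> FMp\<close>.\<close>

lemma separating_extension:
  assumes S: "ideal S FM" "S \<subseteq> FMp"
    and add: "\<And>m n. m \<in> carrier M1 \<Longrightarrow> n \<in> carrier M1 \<Longrightarrow>
      W [m \<oplus>\<^bsub>A1\<^esub> n] \<ominus>\<^bsub>FM\<^esub> (W [m] \<oplus>\<^bsub>FM\<^esub> W [n]) \<in> S"
    and smult: "\<And>c m. c \<in> carrier K \<Longrightarrow> m \<in> carrier M1 \<Longrightarrow>
      W [c \<odot>\<^bsub>A1\<^esub> m] \<ominus>\<^bsub>FM\<^esub> c \<odot>\<^bsub>FM\<^esub> W [m] \<in> S"
  obtains J where "ideal J F" "rels \<subseteq> J" "\<And>f. f \<in> carrier FM \<Longrightarrow> \<Theta> f \<in> J \<longleftrightarrow> f \<in> S"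
proof -
  let ?Q = "quot_module FM S"
  note Q = quot_assoc_algebra[OF FM.assoc_algebra_axioms S(1)]
  note Q_hom = coset_alg_hom[OF FM.assoc_algebra_axioms S(1)]
  note submod = ideal_imp_submodule[OF FM.assoc_algebra_axioms S(1)]
  note Q_eq_iff = coset_eq_iff[OF FM.module_axioms submod]
  define \<mu> where "\<mu> m = S +>\<^bsub>FM\<^esub> W [m]" for m
  have \<mu>: "\<mu> \<in> mod_hom K M1 ?Q"
    by (rule mod_homI)
      (simp_all add: \<mu>_def alg_homD(2)[OF Q_hom] letter_FM M1_closed Q_eq_iff add smult
        flip: alg_homD(3,4)[OF Q_hom])
  obtain J where J: "ideal J F" "rels \<subseteq> J"
    "\<And>f. f \<in> carrier FM \<Longrightarrow> \<Theta> f \<in> J \<longleftrightarrow> f [] = \<zero> \<and> free_eval K ?Q \<mu> f = \<zero>\<^bsub>?Q\<^esub>"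
    using separating_ideal[OF Q \<mu>] by metis
  have "\<Theta> f \<in> J \<longleftrightarrow> f \<in> S" if f: "f \<in> carrier FM" for f
  proof -
    have "S +>\<^bsub>FM\<^esub> f = free_eval K ?Q \<mu> f"
      by (rule free_eval_unique[OF K Q mod_homD(1)[OF \<mu>] Q_hom _ f]) (simp_all add: \<mu>_def)
    then show ?thesis
      using coset_zero_iff[OF FM.module_axioms submod f] J(3)[OF f] S(2) by auto
  qed
  with J(1,2) show thesis
    by (rule that)
qed

section \<open>The ideal extension property\<close>

lemma A_submodule: "submodule A K B"
  unfolding A_eq
  by (rule submodule_image[OF FM.module_axioms B.module_axioms \<theta>_rules(1) FMp_submodule])

lemma A_ideal_extension: "ideal_extension_property A K B"
  unfolding ideal_extension_property_def
proof (intro allI impI)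
  fix I assume "nonunital_ideal I K (B\<lparr>carrier := A\<rparr>)"
  then have I: "submodule I K (B\<lparr>carrier := A\<rparr>)"
    "\<And>a u. a \<in> A \<Longrightarrow> u \<in> I \<Longrightarrow> a \<otimes>\<^bsub>B\<^esub> u \<in> I" "\<And>a u. a \<in> A \<Longrightarrow> u \<in> I \<Longrightarrow> u \<otimes>\<^bsub>B\<^esub> a \<in> I"
    by (auto simp: nonunital_ideal_def)
  have I_A: "I \<subseteq> A"
    using subgroup.subset[OF submodule.axioms(1)[OF I(1)]] by simp
  have I_B: "submodule I K B"
    by (rule submodule_trans[OF B.module_axioms A_submodule I(1)])
  note I_rules = B.submoduleE[OF I_B]
  \<comment> \<open>This preimage contains the kernel of \<theta> on \<open>FMp\<close>, hence the
    degree-one linearity relations, because \<tau> is linear. So it qualifies as the ideal of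
    \<open>separating_extension\<close>.\<close>
  define I' where "I' = {f \<in> FMp. \<theta> f \<in> I}"
  have I'_submodule: "submodule I' K FM"
    unfolding I'_def
    by (rule submodule_vimage[OF FM.module_axioms B.module_axioms \<theta>_rules(1) FMp_submodule I_B])
  have I': "ideal I' FM"
  proof (rule FMp_ideal_imp_ideal[OF I'_submodule])
    fix f g assume "f \<in> I'" "g \<in> FMp"
    then have fg: "f \<in> carrier FM" "f [] = \<zero>" "\<theta> f \<in> I" "g \<in> carrier FM" "g [] = \<zero>" "\<theta> g \<in> A"
      unfolding I'_def A_eq by auto
    then have "\<theta> (g \<otimes>\<^bsub>FM\<^esub> f) \<in> I" "\<theta> (f \<otimes>\<^bsub>FM\<^esub> g) \<in> I"
      using I(2)[OF fg(6,3)] I(3)[OF fg(6,3)] by (simp_all add: \<theta>_rules(5))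
    then show "g \<otimes>\<^bsub>FM\<^esub> f \<in> I' \<and> f \<otimes>\<^bsub>FM\<^esub> g \<in> I'"
      using fg free_mult_Nil[OF K fg(4) fg(1)] free_mult_Nil[OF K fg(1) fg(4)]
      by (simp add: I'_def)
  qed (auto simp: I'_def)
  have in_I': "f \<ominus>\<^bsub>FM\<^esub> g \<in> I'"
    if fg: "f \<in> carrier FM" "g \<in> carrier FM" "f [] = \<zero>" "g [] = \<zero>" "\<theta> f = \<theta> g" for f g
  proof -
    have "f \<ominus>\<^bsub>FM\<^esub> g \<in> FMp"
      using fg by (intro submodule_minus[OF FM.module_axioms FMp_submodule]) simp_all
    moreover have "\<theta> (f \<ominus>\<^bsub>FM\<^esub> g) = \<zero>\<^bsub>B\<^esub>"
      using fg \<theta>_rules(2) by (simp add: mod_hom_minus[OF FM.module_axioms B.module_axioms \<theta>_rules(1)]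
          B.M.minus_eq_zero_iff)
    ultimately show ?thesis
      using submodule_zero[OF I_B] by (simp add: I'_def)
  qed
  have nil: "(W [m] :: 'a list \<Rightarrow> 'k) [] = \<zero>" for m
    by (simp add: word_elem_def)
  have letter_sum: "(W [m] \<oplus>\<^bsub>FM\<^esub> W [n]) [] = \<zero>" for m n
    by (simp add: free_simps nil)
  have letter_smult: "(c \<odot>\<^bsub>FM\<^esub> W [m]) [] = \<zero>" if "c \<in> carrier K" for c m
    using that by (simp add: free_simps nil)
  obtain J where J: "ideal J F" "rels \<subseteq> J" "\<And>f. f \<in> carrier FM \<Longrightarrow> \<Theta> f \<in> J \<longleftrightarrow> f \<in> I'"
  proof (rule separating_extension[OF I'])
    show "I' \<subseteq> FMp"
      by (auto simp: I'_def)
    show "W [m \<oplus>\<^bsub>A1\<^esub> n] \<ominus>\<^bsub>FM\<^esub> (W [m] \<oplus>\<^bsub>FM\<^esub> W [n]) \<in> I'"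
      if "m \<in> carrier M1" "n \<in> carrier M1" for m n
      using that mod_homD(2)[OF \<tau>_hom that]
      by (intro in_I') (simp_all add: letter_FM nil letter_sum \<theta>_rules \<tau>_eq M1_closed)
    show "W [c \<odot>\<^bsub>A1\<^esub> m] \<ominus>\<^bsub>FM\<^esub> c \<odot>\<^bsub>FM\<^esub> W [m] \<in> I'"
      if "c \<in> carrier K" "m \<in> carrier M1" for c m
      using that mod_homD(3)[OF \<tau>_hom that]
      by (intro in_I') (simp_all add: letter_FM nil letter_smult \<theta>_rules \<tau>_eq M1_closed)
  qed (rule that)
  have J_iff: "\<Theta> f \<in> J \<longleftrightarrow> \<theta> f \<in> I" if "f \<in> FMp" for f
    using that J(3)[of f] unfolding I'_def by simp
  have "ideal ((\<lambda>f. C +>\<^bsub>F\<^esub> f) ` J) B"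
    by (rule ideal_image[OF F.assoc_algebra_axioms B.assoc_algebra_axioms B_hom _ J(1)])
      (simp add: B_eq quot_carrier)
  moreover have "I = A \<inter> (\<lambda>f. C +>\<^bsub>F\<^esub> f) ` J"
  proof (intro equalityI subsetI)
    fix u assume u: "u \<in> I"
    then obtain f where f: "f \<in> FMp" "u = \<theta> f"
      using I_A unfolding A_eq by blast
    then have "\<Theta> f \<in> J"
      using J_iff u by blast
    then show "u \<in> A \<inter> (\<lambda>f. C +>\<^bsub>F\<^esub> f) ` J"
      using u I_A f(2) unfolding \<theta>_def by blast
  next
    fix u assume u: "u \<in> A \<inter> (\<lambda>f. C +>\<^bsub>F\<^esub> f) ` J"
    then obtain f where f: "f \<in> FMp" "u = \<theta> f"
      unfolding A_eq by blast
    obtain g where g: "g \<in> J" "u = C +>\<^bsub>F\<^esub> g"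
      using u by blast
    interpret J: ideal J F
      by (rule J)
    have "f \<in> carrier FM" "g \<in> carrier F"
      using g(1) f(1) J.a_Hcarr by auto
    moreover have "C +>\<^bsub>F\<^esub> \<Theta> f = C +>\<^bsub>F\<^esub> g"
      using f(2) g(2) by (simp only: \<theta>_def)
    ultimately have "\<Theta> f \<ominus>\<^bsub>F\<^esub> g \<in> C"
      by (simp only: FJ_eq_iff[OF C \<Theta>_closed])
    \<comment> \<open>The coset may have been produced by an element \<open>g\<close> of
      \<open>J\<close> other than \<open>\<Theta> f\<close>; as \<open>C \<subseteq> J\<close>, this
      does not affect membership in \<open>J\<close>.\<close>
    then have "\<Theta> f \<ominus>\<^bsub>F\<^esub> g \<oplus>\<^bsub>F\<^esub> g \<in> J"
      using C_minimal[OF J(1,2)] g(1) by auto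
    moreover have "\<Theta> f \<ominus>\<^bsub>F\<^esub> g \<oplus>\<^bsub>F\<^esub> g = \<Theta> f"
      using \<open>g \<in> carrier F\<close> \<Theta>_closed[OF \<open>f \<in> carrier FM\<close>]
      by (simp add: F.M.minus_eq F.M.a_assoc F.M.l_neg)
    ultimately show "u \<in> I"
      using J_iff[OF f(1)] f(2) by simp
  qed
  ultimately show "\<exists>J. ideal J B \<and> I = A \<inter> J"
    by blast
qed

section \<open>Embedding augmented algebras\<close>

text \<open>Subtracting scalars moves the generators into the kernel of \<epsilon> without changing
  the unital algebra that they generate. Then \<epsilon> of an evaluated element is its constant
  term, so the kernel of the evaluation lies in \<open>FMp\<close>, and the unital map from
  \<open>FM\<close> to the quotient by \<open>J\<close> has the same kernel.\<close>

lemma augmented_algebra_embeds: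
  fixes A0 :: "('k, 'c, 'q) module_scheme"
  assumes A0: "assoc_algebra K A0" and \<epsilon>: "\<epsilon> \<in> alg_hom K A0 (base_algebra K)"
    and f0: "f0 \<in> mod_hom K M1 A0"
    and gen: "unital_subalgebra_generated K A0 (f0 ` carrier M1) = carrier A0"
  shows "\<exists>(R :: ('k, (('a + 'b) list \<Rightarrow> 'k) set) module) j0 j1 j2.
    assoc_algebra K R \<and>
    j0 \<in> alg_hom K A0 R \<and> inj_on j0 (carrier A0) \<and>
    j1 \<in> alg_hom K A1 R \<and> inj_on j1 (carrier A1) \<and>
    j2 \<in> alg_hom K A2 R \<and> inj_on j2 (carrier A2) \<and>
    unital_subalgebra_generated K R (j1 ` carrier A1 \<union> j2 ` carrier A2) = carrier R"
proof -
  interpret A0: assoc_algebra K A0 by (rule A0)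
  note f0_rules = mod_homD[OF f0, simplified]
  note \<epsilon>_rules = alg_homD[OF \<epsilon>, simplified]
  define \<mu> where "\<mu> m = f0 m \<ominus>\<^bsub>A0\<^esub> \<epsilon> (f0 m) \<odot>\<^bsub>A0\<^esub> \<one>\<^bsub>A0\<^esub>" for m
  have \<mu>: "\<mu> \<in> mod_hom K M1 A0"
    by (rule mod_homI)
      (simp_all add: \<mu>_def f0_rules \<epsilon>_rules A0.smult_l_distr A0.smult_r_distr A0.smult_assoc1
        A0.M.minus_eq A0.M.minus_add A0.M.a_ac A0.smult_r_minus)
  note \<mu>_closed = mod_homD(1)[OF \<mu>]
  have \<epsilon>_\<mu>: "\<epsilon> (\<mu> m) = \<zero>" if "m \<in> carrier M1" for m
  proof -
    have "\<epsilon> (\<mu> m) = \<epsilon> (f0 m \<oplus>\<^bsub>A0\<^esub> (\<ominus> \<epsilon> (f0 m)) \<odot>\<^bsub>A0\<^esub> \<one>\<^bsub>A0\<^esub>)"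
      using that by (simp add: \<mu>_def A0.M.minus_eq f0_rules \<epsilon>_rules A0.smult_l_minus)
    also have "\<dots> = \<zero>"
      using that by (simp add: f0_rules \<epsilon>_rules K.r_neg)
    finally show ?thesis .
  qed
  let ?ev = "free_eval K A0 \<mu>"
  have ev: "?ev \<in> alg_hom K FM A0"
    by (rule free_eval_alg_hom[OF K A0 \<mu>_closed])
  have ev_letter: "?ev (W [m]) = \<mu> m" if "m \<in> carrier M1" for m
    by (rule free_eval_letter[OF K A0 \<mu>_closed that])
  \<comment> \<open>The composite vanishes on all letters, so it is the evaluation at zero, which
    reads off the constant term.\<close>
  have \<epsilon>_ev: "\<epsilon> (?ev f) = f []" if f: "f \<in> carrier FM" for f
  proof -
    note base = assoc_algebra_base[OF K]
    have "(\<epsilon> \<circ> ?ev) f = free_eval K (base_algebra K) (\<lambda>_. \<zero>) f"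
      by (rule free_eval_unique[OF K base _ alg_hom_comp[OF ev \<epsilon>] _ f]) (simp_all add: ev_letter \<epsilon>_\<mu>)
    also have "\<dots> = f []"
      using free_eval_null[OF K base _ f, of "\<lambda>_. \<zero>"] FM_coeff[OF f] by simp
    finally show ?thesis
      by simp
  qed
  have surj: "?ev ` carrier FM = carrier A0"
  proof
    show "?ev ` carrier FM \<subseteq> carrier A0"
      using alg_homD(2)[OF ev] by auto
    have "f0 m \<in> ?ev ` carrier FM" if m: "m \<in> carrier M1" for m
    proof -
      have "?ev (W [m] \<oplus>\<^bsub>FM\<^esub> \<epsilon> (f0 m) \<odot>\<^bsub>FM\<^esub> \<one>\<^bsub>FM\<^esub>) = \<mu> m \<oplus>\<^bsub>A0\<^esub> \<epsilon> (f0 m) \<odot>\<^bsub>A0\<^esub> \<one>\<^bsub>A0\<^esub>"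
        using m by (simp add: alg_homD[OF ev] letter_FM f0_rules \<epsilon>_rules ev_letter)
      also have "\<dots> = f0 m"
        using m by (simp add: \<mu>_def f0_rules \<epsilon>_rules A0.M.minus_eq A0.M.a_assoc A0.M.l_neg)
      finally show ?thesis
        using m letter_FM f0_rules(1) \<epsilon>_rules(2)
        by (metis FM.M.add.m_closed FM.M.one_closed FM.smult_closed imageI)
    qed
    then show "carrier A0 \<subseteq> ?ev ` carrier FM"
      unfolding gen[symmetric] unital_subalgebra_generated_def
      by (intro Inter_lower) (auto intro: unital_subalgebra_image[OF FM.assoc_algebra_axioms A0 ev])
  qed
  obtain J where J: "ideal J F" "rels \<subseteq> J"
    and J_\<Theta>: "\<And>f. f \<in> carrier FM \<Longrightarrow> \<Theta> f \<in> J \<longleftrightarrow> f [] = \<zero> \<and> ?ev f = \<zero>\<^bsub>A0\<^esub>"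
    and J_inl: "\<And>a b. a \<in> carrier A1 \<Longrightarrow> b \<in> carrier A1 \<Longrightarrow>
      W [Inl a] \<ominus>\<^bsub>F\<^esub> W [Inl b] \<in> J \<Longrightarrow> a = b"
    and J_inr: "\<And>a b. a \<in> carrier A2 \<Longrightarrow> b \<in> carrier A2 \<Longrightarrow>
      W [Inr a] \<ominus>\<^bsub>F\<^esub> W [Inr b] \<in> J \<Longrightarrow> a = b"
    using separating_ideal[OF A0 \<mu>] by blast
  let ?R = "quot_module F J"
  note R = FJ_algebra[OF J]
  interpret R: assoc_algebra K ?R by (rule R)
  let ?h = "(\<lambda>f. J +>\<^bsub>F\<^esub> f) \<circ> \<Theta>"
  have h: "?h \<in> alg_hom K FM ?R"
    by (rule alg_hom_comp[OF \<Theta>_hom FJ_hom[OF J]])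
  have ker: "?ev f = \<zero>\<^bsub>A0\<^esub> \<longleftrightarrow> ?h f = \<zero>\<^bsub>?R\<^esub>" if f: "f \<in> carrier FM" for f
  proof -
    have "f [] = \<zero>" if "?ev f = \<zero>\<^bsub>A0\<^esub>"
      using \<epsilon>_ev[OF f] that mod_hom_zero[OF A0.module_axioms assoc_algebra_module[OF assoc_algebra_base[OF K]] \<epsilon>_rules(1)]
      by simp
    then show ?thesis
      using J_\<Theta>[OF f] FJ_zero_iff[OF J \<Theta>_closed[OF f]] by auto
  qed
  obtain j0 where j0: "j0 \<in> mod_hom K A0 ?R" "inj_on j0 (carrier A0)"
    "\<And>f. f \<in> carrier FM \<Longrightarrow> j0 (?ev f) = ?h f"
    using factor_mod_hom[OF FM.module_axioms A0.module_axioms R.module_axioms alg_homD(1)[OF ev] surj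
        alg_homD(1)[OF h] ker] by blast
  have "j0 \<in> alg_hom K A0 ?R"
  proof (rule alg_homI[OF j0(1)])
    show "j0 \<one>\<^bsub>A0\<^esub> = \<one>\<^bsub>?R\<^esub>"
      using j0(3)[OF FM.M.one_closed] unfolding alg_homD(6)[OF ev] alg_homD(6)[OF h] .
    fix a b assume "a \<in> carrier A0" "b \<in> carrier A0"
    then obtain f g where fg: "f \<in> carrier FM" "a = ?ev f" "g \<in> carrier FM" "b = ?ev g"
      using surj by blast
    have "a \<otimes>\<^bsub>A0\<^esub> b = ?ev (f \<otimes>\<^bsub>FM\<^esub> g)"
      using fg by (simp add: alg_homD(5)[OF ev])
    then have "j0 (a \<otimes>\<^bsub>A0\<^esub> b) = ?h (f \<otimes>\<^bsub>FM\<^esub> g)"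
      using j0(3)[OF FM.M.m_closed[OF fg(1,3)]] by simp
    then show "j0 (a \<otimes>\<^bsub>A0\<^esub> b) = j0 a \<otimes>\<^bsub>?R\<^esub> j0 b"
      using alg_homD(5)[OF h fg(1,3)] j0(3)[OF fg(1)] j0(3)[OF fg(3)] fg(2,4) by simp
  qed
  moreover have "inj_on (inl J) (carrier A1)"
    using J_inl letter_closed(1) by (intro inj_onI) (simp add: inl_def[OF J] FJ_eq_iff[OF J])
  moreover have "inj_on (inr J) (carrier A2)"
    using J_inr letter_closed(2) by (intro inj_onI) (simp add: inr_def[OF J] FJ_eq_iff[OF J])
  ultimately show ?thesis
    using R j0(2) inl_hom[OF J] inr_hom[OF J] FJ_generated[OF J] by blast
qed

end

text \<open>For the nonunital tensor algebra: its module axioms are inherited from the free algebra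
  rather than checked degree by degree.\<close>

lemma module_surj_image:
  assumes "module K L" "h \<in> mod_hom K L N" "h ` carrier L = carrier N" "h \<zero>\<^bsub>L\<^esub> = \<zero>\<^bsub>N\<^esub>"
  shows "module K N"
proof -
  interpret L: module K L by fact
  note hom = mod_homD[OF assms(2)]
  have cases: "\<exists>f\<in>carrier L. u = h f" if "u \<in> carrier N" for u
    using that assms(3) by blast
  show ?thesis
  proof (rule moduleI[OF L.R.is_cring])
    show "abelian_group N"
    proof (rule abelian_groupI)
      fix u assume "u \<in> carrier N"
      then obtain f where f: "f \<in> carrier L" "u = h f"
        using cases by blast
      have "h (\<ominus>\<^bsub>L\<^esub> f) \<oplus>\<^bsub>N\<^esub> u = \<zero>\<^bsub>N\<^esub>"
        using f by (simp add: L.M.l_neg assms(4) flip: hom(2))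
      then show "\<exists>v\<in>carrier N. v \<oplus>\<^bsub>N\<^esub> u = \<zero>\<^bsub>N\<^esub>"
        using f hom(1) by blast
    qed (auto dest!: cases simp: hom(1) L.M.a_ac simp flip: hom(2) assms(4))
  qed (auto dest!: cases simp: hom(1) L.smult_l_distr L.smult_r_distr L.smult_assoc1 simp flip: hom(2,3))
qed

lemma mod_hom_finsum:
  assumes "module K L" "module K N" "h \<in> mod_hom K L N" "finite I" "f \<in> I \<rightarrow> carrier L"
  shows "h (\<Oplus>\<^bsub>L\<^esub>i\<in>I. f i) = (\<Oplus>\<^bsub>N\<^esub>i\<in>I. h (f i))"
proof -
  interpret L: module K L by fact
  interpret N: module K N by fact
  note hom = mod_homD[OF assms(3)] mod_hom_zero[OF assms(1-3)]
  show ?thesis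
    using assms(4,5)
  proof (induction I rule: finite_induct)
    case (insert i I)
    then have "f \<in> I \<rightarrow> carrier L" "f i \<in> carrier L"
      by auto
    then show ?case
      using insert by (simp add: hom Pi_def)
  qed (simp add: hom)
qed

section \<open>The tensor algebra as a quotient of the free algebra\<close>

definition homogeneous_part :: "('k, 'm) ring_scheme \<Rightarrow> nat \<Rightarrow> ('s list \<Rightarrow> 'k) \<Rightarrow> 's list \<Rightarrow> 'k"
  where "homogeneous_part K n f = (\<lambda>w. if length w = n then f w else \<zero>\<^bsub>K\<^esub>)"

context
  fixes K :: "('k, 'm) ring_scheme" (structure) and M :: "('k, 'a, 'n) module_scheme"
  assumes M: "module K M"
begin

interpretation M: module K M by (rule M)

lemma tensor_K: "cring K"
  by (rule M.R.is_cring)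

abbreviation (input) "W \<equiv> word_elem K"
abbreviation (input) "FA \<equiv> free_algebra K (carrier M)"
abbreviation (input) "Fn n \<equiv> carrier (tuple_module K M n)"
abbreviation (input) "Nn n \<equiv> multilinear_submodule K M n"
abbreviation (input) "Tn n \<equiv> tensor_power K M n"
abbreviation (input) "part \<equiv> homogeneous_part K"
abbreviation (input) "NTA \<equiv> nonunital_tensor_algebra K M"

interpretation FA: assoc_algebra K FA
  by (rule free_assoc_algebra[OF tensor_K])

section \<open>Tuples of fixed length and the multilinearity relations\<close>

lemma tuple_carrier: "f \<in> Fn n \<longleftrightarrow> f \<in> carrier FA \<and> (\<forall>w. f w \<noteq> \<zero> \<longrightarrow> length w = n)"
  by (simp add: tuple_module_def)

lemma tuple_eq: "tuple_module K M n = FA\<lparr>carrier := Fn n\<rparr>"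
  by (simp add: tuple_module_def)

lemma tuple_simps:
  "zero (tuple_module K M n) = zero FA" "add (tuple_module K M n) = add FA"
  "smult (tuple_module K M n) = smult FA" "mult (tuple_module K M n) = mult FA"
  by (simp_all add: tuple_module_def)

lemma FA_coeff: "f \<in> carrier FA \<Longrightarrow> f w \<in> carrier K"
  by (simp add: free_carrier)

lemma FA_a_inv: "f \<in> carrier FA \<Longrightarrow> (\<ominus>\<^bsub>FA\<^esub> f) w = \<ominus> f w"
proof -
  assume f: "f \<in> carrier FA"
  have "\<ominus>\<^bsub>FA\<^esub> f = (\<ominus> \<one>) \<odot>\<^bsub>FA\<^esub> f"
    using f by (simp add: FA.smult_l_minus)
  then show ?thesis
    using FA_coeff[OF f] by (simp add: free_simps M.R.l_minus)
qed

lemma tuple_submodule: "submodule (Fn n) K FA"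
proof (rule FA.submoduleI)
  show "\<zero>\<^bsub>FA\<^esub> \<in> Fn n"
    unfolding tuple_carrier using FA.M.zero_closed by (simp add: free_simps)
  show "\<ominus>\<^bsub>FA\<^esub> f \<in> Fn n" if "f \<in> Fn n" for f
    using that unfolding tuple_carrier by (auto simp: FA_a_inv) (metis M.R.minus_zero)
  show "f \<oplus>\<^bsub>FA\<^esub> g \<in> Fn n" if fg: "f \<in> Fn n" "g \<in> Fn n" for f g
  proof -
    have "f \<oplus>\<^bsub>FA\<^esub> g \<in> carrier FA"
      using fg by (simp add: tuple_carrier)
    moreover have "length w = n" if "(f \<oplus>\<^bsub>FA\<^esub> g) w \<noteq> \<zero>" for w
      using that fg by (cases "f w = \<zero>") (auto simp: tuple_carrier free_simps FA_coeff)
    ultimately show ?thesis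
      by (simp add: tuple_carrier)
  qed
  show "c \<odot>\<^bsub>FA\<^esub> f \<in> Fn n" if cf: "c \<in> carrier K" "f \<in> Fn n" for c f
  proof -
    have "c \<odot>\<^bsub>FA\<^esub> f \<in> carrier FA"
      using cf by (simp add: tuple_carrier)
    moreover have "length w = n" if "(c \<odot>\<^bsub>FA\<^esub> f) w \<noteq> \<zero>" for w
      using that cf by (cases "f w = \<zero>") (auto simp: tuple_carrier free_simps FA_coeff)
    ultimately show ?thesis
      by (simp add: tuple_carrier)
  qed
qed (auto simp: tuple_carrier)

lemma tuple_module_is_module: "module K (tuple_module K M n)"
  using submodule.submodule_is_module[OF tuple_submodule FA.module_axioms, of n]
  by (simp only: tuple_eq[symmetric])

lemma tuple_minus: "g \<in> Fn n \<Longrightarrow> f \<ominus>\<^bsub>tuple_module K M n\<^esub> g = f \<ominus>\<^bsub>FA\<^esub> g"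
  using submodule_a_inv[OF FA.module_axioms tuple_submodule, of g n]
  by (simp add: a_minus_def tuple_simps flip: tuple_eq)

lemma word_Fn: "w \<in> lists (carrier M) \<Longrightarrow> length w = n \<Longrightarrow> W w \<in> Fn n"
  unfolding tuple_carrier using free_word_closed[OF tensor_K, of w]
  by (auto simp: word_elem_def)

text \<open>The relations are stated with the subtraction of one homogeneous component. Rewriting
  them inside the whole free algebra allows products that change the degree.\<close>

lemma multilinear_relations_cases:
  assumes "r \<in> multilinear_relations K M n"
  obtains (add) u v x y where "u \<in> lists (carrier M)" "v \<in> lists (carrier M)" "x \<in> carrier M" "y \<in> carrier M"
      "length u + 1 + length v = n"
      "r = W (u @ [x \<oplus>\<^bsub>M\<^esub> y] @ v) \<ominus>\<^bsub>FA\<^esub>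
        (W (u @ [x] @ v) \<oplus>\<^bsub>FA\<^esub> W (u @ [y] @ v))"
    | (smult) u v c x where "u \<in> lists (carrier M)" "v \<in> lists (carrier M)" "c \<in> carrier K" "x \<in> carrier M"
      "length u + 1 + length v = n"
      "r = W (u @ [c \<odot>\<^bsub>M\<^esub> x] @ v) \<ominus>\<^bsub>FA\<^esub> c \<odot>\<^bsub>FA\<^esub> W (u @ [x] @ v)"
proof -
  note sub = FA.submoduleE[OF tuple_submodule]
  consider (1) u v x y where "u \<in> lists (carrier M)" "v \<in> lists (carrier M)" "x \<in> carrier M" "y \<in> carrier M"
      "length u + 1 + length v = n"
      "r = W (u @ [x \<oplus>\<^bsub>M\<^esub> y] @ v) \<ominus>\<^bsub>tuple_module K M n\<^esub>
        (W (u @ [x] @ v) \<oplus>\<^bsub>tuple_module K M n\<^esub> W (u @ [y] @ v))"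
    | (2) u v c x where "u \<in> lists (carrier M)" "v \<in> lists (carrier M)" "c \<in> carrier K" "x \<in> carrier M"
      "length u + 1 + length v = n"
      "r = W (u @ [c \<odot>\<^bsub>M\<^esub> x] @ v) \<ominus>\<^bsub>tuple_module K M n\<^esub>
        c \<odot>\<^bsub>tuple_module K M n\<^esub> W (u @ [x] @ v)"
    using assms unfolding multilinear_relations_def Let_def
    by (elim UnE CollectE exE conjE) ((rule that(1); assumption), (rule that(2); assumption))
  then show thesis
  proof cases
    case 1
    have "W (u @ [x] @ v) \<oplus>\<^bsub>FA\<^esub> W (u @ [y] @ v) \<in> Fn n"
      using 1 by (intro sub(5) word_Fn) auto
    then show ?thesis
      using 1(6) by (intro add[OF 1(1-5)]) (simp add: tuple_minus tuple_simps)
  next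
    case 2
    have "c \<odot>\<^bsub>FA\<^esub> W (u @ [x] @ v) \<in> Fn n"
      using 2 by (intro sub(4) word_Fn) auto
    then show ?thesis
      using 2(6) by (intro smult[OF 2(1-5)]) (simp add: tuple_minus tuple_simps)
  qed
qed

lemma multilinear_relationsI:
  assumes "u \<in> lists (carrier M)" "v \<in> lists (carrier M)" "x \<in> carrier M"
    "length u + 1 + length v = n"
  shows "y \<in> carrier M \<Longrightarrow> W (u @ [x \<oplus>\<^bsub>M\<^esub> y] @ v) \<ominus>\<^bsub>FA\<^esub>
        (W (u @ [x] @ v) \<oplus>\<^bsub>FA\<^esub> W (u @ [y] @ v)) \<in> multilinear_relations K M n"
    and "c \<in> carrier K \<Longrightarrow> W (u @ [c \<odot>\<^bsub>M\<^esub> x] @ v) \<ominus>\<^bsub>FA\<^esub> c \<odot>\<^bsub>FA\<^esub> W (u @ [x] @ v)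
        \<in> multilinear_relations K M n"
proof -
  note sub = FA.submoduleE[OF tuple_submodule]
  have w: "W (u @ [z] @ v) \<in> Fn n" if "z \<in> carrier M" for z
    using assms that by (intro word_Fn) auto
  show "W (u @ [x \<oplus>\<^bsub>M\<^esub> y] @ v) \<ominus>\<^bsub>FA\<^esub>
        (W (u @ [x] @ v) \<oplus>\<^bsub>FA\<^esub> W (u @ [y] @ v)) \<in> multilinear_relations K M n"
    if y: "y \<in> carrier M"
    unfolding tuple_minus[OF sub(5)[OF w[OF assms(3)] w[OF y]], symmetric]
      multilinear_relations_def Let_def tuple_simps
    using assms y by blast
  show "W (u @ [c \<odot>\<^bsub>M\<^esub> x] @ v) \<ominus>\<^bsub>FA\<^esub> c \<odot>\<^bsub>FA\<^esub> W (u @ [x] @ v)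
        \<in> multilinear_relations K M n" if c: "c \<in> carrier K"
    unfolding tuple_minus[OF sub(4)[OF c w[OF assms(3)]], symmetric]
      multilinear_relations_def Let_def tuple_simps
    using assms c by blast
qed

lemma multilinear_relations_closed: "multilinear_relations K M n \<subseteq> Fn n"
proof
  note sub = FA.submoduleE[OF tuple_submodule] submodule_minus[OF FA.module_axioms tuple_submodule]
  fix r assume "r \<in> multilinear_relations K M n"
  then show "r \<in> Fn n"
  proof (cases rule: multilinear_relations_cases)
    case (add u v x y)
    then show ?thesis
      by (simp only:, intro sub word_Fn) auto
  next
    case (smult u v c x)
    then show ?thesis
      by (simp only:, intro sub word_Fn) auto
  qed
qed

lemma Nn_submodule: "submodule (Nn n) K (tuple_module K M n)"
  and Nn_relations: "multilinear_relations K M n \<subseteq> Nn n"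
  unfolding multilinear_submodule_def
  by (rule submodule_generated_submodule[OF tuple_module_is_module multilinear_relations_closed])+

lemma Nn_submodule_FA: "submodule (Nn n) K FA"
proof (rule submodule_trans[OF FA.module_axioms tuple_submodule])
  show "submodule (Nn n) K (FA\<lparr>carrier := Fn n\<rparr>)"
    using Nn_submodule[of n] by (simp only: tuple_eq[symmetric])
qed

lemma Nn_Fn: "Nn n \<subseteq> Fn n"
  using subgroup.subset[OF submodule.axioms(1)[OF Nn_submodule]] by simp

text \<open>The preimage of \<open>S\<close> is a submodule containing the relations. Here
  \<open>S\<close> will be either the relation submodule of another degree or the zero submodule of
  \<open>B\<close>.\<close>

lemma Nn_map:
  assumes L: "module K L" and h: "h \<in> mod_hom K FA L" and S: "submodule S K L"
    and rel: "\<And>r. r \<in> multilinear_relations K M n \<Longrightarrow> h r \<in> S" and f: "f \<in> Nn n"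
  shows "h f \<in> S"
proof -
  have "h \<in> mod_hom K (tuple_module K M n) L"
    using mod_homD[OF h] by (intro mod_homI) (simp_all add: tuple_carrier tuple_simps)
  then have "submodule {g \<in> Fn n. h g \<in> S} K (tuple_module K M n)"
    by (rule submodule_vimage[OF tuple_module_is_module L _
          module.carrier_is_submodule[OF tuple_module_is_module] S])
  moreover have "multilinear_relations K M n \<subseteq> {g \<in> Fn n. h g \<in> S}"
    using rel multilinear_relations_closed by auto
  ultimately have "Nn n \<subseteq> {g \<in> Fn n. h g \<in> S}"
    unfolding multilinear_submodule_def by (rule submodule_generated_minimal)
  then show ?thesis
    using f by auto
qed

lemma mult_mod_hom:
  assumes "g \<in> carrier FA"
  shows "(\<lambda>f. g \<otimes>\<^bsub>FA\<^esub> f) \<in> mod_hom K FA FA" "(\<lambda>f. f \<otimes>\<^bsub>FA\<^esub> g) \<in> mod_hom K FA FA"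
  using assms
  by (auto intro!: mod_homI simp: FA.M.r_distr FA.M.l_distr FA.smult_mult_left FA.smult_mult_right)

text \<open>A relation alters one letter between arbitrary words \<open>u\<close> and
  \<open>v\<close>, so multiplication by words only extends this context.\<close>

lemma relations_mult_word:
  assumes r: "r \<in> multilinear_relations K M n" and w: "w \<in> lists (carrier M)" "w' \<in> lists (carrier M)"
  shows "W w \<otimes>\<^bsub>FA\<^esub> r \<otimes>\<^bsub>FA\<^esub> W w' \<in> multilinear_relations K M (length w + n + length w')"
proof -
  have wF: "W v \<in> carrier FA" if "v \<in> lists (carrier M)" for v
    by (rule free_word_closed[OF tensor_K that])
  define h where "h f = W w \<otimes>\<^bsub>FA\<^esub> f \<otimes>\<^bsub>FA\<^esub> W w'" for f
  have h: "h \<in> mod_hom K FA FA"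
    using wF[OF w(1)] wF[OF w(2)]
    by (intro mod_homI) (simp_all add: h_def FA.M.l_distr FA.M.r_distr FA.smult_mult_left FA.smult_mult_right)
  note h_rules = mod_homD[OF h] mod_hom_minus[OF FA.module_axioms FA.module_axioms h]
  have h_word: "h (W (u @ [x] @ v)) = W ((w @ u) @ [x] @ (v @ w'))" for u x v
    by (simp add: h_def free_mult_word[OF tensor_K])
  from r have "h r \<in> multilinear_relations K M (length w + n + length w')"
  proof (cases rule: multilinear_relations_cases)
    case (add u v x y)
    have "h r = W ((w @ u) @ [x \<oplus>\<^bsub>M\<^esub> y] @ (v @ w')) \<ominus>\<^bsub>FA\<^esub>
        (W ((w @ u) @ [x] @ (v @ w')) \<oplus>\<^bsub>FA\<^esub> W ((w @ u) @ [y] @ (v @ w')))"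
      unfolding add(6) h_word[symmetric] using add(1-4) by (simp add: h_rules wF)
    then show ?thesis
      using add w by (simp only:) (intro multilinear_relationsI, auto)
  next
    case (smult u v c x)
    have "h r = W ((w @ u) @ [c \<odot>\<^bsub>M\<^esub> x] @ (v @ w')) \<ominus>\<^bsub>FA\<^esub>
        c \<odot>\<^bsub>FA\<^esub> W ((w @ u) @ [x] @ (v @ w'))"
      unfolding smult(6) h_word[symmetric] using smult(1-4) by (simp add: h_rules wF)
    then show ?thesis
      using smult w by (simp only:) (intro multilinear_relationsI, auto)
  qed
  then show ?thesis
    by (simp add: h_def)
qed

text \<open>The relation submodules of all degrees together behave like a homogeneous ideal; this is
  what makes multiplication of tensors well defined. Linearity reduces both factors to
  generators.\<close>

lemma Nn_mult:
  assumes f: "f \<in> Nn n" and g: "g \<in> Fn i"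
  shows "g \<otimes>\<^bsub>FA\<^esub> f \<in> Nn (i + n)" "f \<otimes>\<^bsub>FA\<^esub> g \<in> Nn (n + i)"
proof -
  have fF: "f \<in> carrier FA" and gF: "g \<in> carrier FA"
    using f g Nn_Fn[of n] by (auto simp: tuple_carrier)
  have wF: "W v \<in> carrier FA" if "v \<in> lists (carrier M)" for v
    by (rule free_word_closed[OF tensor_K that])
  have word: "W w \<otimes>\<^bsub>FA\<^esub> f \<in> Nn (i + n)" "f \<otimes>\<^bsub>FA\<^esub> W w \<in> Nn (n + i)"
    if w: "w \<in> lists (carrier M)" "w \<in> {w. length w = i}" for w
  proof -
    have i: "length w = i"
      using w(2) by simp
    have rel: "W w \<otimes>\<^bsub>FA\<^esub> r \<in> Nn (i + n)" "r \<otimes>\<^bsub>FA\<^esub> W w \<in> Nn (n + i)"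
      if r: "r \<in> multilinear_relations K M n" for r
    proof -
      have "r \<in> carrier FA" "W [] = \<one>\<^bsub>FA\<^esub>"
        using subsetD[OF multilinear_relations_closed r]
        by (auto simp: tuple_carrier free_simps)
      then show "W w \<otimes>\<^bsub>FA\<^esub> r \<in> Nn (i + n)" "r \<otimes>\<^bsub>FA\<^esub> W w \<in> Nn (n + i)"
        using relations_mult_word[OF r w(1), of "[]"] relations_mult_word[OF r _ w(1), of "[]"]
          Nn_relations wF[OF w(1)] by (auto simp: i)
    qed
    show "W w \<otimes>\<^bsub>FA\<^esub> f \<in> Nn (i + n)"
      using rel(1) by (rule Nn_map[OF FA.module_axioms mult_mod_hom(1)[OF wF[OF w(1)]] Nn_submodule_FA _ f])
    show "f \<otimes>\<^bsub>FA\<^esub> W w \<in> Nn (n + i)"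
      using rel(2) by (rule Nn_map[OF FA.module_axioms mult_mod_hom(2)[OF wF[OF w(1)]] Nn_submodule_FA _ f])
  qed
  note N_rules = FA.submoduleE[OF Nn_submodule_FA] submodule_zero[OF Nn_submodule_FA]
  have supp: "w \<in> {w. length w = i}" if "g w \<noteq> \<zero>" for w
    using g that by (simp add: tuple_carrier)
  show "g \<otimes>\<^bsub>FA\<^esub> f \<in> Nn (i + n)"
    by (rule free_induct[OF tensor_K gF supp])
      (use word(1) N_rules(4,5,7) fF in \<open>simp_all add: FA.M.l_distr FA.smult_mult_left\<close>)
  show "f \<otimes>\<^bsub>FA\<^esub> g \<in> Nn (n + i)"
    by (rule free_induct[OF tensor_K gF supp])
      (use word(2) N_rules(4,5,7) fF in \<open>simp_all add: FA.M.r_distr FA.smult_mult_right\<close>)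
qed

section \<open>Homogeneous components and classes in the tensor algebra\<close>

lemma part_supp: "{w. part n f w \<noteq> \<zero>} \<subseteq> {w. f w \<noteq> \<zero>}"
  by (auto simp: homogeneous_part_def)

lemma part_closed:
  assumes "f \<in> carrier FA"
  shows "part n f \<in> Fn n"
proof -
  have "finite {w. part n f w \<noteq> \<zero>}" "{w. part n f w \<noteq> \<zero>} \<subseteq> lists (carrier M)"
    using assms part_supp[of n f] finite_subset unfolding free_carrier by blast+
  moreover have "part n f w \<in> carrier K" for w
    using FA_coeff[OF assms] by (simp add: homogeneous_part_def)
  ultimately have "part n f \<in> carrier FA"
    unfolding free_carrier by blast
  then show ?thesis
    unfolding tuple_carrier by (simp add: homogeneous_part_def)
qed

lemma part_hom: "part n \<in> mod_hom K FA (tuple_module K M n)"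
  by (rule mod_homI) (simp_all add: part_closed tuple_simps,
      auto simp: homogeneous_part_def free_simps)

lemma part_homogeneous: "f \<in> Fn n \<Longrightarrow> part m f = (if m = n then f else \<zero>\<^bsub>FA\<^esub>)"
  unfolding tuple_carrier by (rule ext) (simp add: homogeneous_part_def free_simps, metis)

lemma coset_tuple: "H +>\<^bsub>tuple_module K M n\<^esub> f = H +>\<^bsub>FA\<^esub> f"
  by (simp add: a_r_coset_def' tuple_simps)

lemmas Tn_hom = coset_mod_hom[OF tuple_module_is_module Nn_submodule, folded tensor_power_def, unfolded coset_tuple]
lemmas Tn_zero_iff = coset_zero_iff[OF tuple_module_is_module Nn_submodule, folded tensor_power_def, unfolded coset_tuple]
lemmas Tn_module = quot_module_is_module[OF tuple_module_is_module Nn_submodule, folded tensor_power_def]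

lemma Tn_carrier: "carrier (Tn n) = (\<lambda>f. Nn n +>\<^bsub>FA\<^esub> f) ` Fn n"
  by (simp add: tensor_power_def quot_carrier coset_tuple)

text \<open>The only cut with a nonzero first factor is at position \<open>i\<close>, and the rest
  then has length \<open>j\<close> only if the degrees add up.\<close>

lemma mult_homogeneous:
  assumes f: "f \<in> Fn i" and g: "g \<in> Fn j"
  shows "(f \<otimes>\<^bsub>FA\<^esub> g) w = (if length w = i + j then f (take i w) \<otimes> g (drop i w) else \<zero>)"
proof -
  have fg: "f v \<in> carrier K" "g v \<in> carrier K" "length v \<noteq> i \<Longrightarrow> f v = \<zero>" "length v \<noteq> j \<Longrightarrow> g v = \<zero>" for v
    using f g FA_coeff by (auto simp: tuple_carrier)
  have "(f \<otimes>\<^bsub>FA\<^esub> g) w = (\<Oplus>k\<in>{..length w}.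
      if i = k then (if length w = i + j then f (take i w) \<otimes> g (drop i w) else \<zero>) else \<zero>)"
    unfolding free_simps(5) using fg by (intro M.R.finsum_cong') auto
  also have "\<dots> = (if length w = i + j then f (take i w) \<otimes> g (drop i w) else \<zero>)"
  proof (cases "length w = i + j")
    case True
    then show ?thesis
      using fg by (intro M.R.finsum_singleton) auto
  next
    case False
    then show ?thesis
      by (simp add: M.R.add.finprod_one_eqI)
  qed
  finally show ?thesis .
qed

lemma mult_Fn:
  assumes "f \<in> Fn i" "g \<in> Fn j"
  shows "f \<otimes>\<^bsub>FA\<^esub> g \<in> Fn (i + j)"
proof -
  have "f \<otimes>\<^bsub>FA\<^esub> g \<in> carrier FA"
    using assms by (simp add: tuple_carrier)
  then show ?thesis
    unfolding tuple_carrier using mult_homogeneous[OF assms] by auto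
qed

lemma tensor_mult_coset:
  assumes f: "f \<in> Fn i" and g: "g \<in> Fn j"
  shows "tensor_mult K M i j (Nn i +>\<^bsub>FA\<^esub> f) (Nn j +>\<^bsub>FA\<^esub> g) = Nn (i + j) +>\<^bsub>FA\<^esub> (f \<otimes>\<^bsub>FA\<^esub> g)"
proof -
  note sub = FA.submoduleE[OF tuple_submodule]
  note N_rules = FA.submoduleE[OF Nn_submodule_FA] submodule_zero[OF Nn_submodule_FA]
  have FA_closed: "u \<in> carrier FA" if "u \<in> Fn n" for u n
    using that by (simp add: tuple_carrier)
  have eq: "Nn (i + j) +>\<^bsub>FA\<^esub> (a \<otimes>\<^bsub>FA\<^esub> b) = Nn (i + j) +>\<^bsub>FA\<^esub> (f \<otimes>\<^bsub>FA\<^esub> g)"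
    if ab: "a \<in> Nn i +>\<^bsub>FA\<^esub> f" "b \<in> Nn j +>\<^bsub>FA\<^esub> g" for a b
  proof -
    obtain p q where p: "p \<in> Nn i" "a = p \<oplus>\<^bsub>FA\<^esub> f" and q: "q \<in> Nn j" "b = q \<oplus>\<^bsub>FA\<^esub> g"
      using ab by (auto simp: a_r_coset_def')
    have pq: "p \<in> Fn i" "q \<in> Fn j" "b \<in> Fn j"
      using p q Nn_Fn[of i] Nn_Fn[of j] sub(5)[of q j g] g by auto
    note car = FA_closed[OF pq(1)] FA_closed[OF pq(2)] FA_closed[OF pq(3)] FA_closed[OF f] FA_closed[OF g]
    \<comment> \<open>With \<open>a = p + f\<close> and \<open>b = q + g\<close>, the difference
      \<open>a b - f g\<close> equals \<open>p b + f q\<close>: each summand has one factor among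
      the relations, so the choice of representatives is immaterial.\<close>
    let ?s = "p \<otimes>\<^bsub>FA\<^esub> b \<oplus>\<^bsub>FA\<^esub> f \<otimes>\<^bsub>FA\<^esub> q"
    have s: "?s \<in> Nn (i + j)"
      using Nn_mult(2)[OF p(1) pq(3)] Nn_mult(1)[OF q(1) f] by (rule N_rules(5))
    have "a \<otimes>\<^bsub>FA\<^esub> b = p \<otimes>\<^bsub>FA\<^esub> b \<oplus>\<^bsub>FA\<^esub> f \<otimes>\<^bsub>FA\<^esub> b"
      unfolding p(2) using car by (simp add: FA.M.l_distr)
    also have "f \<otimes>\<^bsub>FA\<^esub> b = f \<otimes>\<^bsub>FA\<^esub> q \<oplus>\<^bsub>FA\<^esub> f \<otimes>\<^bsub>FA\<^esub> g"
      unfolding q(2) using car by (simp add: FA.M.r_distr)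
    finally have "a \<otimes>\<^bsub>FA\<^esub> b \<ominus>\<^bsub>FA\<^esub> f \<otimes>\<^bsub>FA\<^esub> g = ?s"
      using car by (simp add: FA.M.minus_eq FA.M.a_assoc FA.M.r_neg)
    moreover have "a \<in> carrier FA"
      using p(2) car by simp
    ultimately show ?thesis
      using s car by (simp add: coset_eq_iff[OF FA.module_axioms Nn_submodule_FA])
  qed
  have "f \<in> Nn i +>\<^bsub>FA\<^esub> f" "g \<in> Nn j +>\<^bsub>FA\<^esub> g"
    unfolding a_r_coset_def'
    by (rule UN_I[OF N_rules(7)], simp add: FA_closed[OF f] FA_closed[OF g])+
  with eq show ?thesis
    unfolding tensor_mult_def rcoset_mult_def by blast
qed

text \<open>The canonical map from the free algebra to the tensor algebra, with degree 0 discarded.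
  It is linear everywhere; multiplicativity is claimed only for vanishing constant terms, since
  constants would contribute to higher degrees.\<close>

definition tensor_class where
  "tensor_class f = (\<lambda>n\<in>{1..}. multilinear_submodule K M n +>\<^bsub>free_algebra K (carrier M)\<^esub> homogeneous_part K n f)"

lemma NTA_simps:
  "t \<in> carrier NTA \<longleftrightarrow> t \<in> (\<Pi>\<^sub>E n\<in>{1..}. carrier (Tn n)) \<and> finite {n \<in> {1..}. t n \<noteq> \<zero>\<^bsub>Tn n\<^esub>}"
  "s \<oplus>\<^bsub>NTA\<^esub> t = (\<lambda>n\<in>{1..}. s n \<oplus>\<^bsub>Tn n\<^esub> t n)"
  "c \<odot>\<^bsub>NTA\<^esub> t = (\<lambda>n\<in>{1..}. c \<odot>\<^bsub>Tn n\<^esub> t n)"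
  "zero NTA = (\<lambda>n\<in>{1..}. \<zero>\<^bsub>Tn n\<^esub>)"
  "s \<otimes>\<^bsub>NTA\<^esub> t = (\<lambda>n\<in>{1..}. \<Oplus>\<^bsub>Tn n\<^esub>i\<in>{1..<n}. tensor_mult K M i (n - i) (s i) (t (n - i)))"
  by (simp_all add: nonunital_tensor_algebra_def)

lemma Tn_part_closed: "f \<in> carrier FA \<Longrightarrow> Nn n +>\<^bsub>FA\<^esub> part n f \<in> carrier (Tn n)"
  by (rule mod_homD(1)[OF Tn_hom part_closed])

lemma tensor_class_closed:
  assumes f: "f \<in> carrier FA"
  shows "tensor_class f \<in> carrier NTA"
proof -
  have "{n \<in> {1..}. tensor_class f n \<noteq> \<zero>\<^bsub>Tn n\<^esub>} \<subseteq> length ` {w. f w \<noteq> \<zero>}"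
  proof
    fix n assume n: "n \<in> {n \<in> {1..}. tensor_class f n \<noteq> \<zero>\<^bsub>Tn n\<^esub>}"
    show "n \<in> length ` {w. f w \<noteq> \<zero>}"
    proof (rule ccontr)
      assume "n \<notin> length ` {w. f w \<noteq> \<zero>}"
      then have "part n f = \<zero>\<^bsub>FA\<^esub>"
        by (auto simp: homogeneous_part_def free_simps fun_eq_iff)
      then have "Nn n +>\<^bsub>FA\<^esub> part n f = \<zero>\<^bsub>Tn n\<^esub>"
        using Tn_zero_iff[OF part_closed[OF f], of n] submodule_zero[OF Nn_submodule_FA, of n] by simp
      moreover have "n \<ge> 1" "tensor_class f n \<noteq> \<zero>\<^bsub>Tn n\<^esub>"
        using n by auto
      ultimately show False
        by (simp add: tensor_class_def)
    qed
  qed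
  moreover have "finite {w. f w \<noteq> \<zero>}"
    using f by (simp add: free_carrier)
  ultimately have "finite {n \<in> {1..}. tensor_class f n \<noteq> \<zero>\<^bsub>Tn n\<^esub>}"
    by (meson finite_imageI finite_subset)
  moreover have "tensor_class f \<in> (\<Pi>\<^sub>E n\<in>{1..}. carrier (Tn n))"
    using Tn_part_closed[OF f] by (auto simp: tensor_class_def)
  ultimately show ?thesis
    unfolding NTA_simps by blast
qed

lemma tensor_class_hom: "tensor_class \<in> mod_hom K FA NTA"
proof (rule mod_homI[OF tensor_class_closed])
  fix f g assume fg: "f \<in> carrier FA" "g \<in> carrier FA"
  have "Nn n +>\<^bsub>FA\<^esub> part n (f \<oplus>\<^bsub>FA\<^esub> g) = (Nn n +>\<^bsub>FA\<^esub> part n f) \<oplus>\<^bsub>Tn n\<^esub> (Nn n +>\<^bsub>FA\<^esub> part n g)" for n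
    using mod_homD(2)[OF Tn_hom, of "part n f" n "part n g"] mod_homD(2)[OF part_hom fg, of n]
      part_closed[OF fg(1)] part_closed[OF fg(2)] by (simp add: tuple_simps)
  then show "tensor_class (f \<oplus>\<^bsub>FA\<^esub> g) = tensor_class f \<oplus>\<^bsub>NTA\<^esub> tensor_class g"
    by (auto simp: tensor_class_def NTA_simps fun_eq_iff restrict_def)
next
  fix c f assume cf: "c \<in> carrier K" "f \<in> carrier FA"
  have "Nn n +>\<^bsub>FA\<^esub> part n (c \<odot>\<^bsub>FA\<^esub> f) = c \<odot>\<^bsub>Tn n\<^esub> (Nn n +>\<^bsub>FA\<^esub> part n f)" for n
    using mod_homD(3)[OF Tn_hom cf(1), of "part n f" n] mod_homD(3)[OF part_hom cf, of n]
      part_closed[OF cf(2)] by (simp add: tuple_simps)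
  then show "tensor_class (c \<odot>\<^bsub>FA\<^esub> f) = c \<odot>\<^bsub>NTA\<^esub> tensor_class f"
    by (auto simp: tensor_class_def NTA_simps fun_eq_iff restrict_def)
qed

lemma tensor_class_zero_iff:
  assumes f: "f \<in> carrier FA"
  shows "tensor_class f = \<zero>\<^bsub>NTA\<^esub> \<longleftrightarrow> (\<forall>n\<ge>1. part n f \<in> Nn n)"
  using Tn_zero_iff[OF part_closed[OF f]]
  by (auto simp: tensor_class_def NTA_simps fun_eq_iff restrict_def)

lemma tensor_class_surj: "tensor_class ` {f \<in> carrier FA. f [] = \<zero>} = carrier NTA"
proof
  show "tensor_class ` {f \<in> carrier FA. f [] = \<zero>} \<subseteq> carrier NTA"
    using tensor_class_closed by auto
  show "carrier NTA \<subseteq> tensor_class ` {f \<in> carrier FA. f [] = \<zero>}"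
  proof
    fix t assume "t \<in> carrier NTA"
    then have t: "t \<in> (\<Pi>\<^sub>E n\<in>{1..}. carrier (Tn n))" "finite {n \<in> {1..}. t n \<noteq> \<zero>\<^bsub>Tn n\<^esub>}"
      by (auto simp: NTA_simps)
    define S where "S = {n \<in> {1..}. t n \<noteq> \<zero>\<^bsub>Tn n\<^esub>}"
    have "\<exists>f. f \<in> Fn n \<and> t n = Nn n +>\<^bsub>FA\<^esub> f" if "n \<ge> 1" for n
    proof -
      have "t n \<in> carrier (Tn n)"
        using t(1) that by auto
      then show ?thesis
        unfolding Tn_carrier by blast
    qed
    then obtain r where r: "\<And>n. n \<ge> 1 \<Longrightarrow> r n \<in> Fn n" "\<And>n. n \<ge> 1 \<Longrightarrow> t n = Nn n +>\<^bsub>FA\<^esub> r n"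
      by metis
    \<comment> \<open>Representatives of different degrees are glued into one function. Outside
      \<open>S\<close> it is set to zero, because a nonzero representative of the zero class in
      every degree could make the support infinite.\<close>
    define f where "f w = (if length w \<in> S then r (length w) w else \<zero>)" for w
    have rS: "r n \<in> carrier FA" if "n \<in> S" for n
      using r(1)[of n] that by (simp add: S_def tuple_carrier)
    have "{w. f w \<noteq> \<zero>} \<subseteq> (\<Union>n\<in>S. {w. r n w \<noteq> \<zero>})"
      by (auto simp: f_def split: if_splits)
    moreover have "finite (\<Union>n\<in>S. {w. r n w \<noteq> \<zero>})" "(\<Union>n\<in>S. {w. r n w \<noteq> \<zero>}) \<subseteq> lists (carrier M)"
      using t(2) rS unfolding free_carrier S_def by blast+
    moreover have "f w \<in> carrier K" for w
      using rS FA_coeff by (auto simp: f_def)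
    ultimately have f: "f \<in> carrier FA"
      unfolding free_carrier by (meson finite_subset subset_trans)
    have "tensor_class f = t"
    proof
      fix n
      show "tensor_class f n = t n"
      proof (cases "n \<ge> 1")
        case True
        have "Nn n +>\<^bsub>FA\<^esub> part n f = t n"
        proof (cases "n \<in> S")
          case True
          then have "part n f = r n"
            using r(1)[of n] by (auto simp: homogeneous_part_def f_def fun_eq_iff tuple_carrier S_def)
          then show ?thesis
            using r(2) \<open>n \<ge> 1\<close> by simp
        next
          case False
          then have "part n f = \<zero>\<^bsub>FA\<^esub>"
            by (auto simp: homogeneous_part_def f_def fun_eq_iff free_simps)
          moreover have "t n = \<zero>\<^bsub>Tn n\<^esub>"
            using False \<open>n \<ge> 1\<close> by (simp add: S_def)
          ultimately show ?thesis
            using Tn_zero_iff[OF part_closed[OF f], of n] submodule_zero[OF Nn_submodule_FA] by simp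
        qed
        then show ?thesis
          using True by (simp add: tensor_class_def)
      next
        case False
        then show ?thesis
          using t(1) by (auto simp: tensor_class_def PiE_def extensional_def)
      qed
    qed
    moreover have "f [] = \<zero>"
      by (simp add: f_def S_def)
    ultimately show "t \<in> tensor_class ` {f \<in> carrier FA. f [] = \<zero>}"
      using f by blast
  qed
qed

lemma NTA_module: "module K NTA"
proof (rule module_surj_image[OF FA.module_axioms tensor_class_hom])
  show "tensor_class ` carrier FA = carrier NTA"
    using tensor_class_surj tensor_class_closed by blast
  show "tensor_class \<zero>\<^bsub>FA\<^esub> = \<zero>\<^bsub>NTA\<^esub>"
    using mod_hom_zero[OF FA.module_axioms tuple_module_is_module part_hom]
      submodule_zero[OF Nn_submodule_FA] by (simp add: tensor_class_zero_iff tuple_simps)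
qed

text \<open>The cuts at 0 and \<open>n\<close> contribute a factor \<open>f []\<close> or
  \<open>g []\<close>. Their vanishing is why the sum may run over \<open>{1..<n}\<close>, as in the
  product of the nonunital tensor algebra.\<close>

lemma part_mult:
  assumes f: "f \<in> carrier FA" "f [] = \<zero>" and g: "g \<in> carrier FA" "g [] = \<zero>"
  shows "part n (f \<otimes>\<^bsub>FA\<^esub> g) = (\<Oplus>\<^bsub>tuple_module K M n\<^esub>i\<in>{1..<n}. part i f \<otimes>\<^bsub>FA\<^esub> part (n - i) g)"
    (is "_ = ?r")
proof
  fix w
  have closed: "part i f \<otimes>\<^bsub>FA\<^esub> part (n - i) g \<in> Fn n" if "i \<in> {1..<n}" for i
    using mult_Fn[OF part_closed[OF f(1)] part_closed[OF g(1)], of i "n - i"] that by simp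
  \<comment> \<open>Evaluation at a fixed word is linear and so moves inside the finite sum of
    tuples.\<close>
  have ev: "(\<lambda>f. f w) \<in> mod_hom K (tuple_module K M n) (base_algebra K)"
    by (rule mod_homI) (simp_all add: tuple_carrier FA_coeff tuple_simps free_simps)
  have base: "finsum (base_algebra K) h A = finsum K h A" for h and A :: "nat set"
    by (simp add: finsum_def finprod_def)
  have "?r w = (\<Oplus>i\<in>{1..<n}. (part i f \<otimes>\<^bsub>FA\<^esub> part (n - i) g) w)"
    using mod_hom_finsum[OF tuple_module_is_module assoc_algebra_module[OF assoc_algebra_base[OF tensor_K]] ev,
        of "{1..<n}" "\<lambda>i. part i f \<otimes>\<^bsub>FA\<^esub> part (n - i) g"] closed by (simp add: base Pi_def)
  also have "\<dots> = (\<Oplus>i\<in>{1..<n}. if length w = n then f (take i w) \<otimes> g (drop i w) else \<zero>)"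
  proof (rule M.R.finsum_cong')
    fix i assume i: "i \<in> {1..<n}"
    show "(part i f \<otimes>\<^bsub>FA\<^esub> part (n - i) g) w =
        (if length w = n then f (take i w) \<otimes> g (drop i w) else \<zero>)"
      unfolding mult_homogeneous[OF part_closed[OF f(1)] part_closed[OF g(1)]]
      using i by (simp add: homogeneous_part_def)
  qed (use FA_coeff[OF f(1)] FA_coeff[OF g(1)] in auto)
  also have "\<dots> = part n (f \<otimes>\<^bsub>FA\<^esub> g) w"
  proof (cases "length w = n")
    case True
    have "(\<Oplus>i\<in>{1..<n}. f (take i w) \<otimes> g (drop i w)) =
        (\<Oplus>i\<in>{..n}. f (take i w) \<otimes> g (drop i w))"
    proof (rule M.R.add.finprod_mono_neutral_cong_left)
      fix i assume "i \<in> {..n} - {1..<n}"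
      then have "i = 0 \<or> i = n"
        by auto
      then show "f (take i w) \<otimes> g (drop i w) = \<zero>"
        using True f(2) g(2) FA_coeff[OF f(1)] FA_coeff[OF g(1)] by auto
    qed (use FA_coeff[OF f(1)] FA_coeff[OF g(1)] in auto)
    then show ?thesis
      using True by (simp add: homogeneous_part_def free_simps(5))
  next
    case False
    then show ?thesis
      by (simp add: homogeneous_part_def M.R.add.finprod_one_eqI)
  qed
  finally show "part n (f \<otimes>\<^bsub>FA\<^esub> g) w = ?r w" ..
qed

lemma tensor_class_mult:
  assumes f: "f \<in> carrier FA" "f [] = \<zero>" and g: "g \<in> carrier FA" "g [] = \<zero>"
  shows "tensor_class (f \<otimes>\<^bsub>FA\<^esub> g) = tensor_class f \<otimes>\<^bsub>NTA\<^esub> tensor_class g"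
proof
  fix n
  interpret T: module K "Tn n"
    by (rule Tn_module)
  have closed: "part i f \<otimes>\<^bsub>FA\<^esub> part (n - i) g \<in> Fn n" if "i \<in> {1..<n}" for i
    using mult_Fn[OF part_closed[OF f(1)] part_closed[OF g(1)], of i "n - i"] that by simp
  have "Nn n +>\<^bsub>FA\<^esub> part n (f \<otimes>\<^bsub>FA\<^esub> g) = (\<Oplus>\<^bsub>Tn n\<^esub>i\<in>{1..<n}. Nn n +>\<^bsub>FA\<^esub> (part i f \<otimes>\<^bsub>FA\<^esub> part (n - i) g))"
    unfolding part_mult[OF f g] using closed
    by (intro mod_hom_finsum[OF tuple_module_is_module Tn_module Tn_hom]) auto
  also have "\<dots> = (\<Oplus>\<^bsub>Tn n\<^esub>i\<in>{1..<n}. tensor_mult K M i (n - i) (tensor_class f i) (tensor_class g (n - i)))"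
  proof (rule T.M.finsum_cong')
    show eq: "Nn n +>\<^bsub>FA\<^esub> (part i f \<otimes>\<^bsub>FA\<^esub> part (n - i) g) =
        tensor_mult K M i (n - i) (tensor_class f i) (tensor_class g (n - i))" if "i \<in> {1..<n}" for i
    proof -
      have "i \<ge> 1" "n - i \<ge> 1" "i + (n - i) = n"
        using that by auto
      then show ?thesis
        using tensor_mult_coset[OF part_closed[OF f(1)] part_closed[OF g(1)], of i "n - i"]
        by (simp add: tensor_class_def)
    qed
    show "(\<lambda>i. tensor_mult K M i (n - i) (tensor_class f i) (tensor_class g (n - i))) \<in> {1..<n} \<rightarrow> carrier (Tn n)"
      using mod_homD(1)[OF Tn_hom closed] by (auto simp flip: eq)
  qed simp
  finally show "tensor_class (f \<otimes>\<^bsub>FA\<^esub> g) n = (tensor_class f \<otimes>\<^bsub>NTA\<^esub> tensor_class g) n"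
    by (simp add: tensor_class_def[of "f \<otimes>\<^bsub>FA\<^esub> g"] NTA_simps)
qed

end

section \<open>Comparing the kernel of \<theta> with the tensor relations\<close>

context split_pair
begin

abbreviation NTA where "NTA \<equiv> nonunital_tensor_algebra K M1"
abbreviation tc where "tc \<equiv> tensor_class K M1"

lemmas tc_hom = tensor_class_hom[OF M1_module]
lemmas tc_rules = mod_homD[OF tc_hom]

lemma tc_zero: "tc \<zero>\<^bsub>FM\<^esub> = \<zero>\<^bsub>NTA\<^esub>"
  by (rule mod_hom_zero[OF FM.module_axioms NTA_module[OF M1_module] tc_hom])

lemma \<theta>_sandwich:
  assumes "u \<in> lists (carrier M1)" "v \<in> lists (carrier M1)" "m \<in> carrier M1"
  shows "\<theta> (W (u @ [m] @ v)) =
    \<theta> (W u) \<otimes>\<^bsub>B\<^esub> (\<tau> m \<otimes>\<^bsub>B\<^esub> \<theta> (W v))"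
proof -
  have w: "W w \<in> carrier FM" if "w \<in> lists (carrier M1)" for w
    by (rule free_word_closed[OF K that])
  have "W (u @ [m] @ v) =
      W u \<otimes>\<^bsub>FM\<^esub> (W [m] \<otimes>\<^bsub>FM\<^esub> W v)"
    by (simp add: free_mult_word[OF K])
  then show ?thesis
    using w[OF assms(1)] w[OF assms(2)] letter_FM[OF assms(3)] by (simp add: \<theta>_rules(5) \<tau>_eq[OF assms(3)])
qed

text \<open>Splitting the word around the altered letter isolates a factor \<open>\<tau> m\<close>,
  and \<tau> is linear; so each relation goes to zero.\<close>

lemma \<theta>_multilinear:
  assumes f: "f \<in> multilinear_submodule K M1 n"
  shows "\<theta> f = \<zero>\<^bsub>B\<^esub>"
proof -
  have w: "W w \<in> carrier FM" if "w \<in> lists (carrier M1)" for w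
    by (rule free_word_closed[OF K that])
  note minus = mod_hom_minus[OF FM.module_axioms B.module_axioms \<theta>_rules(1)]
  have "\<theta> r \<in> {\<zero>\<^bsub>B\<^esub>}" if "r \<in> multilinear_relations K M1 n" for r
    using M1_module that
  proof (cases rule: multilinear_relations_cases)
    case (add u v y z)
    have y: "\<tau> y \<in> carrier B" "\<tau> z \<in> carrier B" "\<theta> (W u) \<in> carrier B" "\<theta> (W v) \<in> carrier B"
      using add w mod_homD(1)[OF \<tau>_hom] \<theta>_rules(2) by auto
    have "\<theta> r = \<theta> (W (u @ [y \<oplus>\<^bsub>A1\<^esub> z] @ v)) \<ominus>\<^bsub>B\<^esub>
        (\<theta> (W (u @ [y] @ v)) \<oplus>\<^bsub>B\<^esub> \<theta> (W (u @ [z] @ v)))"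
      using add(1-4) M1_closed(1)[OF add(3,4)] by (simp add: add(6) minus w \<theta>_rules(3))
    also have "\<dots> = \<zero>\<^bsub>B\<^esub>"
      using y mod_homD(2)[OF \<tau>_hom add(3,4)]
      by (simp only: \<theta>_sandwich[OF add(1,2)] M1_closed(1)[OF add(3,4)] add(3,4))
        (simp add: B.M.l_distr B.M.r_distr B.M.minus_eq B.M.r_neg)
    finally show ?thesis
      by simp
  next
    case (smult u v c y)
    have y: "\<tau> y \<in> carrier B" "\<theta> (W u) \<in> carrier B" "\<theta> (W v) \<in> carrier B"
      using smult w mod_homD(1)[OF \<tau>_hom] \<theta>_rules(2) by auto
    have "\<theta> r = \<theta> (W (u @ [c \<odot>\<^bsub>A1\<^esub> y] @ v)) \<ominus>\<^bsub>B\<^esub> c \<odot>\<^bsub>B\<^esub> \<theta> (W (u @ [y] @ v))"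
      using smult(1-4) M1_closed(2)[OF smult(3,4)] by (simp add: smult(6) minus w \<theta>_rules(4))
    also have "\<dots> = \<zero>\<^bsub>B\<^esub>"
      using y smult(3) mod_homD(3)[OF \<tau>_hom smult(3,4)]
      by (simp only: \<theta>_sandwich[OF smult(1,2)] M1_closed(2)[OF smult(3,4)] smult(4))
        (simp add: B.smult_mult_left B.smult_mult_right B.M.minus_eq B.M.r_neg)
    finally show ?thesis
      by simp
  qed
  from Nn_map[OF M1_module B.module_axioms \<theta>_rules(1) zero_submodule[OF B.module_axioms] this f] show ?thesis
    by simp
qed

lemma tc_zero_imp_\<theta>_zero:
  assumes "f \<in> FMp" "tc f = \<zero>\<^bsub>NTA\<^esub>"
  shows "\<theta> f = \<zero>\<^bsub>B\<^esub>"
proof -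
  \<comment> \<open>Induction on a bound \<open>d\<close> for the lengths in the support: the
    component of top degree is split off, and the remainder satisfies the smaller bound.\<close>
  have *: "\<theta> f = \<zero>\<^bsub>B\<^esub>"
    if "f \<in> carrier FM" "f [] = \<zero>" "\<And>n. n \<ge> 1 \<Longrightarrow> \<theta> (homogeneous_part K n f) = \<zero>\<^bsub>B\<^esub>"
      "\<And>w. f w \<noteq> \<zero> \<Longrightarrow> length w \<le> d" for d f
    using that
  proof (induction d arbitrary: f)
    case 0
    have "f w = \<zero>" for w
      using 0(2) 0(4)[of w] by (cases "f w = \<zero>") auto
    then have "f = \<zero>\<^bsub>FM\<^esub>"
      by (auto simp: free_simps)
    then show ?case
      by (simp add: \<theta>_zero)
  next
    case (Suc d)
    let ?p = "homogeneous_part K (Suc d) f"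
    define g where "g = f \<ominus>\<^bsub>FM\<^esub> ?p"
    have p: "?p \<in> carrier FM"
      using part_closed[OF M1_module Suc.prems(1), of "Suc d"] by (simp add: tuple_carrier[OF M1_module])
    have g: "g \<in> carrier FM"
      using Suc.prems(1) p by (simp add: g_def)
    have g_w: "g w = (if length w = Suc d then \<zero> else f w)" for w
      using FM_coeff[OF Suc.prems(1), of w] FA_a_inv[OF M1_module p, of w]
      by (simp add: g_def a_minus_def free_simps homogeneous_part_def K.r_neg)
    have part_g: "homogeneous_part K n g = (if n = Suc d then \<zero>\<^bsub>FM\<^esub> else homogeneous_part K n f)" for n
      by (auto simp: homogeneous_part_def g_w free_simps)
    have "\<theta> g = \<zero>\<^bsub>B\<^esub>"
    proof (rule Suc.IH[OF g])
      show "g [] = \<zero>"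
        using Suc.prems(2) by (simp add: g_w)
      show "\<theta> (homogeneous_part K n g) = \<zero>\<^bsub>B\<^esub>" if "n \<ge> 1" for n
        using Suc.prems(3)[OF that] by (simp add: part_g \<theta>_zero)
      show "length w \<le> d" if "g w \<noteq> \<zero>" for w
        using that Suc.prems(4)[of w] by (auto simp: g_w split: if_splits)
    qed
    moreover have "f = g \<oplus>\<^bsub>FM\<^esub> ?p"
      using Suc.prems(1) p by (simp add: g_def FM.M.minus_eq FM.M.a_assoc FM.M.l_neg)
    ultimately show ?case
      using \<theta>_rules(3)[OF g p] Suc.prems(3)[of "Suc d"] by simp
  qed
  have f: "f \<in> carrier FM" "f [] = \<zero>"
    using assms(1) by auto
  have "finite {w. f w \<noteq> \<zero>}"
    using f(1) by (simp add: free_carrier)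
  then have "finite (length ` {w. f w \<noteq> \<zero>})"
    by simp
  then obtain d where "\<And>w. f w \<noteq> \<zero> \<Longrightarrow> length w \<le> d"
    unfolding finite_nat_set_iff_bounded_le by blast
  moreover have "\<theta> (homogeneous_part K n f) = \<zero>\<^bsub>B\<^esub>" if "n \<ge> 1" for n
    using assms(2) that \<theta>_multilinear tensor_class_zero_iff[OF M1_module f(1)] by blast
  ultimately show ?thesis
    using * f by blast
qed

text \<open>Here \<open>FM\<close> modulo \<open>S\<close> is the unital tensor algebra. The ideal
  \<open>J\<close> obtained for it lies above \<open>C\<close> and meets the image of \<Theta> only
  in \<open>\<Theta> S\<close>, so \<theta> has no kernel beyond the tensor relations.\<close>

lemma \<theta>_zero_imp_tc_zero:
  assumes "f \<in> FMp" "\<theta> f = \<zero>\<^bsub>B\<^esub>"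
  shows "tc f = \<zero>\<^bsub>NTA\<^esub>"
proof -
  interpret N: module K NTA
    by (rule NTA_module[OF M1_module])
  define S where "S = {f \<in> FMp. tc f = \<zero>\<^bsub>NTA\<^esub>}"
  have "submodule S K FM"
    using submodule_vimage[OF FM.module_axioms N.module_axioms tc_hom FMp_submodule
        zero_submodule[OF N.module_axioms]]
    by (simp add: S_def)
  then have S: "ideal S FM"
  proof (rule FMp_ideal_imp_ideal)
    fix f g assume "f \<in> S" "g \<in> FMp"
    then have fg: "f \<in> carrier FM" "f [] = \<zero>" "tc f = tc \<zero>\<^bsub>FM\<^esub>" "g \<in> carrier FM" "g [] = \<zero>"
      by (auto simp: S_def tc_zero)
    have zero: "\<zero>\<^bsub>FM\<^esub> \<in> carrier FM" "\<zero>\<^bsub>FM\<^esub> [] = \<zero>"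
      by (simp, simp add: free_simps)
    note mult = tensor_class_mult[OF M1_module]
    \<comment> \<open>No ring laws have been established for \<open>NTA\<close>. Absorption is
      obtained by replacing \<open>f\<close> with zero inside \<open>FM\<close>, which has the same
      class and hence the same product classes.\<close>
    have "tc (g \<otimes>\<^bsub>FM\<^esub> f) = tc (g \<otimes>\<^bsub>FM\<^esub> \<zero>\<^bsub>FM\<^esub>)"
      unfolding mult[OF fg(4,5) fg(1,2)] mult[OF fg(4,5) zero] fg(3) ..
    moreover have "tc (f \<otimes>\<^bsub>FM\<^esub> g) = tc (\<zero>\<^bsub>FM\<^esub> \<otimes>\<^bsub>FM\<^esub> g)"
      unfolding mult[OF fg(1,2) fg(4,5)] mult[OF zero fg(4,5)] fg(3) ..
    ultimately show "g \<otimes>\<^bsub>FM\<^esub> f \<in> S \<and> f \<otimes>\<^bsub>FM\<^esub> g \<in> S"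
      using fg free_mult_Nil[OF K fg(4) fg(1)] free_mult_Nil[OF K fg(1) fg(4)]
      by (simp add: S_def tc_zero)
  qed (auto simp: S_def)
  have rel: "r \<in> S" if r: "r \<in> multilinear_relations K M1 1" for r
  proof -
    have r1: "r \<in> carrier (tuple_module K M1 1)"
      using multilinear_relations_closed[OF M1_module] r by blast
    then have "r \<in> carrier FM" "r [] = \<zero>"
      unfolding tuple_carrier[OF M1_module] by force+
    moreover have "homogeneous_part K n r \<in> multilinear_submodule K M1 n" for n
      using r Nn_relations[OF M1_module, of 1] submodule_zero[OF Nn_submodule_FA[OF M1_module]]
      by (auto simp: part_homogeneous[OF M1_module r1])
    ultimately show ?thesis
      by (simp add: S_def tensor_class_zero_iff[OF M1_module])
  qed
  obtain J where J: "ideal J F" "rels \<subseteq> J" "\<And>f. f \<in> carrier FM \<Longrightarrow> \<Theta> f \<in> J \<longleftrightarrow> f \<in> S"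
  proof (rule separating_extension[OF S])
    show "S \<subseteq> FMp"
      by (auto simp: S_def)
    show "W [m \<oplus>\<^bsub>A1\<^esub> n] \<ominus>\<^bsub>FM\<^esub> (W [m] \<oplus>\<^bsub>FM\<^esub> W [n]) \<in> S"
      if "m \<in> carrier M1" "n \<in> carrier M1" for m n
      using multilinear_relationsI(1)[OF M1_module, of "[]" "[]" m 1 n] that by (intro rel) simp
    show "W [c \<odot>\<^bsub>A1\<^esub> m] \<ominus>\<^bsub>FM\<^esub> c \<odot>\<^bsub>FM\<^esub> W [m] \<in> S"
      if "c \<in> carrier K" "m \<in> carrier M1" for c m
      using multilinear_relationsI(2)[OF M1_module, of "[]" "[]" m 1 c] that by (intro rel) simp
  qed (rule that)
  have "f \<in> carrier FM"
    using assms(1) by simp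
  then have "f \<in> S"
    using \<theta>_kernel_le[OF J(1,2) _ assms(2)] J(3) by blast
  then show ?thesis
    by (simp add: S_def)
qed

text \<open>On \<open>FMp\<close> the maps \<theta> and \<open>tc\<close> have the same kernel and
  are onto \<open>A\<close> and the tensor algebra; both are multiplicative there, so the induced
  bijection is too.\<close>

lemma A_isomorphic: "nonunital_alg_isomorphic K (B\<lparr>carrier := A\<rparr>) NTA"
proof -
  let ?L = "FM\<lparr>carrier := FMp\<rparr>"
  interpret N: module K NTA
    by (rule NTA_module[OF M1_module])
  have L: "module K ?L"
    by (rule submodule.submodule_is_module[OF FMp_submodule FM.module_axioms])
  have BA: "module K (B\<lparr>carrier := A\<rparr>)"
    by (rule submodule.submodule_is_module[OF A_submodule B.module_axioms])
  have p: "\<theta> \<in> mod_hom K ?L (B\<lparr>carrier := A\<rparr>)"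
    by (rule mod_homI) (simp_all add: A_eq \<theta>_rules)
  have surj: "\<theta> ` carrier ?L = carrier (B\<lparr>carrier := A\<rparr>)"
    by (simp add: A_eq)
  have h: "tc \<in> mod_hom K ?L NTA"
    by (rule mod_homI) (simp_all add: tc_rules)
  obtain j where j: "j \<in> mod_hom K (B\<lparr>carrier := A\<rparr>) NTA" "inj_on j (carrier (B\<lparr>carrier := A\<rparr>))"
    "\<And>f. f \<in> carrier ?L \<Longrightarrow> j (\<theta> f) = tc f"
  proof (rule factor_mod_hom[OF L BA N.module_axioms p surj h])
    show "\<theta> f = \<zero>\<^bsub>B\<lparr>carrier := A\<rparr>\<^esub> \<longleftrightarrow> tc f = \<zero>\<^bsub>NTA\<^esub>" if "f \<in> carrier ?L" for f
      using that \<theta>_zero_imp_tc_zero[of f] tc_zero_imp_\<theta>_zero[of f] by auto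
  qed (rule that)
  have "j ` A = tc ` FMp"
    unfolding A_eq image_image using j(3) by (intro image_cong) simp_all
  then have "j ` A = carrier NTA"
    using tensor_class_surj[OF M1_module] by simp
  then have bij: "bij_betw j A (carrier NTA)"
    using j(2) by (simp add: bij_betw_def)
  have "j (u \<otimes>\<^bsub>B\<^esub> v) = j u \<otimes>\<^bsub>NTA\<^esub> j v" if uv: "u \<in> A" "v \<in> A" for u v
  proof -
    obtain f g where fg: "f \<in> FMp" "u = \<theta> f" "g \<in> FMp" "v = \<theta> g"
      using uv unfolding A_eq by blast
    then have f: "f \<in> carrier FM" "f [] = \<zero>" and g: "g \<in> carrier FM" "g [] = \<zero>"
      by auto
    have "f \<otimes>\<^bsub>FM\<^esub> g \<in> FMp"
      using f g free_mult_Nil[OF K f(1) g(1)] by simp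
    then have "j (\<theta> (f \<otimes>\<^bsub>FM\<^esub> g)) = tc f \<otimes>\<^bsub>NTA\<^esub> tc g"
      using j(3)[of "f \<otimes>\<^bsub>FM\<^esub> g"] tensor_class_mult[OF M1_module f g] by simp
    then show ?thesis
      using j(3)[of f] j(3)[of g] fg \<theta>_rules(5)[OF f(1) g(1)] by simp
  qed
  with j(1) bij show ?thesis
    unfolding nonunital_alg_isomorphic_def by (intro bexI[of _ j]) simp_all
qed

end

theorem theorem15:
  fixes K :: "('k, 'm) ring_scheme"
    and A1 :: "('k, 'a, 'n) module_scheme"
    and A2 :: "('k, 'b, 'p) module_scheme"
    and \<pi> :: "'a \<Rightarrow> 'k"
    and \<psi> :: "'b \<Rightarrow> (nat \<Rightarrow> 'k) set"
    and x :: 'b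
  assumes "cring K"
    and "assoc_algebra K A1"
    and "assoc_algebra K A2"
    and "\<pi> \<in> mod_hom K A1 (base_algebra K)"
    and "\<And>c. c \<in> carrier K \<Longrightarrow> \<pi> (c \<odot>\<^bsub>A1\<^esub> \<one>\<^bsub>A1\<^esub>) = c"
    and "\<psi> \<in> alg_hom K A2 (truncated_poly K)"
    and "\<psi> ` carrier A2 = carrier (truncated_poly K)"
    and "x \<in> carrier A2"
    and "\<psi> x = truncated_x K"
    and M1_eq: "M1 = A1\<lparr>carrier := a_kernel A1 (base_algebra K) \<pi>\<rparr>"
    and B_eq: "B = coprod_algebra K A1 A2"
    and xMx_eq: "xMx = (\<lambda>m. coprod_inr K A1 A2 x \<otimes>\<^bsub>B\<^esub> coprod_inl K A1 A2 m \<otimes>\<^bsub>B\<^esub> coprod_inr K A1 A2 x)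
                    ` carrier M1"
    and A_eq: "A = nonunital_subalgebra_generated K B xMx"
  shows "submodule xMx K B \<and>
    mod_isomorphic K (B\<lparr>carrier := xMx\<rparr>) M1 \<and>
    nonunital_alg_isomorphic K (B\<lparr>carrier := A\<rparr>) (nonunital_tensor_algebra K M1) \<and>
    ideal_extension_property A K B \<and>
    (\<forall>A0 :: ('k, 'c, 'q) module_scheme.
      assoc_algebra K A0 \<and>
      (\<exists>\<epsilon>. \<epsilon> \<in> alg_hom K A0 (base_algebra K)) \<and>
      (\<exists>f \<in> mod_hom K M1 A0. unital_subalgebra_generated K A0 (f ` carrier M1) = carrier A0)
      \<longrightarrow>
      (\<exists>(R :: ('k, (('a + 'b) list \<Rightarrow> 'k) set) module) j0 j1 j2.
        assoc_algebra K R \<and>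
        j0 \<in> alg_hom K A0 R \<and> inj_on j0 (carrier A0) \<and>
        j1 \<in> alg_hom K A1 R \<and> inj_on j1 (carrier A1) \<and>
        j2 \<in> alg_hom K A2 R \<and> inj_on j2 (carrier A2) \<and>
        unital_subalgebra_generated K R (j1 ` carrier A1 \<union> j2 ` carrier A2) = carrier R))"
proof -
  interpret S: split_pair K A1 A2 \<pi> \<psi> x
    by (rule split_pair.intro) fact+
  have M1: "M1 = S.M1"
    unfolding M1_eq S.M1_def ..
  have X: "xMx = S.\<tau> ` carrier S.M1"
    unfolding xMx_eq B_eq M1 by (rule image_cong) (simp_all only: S.\<tau>_def)
  show ?thesis
    unfolding A_eq X unfolding B_eq M1
    using S.xMx_submodule S.xMx_isomorphic S.A_isomorphic S.A_ideal_extension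
      S.augmented_algebra_embeds
    by blast
qed

end
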